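(* Let $G=\{g_1,\dots,g_m\}\subseteq\mathbb{R}[X]=\mathbb{R}[x_1,\dots,x_n]$ and let $K_G=\{x\in\mathbb{R}^n : g_1(x)\ge 0,\dots,g_m(x)\ge 0\}$. Let $f:\mathbb{R}^n\to\mathbb{R}$ be a Morse polynomial function. Assume that: (1) $K_G$ is compact (resp. the quadratic module $M_G$ is Archimedean); (2) $f\ge 0$ on $K_G$, and $f$ has only finitely many zeros $p_1,\dots,p_r$ in $K_G$, each lying in the interior of $K_G$. Then $f\in T_G$ (resp. $f\in M_G$).
   Context: $\sum\mathbb{R}[X]^2$ is the set of finite sums of squares of polynomials in $\mathbb{R}[X]$. The quadratic module generated by $G$ is $M_G=\{s_0+\sum_{i=1}^m s_i g_i : s_0,\dots,s_m\in\sum\mathbb{R}[X]^2\}$. The preordering generated by $G$ is $T_G=\{\sum_{\sigma\in\{0,1\}^m}s_\sigma g_1^{\sigma_1}\cdots g_m^{\sigma_m} : s_\sigma\in\sum\mathbb{R}[X]^2\}$. $M_G$ is Archimedean if for every $p\in\mathbb{R}[X]$ there is a positive integer $k$ with $k+p\in M_G$ and $k-p\in M_G$. A polynomial function $f:\mathbb{R}^n\to\mathbb{R}$ is Morse if at every critical point $p\in\mathbb{R}^n$ of $f$ the Hessian matrix $D^2f(p)$ is invertible. The interior of $K_G$ is its topological interior in $\mathbb{R}^n$. *)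

theory Defs
  imports "HOL-Analysis.Analysis" "HOL-Library.Poly_Mapping" "HOL-Library.FuncSet"
begin

text \<open>A polynomial maps each exponent vector to its coefficient; multiplication on the type
  is convolution, so this is the ring of real polynomials in the finitely many variables
  indexed by \<^typ>\<open>'n\<close>.\<close>

type_synonym 'n real_mpoly = "('n \<Rightarrow>\<^sub>0 nat) \<Rightarrow>\<^sub>0 real"

definition mpoly_eval :: "'n::finite real_mpoly \<Rightarrow> real ^ 'n \<Rightarrow> real" where
  "mpoly_eval p x = (\<Sum>a\<in>Poly_Mapping.keys p.
     Poly_Mapping.lookup p a * (\<Prod>i\<in>UNIV. (x $ i) ^ Poly_Mapping.lookup a i))"

definition sums_of_squares :: "'a::comm_ring_1 set" where
  "sums_of_squares = {\<Sum>i<k. (q i)\<^sup>2 | (k::nat) q. True}"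

text \<open>In the next definitions the generators are \<open>g 1, \<dots>, g m\<close>; the values of \<open>g\<close> at
  other indices are irrelevant.  In the quadratic module, \<open>s 0\<close> is the summand without a
  generator.\<close>

definition generated_quadratic_module :: "nat \<Rightarrow> (nat \<Rightarrow> 'a::comm_ring_1) \<Rightarrow> 'a set" where
  "generated_quadratic_module m g =
     {s 0 + (\<Sum>i=1..m. s i * g i) | s. \<forall>i\<le>m. s i \<in> sums_of_squares}"

definition generated_preordering :: "nat \<Rightarrow> (nat \<Rightarrow> 'a::comm_ring_1) \<Rightarrow> 'a set" where
  "generated_preordering m g =
     {\<Sum>\<sigma>\<in>{1..m} \<rightarrow>\<^sub>E {0, 1::nat}. s \<sigma> * (\<Prod>i=1..m. g i ^ \<sigma> i) | s.
        \<forall>\<sigma>\<in>{1..m} \<rightarrow>\<^sub>E {0, 1}. s \<sigma> \<in> sums_of_squares}"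

definition archimedean :: "'a::comm_ring_1 set \<Rightarrow> bool" where
  "archimedean M \<longleftrightarrow> (\<forall>p. \<exists>k::nat. k > 0 \<and> of_nat k + p \<in> M \<and> of_nat k - p \<in> M)"

definition nonneg_set :: "nat \<Rightarrow> (nat \<Rightarrow> 'n::finite real_mpoly) \<Rightarrow> (real ^ 'n) set" where
  "nonneg_set m g = {x. \<forall>i\<in>{1..m}. mpoly_eval (g i) x \<ge> 0}"

definition partial_deriv :: "'n::finite \<Rightarrow> (real ^ 'n \<Rightarrow> real) \<Rightarrow> real ^ 'n \<Rightarrow> real" where
  "partial_deriv i f x = frechet_derivative f (at x) (axis i 1)"

definition hessian :: "(real ^ 'n::finite \<Rightarrow> real) \<Rightarrow> real ^ 'n \<Rightarrow> real ^ 'n ^ 'n" where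
  "hessian f x = (\<chi> i j. partial_deriv i (partial_deriv j f) x)"

text \<open>This is intended for smooth \<open>f\<close>, in particular polynomial functions, as
  \<^const>\<open>frechet_derivative\<close> is unspecified where \<open>f\<close> is not differentiable.\<close>

definition morse :: "(real ^ 'n::finite \<Rightarrow> real) \<Rightarrow> bool" where
  "morse f \<longleftrightarrow> (\<forall>p. (f has_derivative (\<lambda>_. 0)) (at p) \<longrightarrow> invertible (hessian f p))"

end

(*
The Positivstellensatz over the reals comes from a transfer of sign conditions between real closed
fields: the prime cone that a counterexample would produce has a real closure, namely the
subfield of differences of a maximal cone in an algebraic closure, and by elimination of variables every finite
system of sign conditions solvable there is solvable over the reals. By Woermann's argument a
preordering with compact nonnegativity set is then Archimedean, so that both claims concern an
Archimedean quadratic module M, for which positive polynomials belong to M.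

At an interior zero of f the Hessian is positive semidefinite and invertible, hence positive
definite, and f = sum B_kl (x - p)_k (x - p)_l with B(p) positive definite. If p is the only zero,
a multiple of |y|^2 I - y y^T, y = x - p, makes the matrix uniformly positive definite without
changing f, and completing squares with polynomial approximations of the quotients gives f in M.
Several zeros are separated one at a time by writing f = e^4 F + s c with s and e^4 squares, where
F vanishes at one zero only and c at the remaining ones.
*)
theory Submission
  imports "HOL-Algebra.Algebraic_Closure_Type" "HOL-Computational_Algebra.Computational_Algebra" Defs
begin

section \<open>Polynomials over real closed fields\<close>

text \<open>Elimination follows Cohen and Hormander, but no formulas are eliminated: two ring
  homomorphisms into real closed fields are compared, and an order isomorphism of their root sets is
  built from the agreement of finitely many coefficient signs. Of real closedness only the
  intermediate value property for polynomials is used. For the real closure, one set in an algebraic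
  closure encodes both a subfield and its ordering, so a single application of Zorn's lemma
  suffices.

  Two obstacles shape the rest. A quadratic module is not closed under products, so every multiplier
  has to be a square or a sum of squares. And membership by strict positivity fails for f itself,
  which has zeros; it is applied instead to the diagonal coefficients met while completing squares.
  Unlike nonnegativity of f, uniform positive definiteness of its matrix is an open condition and
  survives the replacement of quotients by polynomials. Zeros have to be interior because the
  Hessian argument needs f to be nonnegative in every direction.\<close>

class real_closed_field = linordered_field +
  assumes polynomial_ivt: "a < b \<Longrightarrow> (\<Sum>k\<le>n. f k * a ^ k) < 0 \<Longrightarrow> 0 < (\<Sum>k\<le>n. f k * b ^ k) \<Longrightarrow>
    \<exists>c. a < c \<and> c < b \<and> (\<Sum>k\<le>n. f k * c ^ k) = 0"

text \<open>Integer values make signs from two different ordered fields comparable;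
  \<open>sgn\<close> would stay in the field.\<close>

definition sg :: "'a::linordered_idom \<Rightarrow> int" where
  "sg x = (if 0 < x then 1 else if x < 0 then -1 else 0)"

lemma sg_0 [simp]: "sg 0 = 0"
  by (simp add: sg_def)

lemma sg_minus [simp]: "sg (- x) = - sg x"
  by (simp add: sg_def)

lemma sg_mult: "sg (x * y) = sg x * sg y"
  by (auto simp: sg_def zero_less_mult_iff mult_less_0_iff)

lemma sg_eq_0_iff [simp]: "sg x = 0 \<longleftrightarrow> x = 0"
  by (auto simp: sg_def)

lemma sg_power: "sg (x ^ n) = sg x ^ n"
  by (induct n) (auto simp: sg_mult, simp add: sg_def)

section \<open>Intermediate values, Rolle's theorem and monotonicity\<close>

lemma rcf_ivt:
  fixes p :: "'a::real_closed_field poly"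
  assumes "a < b" "sg (poly p a) * sg (poly p b) = -1"
  shows "\<exists>c. a < c \<and> c < b \<and> poly p c = 0"
proof -
  have *: "\<exists>c. a < c \<and> c < b \<and> poly p c = 0" if "poly p a < 0" "0 < poly p b" for p :: "'a poly"
    using polynomial_ivt[OF assms(1), where n = "degree p" and f = "coeff p"] that
    by (simp add: poly_altdef)
  consider "poly p a < 0" "0 < poly p b" | "0 < poly p a" "poly p b < 0"
    using assms(2) by (auto simp: sg_def split: if_splits)
  then show ?thesis
  proof cases
    case 1 then show ?thesis by (rule *)
  next
    case 2 then show ?thesis using *[of "-p"] by simp
  qed
qed

lemma sg_prod_neg: "sg x \<noteq> 0 \<Longrightarrow> sg y \<noteq> 0 \<Longrightarrow> sg x \<noteq> sg y \<Longrightarrow> sg x * sg y = -1"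
  by (auto simp: sg_def split: if_splits)

lemma rcf_sg_const:
  fixes p :: "'a::real_closed_field poly"
  assumes "a < b" "\<And>c. a \<le> c \<Longrightarrow> c \<le> b \<Longrightarrow> poly p c \<noteq> 0"
  shows "sg (poly p a) = sg (poly p b)"
proof (rule ccontr)
  assume "sg (poly p a) \<noteq> sg (poly p b)"
  then have "sg (poly p a) * sg (poly p b) = -1"
    using assms by (intro sg_prod_neg) auto
  from rcf_ivt[OF assms(1) this] show False using assms(2) by auto
qed

lemma rcf_rolle_consecutive:
  fixes p :: "'a::real_closed_field poly"
  assumes ab: "a < b" and p0: "p \<noteq> 0" and pa: "poly p a = 0" and pb: "poly p b = 0"
    and no: "\<And>c. a < c \<Longrightarrow> c < b \<Longrightarrow> poly p c \<noteq> 0"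
  shows "\<exists>c. a < c \<and> c < b \<and> poly (pderiv p) c = 0"
proof -
  obtain q where q: "p = [:-a,1:] ^ order a p * q" "\<not> [:-a,1:] dvd q"
    using order_decomp[OF p0] by blast
  obtain m where m: "order a p = Suc m"
    using pa p0 order_root by (metis not0_implies_Suc)
  have q0: "q \<noteq> 0" using q(2) by auto
  obtain g where g: "q = [:-b,1:] ^ order b q * g" "\<not> [:-b,1:] dvd g"
    using order_decomp[OF q0] by blast
  have "poly q b = 0"
    using pb q(1) ab by (metis (no_types, lifting) add.inverse_inverse diff_gt_0_iff_gt less_irrefl mult_eq_0_iff poly_mult poly_power poly_pCons poly_0 power_eq_0_iff add_uminus_conv_diff mult.right_neutral mult_zero_right add_0_right add.commute)
  then obtain n where n: "order b q = Suc n"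
    using q0 order_root by (metis not0_implies_Suc)
  have "poly q a \<noteq> 0" using q(2) by (simp add: poly_eq_0_iff_dvd)
  then have ga: "poly g a \<noteq> 0" using g(1) by (metis mult_zero_right poly_mult)
  have gb: "poly g b \<noteq> 0" using g(2) by (auto simp: poly_eq_0_iff_dvd[symmetric])
  have pe: "p = [:-a,1:] ^ Suc m * ([:-b,1:] ^ Suc n * g)"
    using q(1) g(1) m n by simp
  have "poly g c \<noteq> 0" if "a \<le> c" "c \<le> b" for c
  proof (cases "c = a \<or> c = b")
    case True then show ?thesis using ga gb by blast
  next
    case False
    then have "poly p c \<noteq> 0" using that no by (simp add: order.strict_iff_order)
    then show ?thesis by (subst (asm) pe) auto
  qed
  then have sgg: "sg (poly g a) = sg (poly g b)"
    using rcf_sg_const[OF ab] by blast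
  define A B where "A = [:-a,1:]" and "B = [:-b,1:]"
  \<comment> \<open>The derivative without its factors \<open>A ^ m\<close> and
    \<open>B ^ n\<close>. At a only the first summand survives, at b only the second, with factors a
    - b and b - a of opposite sign.\<close>
  define r where "r = of_nat (Suc m) * (B * g) + of_nat (Suc n) * (A * g) + A * B * pderiv g"
  have sm: "smult (of_nat k) u = of_nat k * u" for k and u :: "'a poly"
    by (simp add: of_nat_poly)
  have d1: "pderiv A = 1" "pderiv B = 1" by (simp_all add: A_def B_def pderiv_pCons one_pCons)
  have pd: "pderiv p = A ^ m * B ^ n * r"
    unfolding pe r_def A_def[symmetric] B_def[symmetric] pderiv_mult pderiv_power_Suc sm d1
    by (simp add: algebra_simps del: of_nat_Suc)
  have ra: "poly r a = of_nat (Suc m) * ((a - b) * poly g a)"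
    and rb: "poly r b = of_nat (Suc n) * ((b - a) * poly g b)"
    by (simp_all add: r_def A_def B_def algebra_simps del: of_nat_Suc)
  have sn: "sg (of_nat (Suc k) :: 'a) = 1" for k by (simp add: sg_def del: of_nat_Suc)
  have "sg (poly r a) = - sg (poly g a)"
    unfolding ra sg_mult sn using ab by (simp add: sg_def)
  moreover have "sg (poly r b) = sg (poly g b)"
    unfolding rb sg_mult sn using ab by (simp add: sg_def)
  ultimately have "sg (poly r a) * sg (poly r b) = -1"
    using sgg ga by (auto simp: sg_def split: if_splits)
  from rcf_ivt[OF ab this] obtain c where "a < c" "c < b" "poly r c = 0" by blast
  then show ?thesis
    using pd by auto
qed

lemma rcf_rolle:
  fixes p :: "'a::real_closed_field poly"
  assumes ab: "a < b" and pa: "poly p a = 0" and pb: "poly p b = 0"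
  shows "\<exists>c. a < c \<and> c < b \<and> poly (pderiv p) c = 0"
proof (cases "p = 0")
  case True
  then show ?thesis using dense[OF ab] by auto
next
  case False
  define R where "R = {c. a < c \<and> c \<le> b \<and> poly p c = 0}"
  have fin: "finite R" unfolding R_def
    by (rule finite_subset[OF _ poly_roots_finite[OF False]]) auto
  have "b \<in> R" using ab pb by (simp add: R_def)
  define d where "d = Min R"
  have d: "d \<in> R" using fin \<open>b \<in> R\<close> unfolding d_def by (metis Min_in empty_iff)
  have "poly p c \<noteq> 0" if "a < c" "c < d" for c
  proof
    assume "poly p c = 0"
    then have "c \<in> R" using that d by (auto simp: R_def)
    then show False using that(2) fin unfolding d_def by (metis Min_le not_le)
  qed
  then have "\<exists>c. a < c \<and> c < d \<and> poly (pderiv p) c = 0"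
    using d False pa by (intro rcf_rolle_consecutive) (auto simp: R_def)
  then show ?thesis using d by (force simp: R_def)
qed

lemma rcf_mvt:
  fixes p :: "'a::real_closed_field poly"
  assumes ab: "a < b"
  shows "\<exists>c. a < c \<and> c < b \<and> poly p b - poly p a = (b - a) * poly (pderiv p) c"
proof -
  define s where "s = (poly p b - poly p a) / (b - a)"
  define q where "q = p - [:poly p a - s * a, s:]"
  have "poly q a = 0" "poly q b = 0"
    using ab by (simp_all add: q_def s_def algebra_simps)
      (simp_all add: divide_simps, simp_all add: algebra_simps)
  from rcf_rolle[OF ab this] obtain c where c: "a < c" "c < b" "poly (pderiv q) c = 0" by blast
  have "poly (pderiv p) c = s"
    using c(3) by (simp add: q_def pderiv_diff pderiv_pCons)
  then show ?thesis using c ab by (auto simp: s_def intro!: exI[of _ c])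
qed

lemma rcf_monotone:
  fixes p :: "'a::real_closed_field poly"
  assumes ab: "a < b" and "\<And>c. a < c \<Longrightarrow> c < b \<Longrightarrow> sg (poly (pderiv p) c) = s"
  shows "sg (poly p b - poly p a) = s"
proof -
  obtain c where c: "a < c" "c < b" "poly p b - poly p a = (b - a) * poly (pderiv p) c"
    using rcf_mvt[OF ab] by blast
  then have "sg (poly p b - poly p a) = sg (b - a) * sg (poly (pderiv p) c)"
    by (simp add: sg_mult)
  then show ?thesis using ab assms(2)[OF c(1,2)] by (simp add: sg_def)
qed

section \<open>Signs of a polynomial near plus and minus infinity\<close>

lemma poly_eventually_ge_lead_coeff:
  fixes p :: "'a::linordered_field poly"
  assumes "0 < lead_coeff p"
  shows "\<exists>B. \<forall>x\<ge>B. lead_coeff p \<le> poly p x"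
  using assms
proof (induct p)
  case 0 then show ?case by simp
next
  case (pCons a q)
  show ?case
  proof (cases "q = 0")
    case True then show ?thesis by simp
  next
    case False
    have l2: "lead_coeff (pCons a q) = lead_coeff q" using False by simp
    have l1: "0 < lead_coeff q" using pCons(3) l2 by simp
    from pCons(2)[OF l1] obtain B where B: "\<And>x. x \<ge> B \<Longrightarrow> lead_coeff q \<le> poly q x" by blast
    \<comment> \<open>The threshold makes x times the leading coefficient at least that coefficient
      plus |a|, which pays for the constant term \<open>a\<close>.\<close>
    have *: "lead_coeff q \<le> poly (pCons a q) x" if x: "x \<ge> max B (1 + \<bar>a\<bar> / lead_coeff q)" for x
    proof -
      have x1: "1 + \<bar>a\<bar> / lead_coeff q \<le> x" and xB: "B \<le> x" using x by auto
      have x0: "0 \<le> x" using x1 l1 by (smt (verit, del_insts) abs_ge_zero divide_nonneg_pos add_nonneg_nonneg order_trans zero_le_one)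
      have "lead_coeff q + \<bar>a\<bar> = (1 + \<bar>a\<bar> / lead_coeff q) * lead_coeff q"
        using l1 by (simp add: distrib_right del: leading_coeff_0_iff)
      also have "\<dots> \<le> x * lead_coeff q" using x1 l1 by (intro mult_right_mono) auto
      also have "\<dots> \<le> x * poly q x" using B[OF xB] x0 by (intro mult_left_mono) auto
      finally have h: "lead_coeff q + \<bar>a\<bar> \<le> x * poly q x" .
      have "0 \<le> a + \<bar>a\<bar>" using abs_ge_minus_self[of a] by (simp add: minus_le_iff add.commute)
      then have "lead_coeff q + \<bar>a\<bar> \<le> (a + \<bar>a\<bar>) + x * poly q x" using h by (rule add_increasing)
      then show ?thesis by (simp add: algebra_simps)
    qed
    show ?thesis unfolding l2 using * by blast
  qed
qed

lemma sg_poly_at_top: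
  fixes p :: "'a::linordered_field poly"
  shows "\<exists>B. \<forall>x\<ge>B. sg (poly p x) = sg (lead_coeff p)"
proof -
  have *: "\<exists>B. \<forall>x\<ge>B. sg (poly p x) = sg (lead_coeff p)" if "0 < lead_coeff p" for p :: "'a poly"
  proof -
    from that obtain B where "\<forall>x\<ge>B. lead_coeff p \<le> poly p x" using poly_eventually_ge_lead_coeff by blast
    then have "\<forall>x\<ge>B. sg (poly p x) = sg (lead_coeff p)"
      using that by (auto simp: sg_def dest: less_le_trans)
    then show ?thesis by blast
  qed
  consider "p = 0" | "0 < lead_coeff p" | "0 < lead_coeff (- p)"
    by (metis lead_coeff_minus leading_coeff_0_iff neg_0_less_iff_less linorder_neqE)
  then show ?thesis
  proof cases
    case 3
    then show ?thesis using *[OF 3] by simp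
  qed (use * in auto)
qed

lemma lead_coeff_reflect_arg:
  fixes p :: "'a::idom poly"
  shows "lead_coeff (p \<circ>\<^sub>p [:0, -1:]) = (-1) ^ degree p * lead_coeff p"
  by (subst lead_coeff_comp) (auto simp: mult.commute)

lemma sg_poly_at_bot:
  fixes p :: "'a::linordered_field poly"
  shows "\<exists>B. \<forall>x\<le>B. sg (poly p x) = (-1) ^ degree p * sg (lead_coeff p)"
proof -
  obtain B where B: "\<forall>x\<ge>B. sg (poly (p \<circ>\<^sub>p [:0, -1:]) x) = sg (lead_coeff (p \<circ>\<^sub>p [:0, -1:]))"
    using sg_poly_at_top by blast
  have "sg (poly p x) = (-1) ^ degree p * sg (lead_coeff p)" if "x \<le> -B" for x
    using B[rule_format, of "-x"] that
    unfolding lead_coeff_reflect_arg poly_pcompose sg_mult sg_power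
    by (simp add: sg_def algebra_simps)
  then show ?thesis by blast
qed

instance real :: real_closed_field
proof
  fix a b :: real and n f
  assume ab: "a < b" "(\<Sum>k\<le>n. f k * a ^ k) < 0" "0 < (\<Sum>k\<le>n. f k * b ^ k)"
  define p where "p = (\<Sum>k\<le>n. monom (f k) k)"
  have p: "poly p x = (\<Sum>k\<le>n. f k * x ^ k)" for x by (simp add: p_def poly_sum poly_monom)
  show "\<exists>c. a < c \<and> c < b \<and> (\<Sum>k\<le>n. f k * c ^ k) = 0"
    using poly_IVT_pos[of a b p] ab unfolding p by blast
qed


section \<open>Cells cut out by a finite set of points\<close>

text \<open>\<open>y\<close> and \<open>y'\<close> have the same position relative to
  \<open>U\<close> and to its image: at corresponding points or in corresponding gaps. With
  \<open>h\<close> the identity, both lie in one cell of \<open>U\<close>.\<close>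

definition match :: "'a::linordered_idom set \<Rightarrow> ('a \<Rightarrow> 'b::linordered_idom) \<Rightarrow> 'a \<Rightarrow> 'b \<Rightarrow> bool" where
  "match U h y y' \<longleftrightarrow> (\<forall>u\<in>U. sg (u - y) = sg (h u - y'))"

lemma sg_diff_eq_iff:
  "sg (a - b) = sg (c - d) \<longleftrightarrow> (a < b \<longleftrightarrow> c < d) \<and> (b < a \<longleftrightarrow> d < c)"
  by (auto simp: sg_def)

lemma match_iff: "match U h y y' \<longleftrightarrow> (\<forall>u\<in>U. (u < y \<longleftrightarrow> h u < y') \<and> (y < u \<longleftrightarrow> y' < h u))"
  by (simp add: match_def sg_diff_eq_iff)

lemma strict_mono_onD_iff:
  fixes h :: "'a::linorder \<Rightarrow> 'b::linorder"
  assumes "strict_mono_on U h" "a \<in> U" "b \<in> U"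
  shows "h a < h b \<longleftrightarrow> a < b" "h a = h b \<longleftrightarrow> a = b"
  using assms unfolding strict_mono_on_def by (metis less_asym less_irrefl linorder_neqE)+

lemma match_point:
  "strict_mono_on U h \<Longrightarrow> u \<in> U \<Longrightarrow> match U h u (h u)"
  by (simp add: match_iff strict_mono_onD_iff)

lemma finite_separation:
  fixes A B :: "'a::linordered_field set"
  assumes "finite A" "finite B" "\<And>a b. a \<in> A \<Longrightarrow> b \<in> B \<Longrightarrow> a < b"
  shows "\<exists>x. (\<forall>a\<in>A. a < x) \<and> (\<forall>b\<in>B. x < b)"
proof -
  obtain l where l: "\<forall>a\<in>A. a \<le> l" "B \<noteq> {} \<Longrightarrow> l < Min B"
  proof (cases "A = {}")
    case True
    show ?thesis by (rule that[of "Min B - 1"]) (use True in auto)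
  next
    case False
    show ?thesis
      by (rule that[of "Max A"]) (use False assms in auto)
  qed
  obtain x where x: "l < x" "B \<noteq> {} \<Longrightarrow> x < Min B"
    using l(2) dense gt_ex by metis
  have "x < b" if "b \<in> B" for b
    using x(2) that assms(2) by (metis Min_le empty_iff less_le_trans)
  then show ?thesis using l(1) x(1) by (metis le_less_trans)
qed

text \<open>An ordered field is dense and has no end points, so every position relative to a finite
  set can be copied along an order embedding, as in a back-and-forth argument.\<close>

lemma match_exists:
  fixes h :: "'a::linordered_field \<Rightarrow> 'b::linordered_field"
  assumes "finite U" "strict_mono_on U h"
  shows "\<exists>y'. match U h y y'"
proof (cases "y \<in> U")
  case True then show ?thesis using match_point assms by blast
next
  case False
  have "\<exists>x. (\<forall>a\<in>h ` {u\<in>U. u < y}. a < x) \<and> (\<forall>b\<in>h ` {u\<in>U. y < u}. x < b)"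
  proof (rule finite_separation)
    fix a b assume "a \<in> h ` {u\<in>U. u < y}" "b \<in> h ` {u\<in>U. y < u}"
    then show "a < b" using assms(2) by (auto simp: strict_mono_onD_iff)
  qed (use assms in auto)
  then obtain x where x: "\<And>u. u \<in> U \<Longrightarrow> u < y \<Longrightarrow> h u < x" "\<And>u. u \<in> U \<Longrightarrow> y < u \<Longrightarrow> x < h u"
    by auto
  have "match U h y x"
    unfolding match_iff
  proof
    fix u assume u: "u \<in> U"
    then consider "u < y" | "y < u" using False by (metis linorder_neqE)
    then show "(u < y \<longleftrightarrow> h u < x) \<and> (y < u \<longleftrightarrow> x < h u)"
      using x[OF u] by (metis less_asym)
  qed
  then show ?thesis ..
qed

lemma match_exists_rev:
  fixes h :: "'a::linordered_field \<Rightarrow> 'b::linordered_field"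
  assumes "finite U" "strict_mono_on U h"
  shows "\<exists>y. match U h y y'"
proof -
  define g where "g = the_inv_into U h"
  have inj: "inj_on h U" using assms(2) by (rule strict_mono_on_imp_inj_on)
  have g: "g (h u) = u" if "u \<in> U" for u
    using that inj by (simp add: g_def the_inv_into_f_f)
  have "strict_mono_on (h ` U) g"
    using assms(2) g by (auto simp: strict_mono_on_def strict_mono_onD_iff)
  then obtain y where "match (h ` U) g y' y" using match_exists assms(1) by blast
  then have "match U h y y'" using g by (auto simp: match_iff)
  then show ?thesis ..
qed

text \<open>Sign of \<open>p\<close> at the left end of the cell of \<open>y\<close>. The leftmost
  cell ends at minus infinity, where the sign comes from the leading coefficient and the parity of
  the degree; \<open>rsign\<close> does the same on the right.\<close>

definition lsign :: "'a::linordered_field set \<Rightarrow> 'a poly \<Rightarrow> 'a \<Rightarrow> int" where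
  "lsign U p y = (if \<exists>u\<in>U. u < y then sg (poly p (Max {u\<in>U. u < y}))
     else (-1) ^ degree p * sg (lead_coeff p))"

definition rsign :: "'a::linordered_field set \<Rightarrow> 'a poly \<Rightarrow> 'a \<Rightarrow> int" where
  "rsign U p y = (if \<exists>u\<in>U. y < u then sg (poly p (Min {u\<in>U. y < u})) else sg (lead_coeff p))"

text \<open>An end at infinity is replaced by a point far enough to the left, so bounded and
  unbounded cells are treated alike.\<close>

lemma lsign_witness:
  assumes "finite U"
  shows "\<exists>a<w. sg (poly p a) = lsign U p w \<and> (\<forall>u\<in>U. \<not> (a < u \<and> u < w))"
proof (cases "\<exists>u\<in>U. u < w")
  case True
  define a where "a = Max {u\<in>U. u < w}"
  have fin: "finite {u\<in>U. u < w}" using assms by simp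
  have "a \<in> {u\<in>U. u < w}" unfolding a_def using True fin by (intro Max_in) auto
  moreover have "u \<le> a" if "u \<in> U" "u < w" for u
    unfolding a_def using that fin by auto
  moreover have "lsign U p w = sg (poly p a)" using True by (simp add: lsign_def a_def)
  ultimately show ?thesis by (intro exI[of _ a]) force
next
  case False
  obtain B where B: "\<forall>x\<le>B. sg (poly p x) = (-1) ^ degree p * sg (lead_coeff p)"
    using sg_poly_at_bot by blast
  obtain a where "a < min B w" using lt_ex by blast
  moreover have "lsign U p w = (-1) ^ degree p * sg (lead_coeff p)"
    unfolding lsign_def using False by (rule if_not_P)
  ultimately show ?thesis using False B by (intro exI[of _ a]) auto
qed

lemma rsign_witness:
  assumes "finite U"
  shows "\<exists>b>w. sg (poly p b) = rsign U p w \<and> (\<forall>u\<in>U. \<not> (w < u \<and> u < b))"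
proof (cases "\<exists>u\<in>U. w < u")
  case True
  define a where "a = Min {u\<in>U. w < u}"
  have fin: "finite {u\<in>U. w < u}" using assms by simp
  have "a \<in> {u\<in>U. w < u}" unfolding a_def using True fin by (intro Min_in) auto
  moreover have "a \<le> u" if "u \<in> U" "w < u" for u
    unfolding a_def using that fin by auto
  moreover have "rsign U p w = sg (poly p a)" using True by (simp add: rsign_def a_def)
  ultimately show ?thesis by (intro exI[of _ a]) force
next
  case False
  obtain B where B: "\<forall>x\<ge>B. sg (poly p x) = sg (lead_coeff p)"
    using sg_poly_at_top by blast
  obtain a where "max B w < a" using gt_ex by blast
  moreover have "rsign U p w = sg (lead_coeff p)"
    unfolding rsign_def using False by (rule if_not_P)
  ultimately show ?thesis using False B by (intro exI[of _ a]) auto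
qed

lemma same_cell_interval:
  assumes "w \<notin> U" "\<forall>u\<in>U. \<not> (a < u \<and> u < w)" "\<forall>u\<in>U. \<not> (w < u \<and> u < b)" "a < z" "z < b" "a < w" "w < b"
  shows "match U (\<lambda>u. u) w z"
  unfolding match_iff
proof
  fix u assume u: "u \<in> U"
  with assms have "u \<le> a \<or> b \<le> u" by (metis linorder_neqE not_le)
  then show "(u < w \<longleftrightarrow> u < z) \<and> (w < u \<longleftrightarrow> z < u)"
    using assms by (metis less_le_trans le_less_trans less_asym)
qed

text \<open>All zeros of the derivative lie in \<open>U\<close>, so \<open>p\<close> is strictly
  monotone between neighbouring points of \<open>U\<close> and has at most one root in each
  cell.\<close>

locale monotone_cells =
  fixes U :: "'a::real_closed_field set" and p :: "'a poly"
  assumes fin: "finite U" and deriv_nz: "\<And>x. x \<notin> U \<Longrightarrow> poly (pderiv p) x \<noteq> 0"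
begin

lemma monotone_in_cell:
  assumes "w \<notin> U" "\<forall>u\<in>U. \<not> (a < u \<and> u < b)" "a \<le> w" "w \<le> b" "a < b"
  shows "sg (poly p b - poly p a) = sg (poly (pderiv p) w)"
proof (rule rcf_monotone[OF assms(5)])
  fix c assume c: "a < c" "c < b"
  have nz: "poly (pderiv p) d \<noteq> 0" if "min c w \<le> d" "d \<le> max c w" for d
  proof (rule deriv_nz)
    show "d \<notin> U"
    proof
      assume "d \<in> U"
      then have "\<not> (a < d \<and> d < b)" "d \<noteq> w" using assms by auto
      then show False using that c assms(3,4) by (auto simp: min_def max_def split: if_splits)
    qed
  qed
  consider "c < w" | "c = w" | "w < c" by (metis linorder_neqE)
  then show "sg (poly (pderiv p) c) = sg (poly (pderiv p) w)"
  proof cases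
    case 1 then show ?thesis using nz by (intro rcf_sg_const) auto
  next
    case 3 then show ?thesis using nz by (intro rcf_sg_const[symmetric]) auto
  qed simp
qed

text \<open>A monotone polynomial leaves its root with the sign of the derivative on the right and
  the opposite sign on the left. Together with the converse \<open>root_in_cell\<close>, the signs
  at the two ends decide whether a cell contains a root.\<close>

lemma ends_of_root:
  assumes "z \<notin> U" "poly p z = 0"
  shows "lsign U p z = - sg (poly (pderiv p) z)" "rsign U p z = sg (poly (pderiv p) z)"
proof -
  obtain a where a: "a < z" "sg (poly p a) = lsign U p z" "\<forall>u\<in>U. \<not> (a < u \<and> u < z)"
    using lsign_witness[OF fin] by blast
  obtain b where b: "z < b" "sg (poly p b) = rsign U p z" "\<forall>u\<in>U. \<not> (z < u \<and> u < b)"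
    using rsign_witness[OF fin] by blast
  show "lsign U p z = - sg (poly (pderiv p) z)"
    using monotone_in_cell[OF assms(1) a(3)] a assms(2) by simp
  show "rsign U p z = sg (poly (pderiv p) z)"
    using monotone_in_cell[OF assms(1) b(3)] b assms(2) by simp
qed

lemma root_in_cell:
  assumes "w \<notin> U" "lsign U p w = - sg (poly (pderiv p) w)" "rsign U p w = sg (poly (pderiv p) w)"
  shows "\<exists>z. poly p z = 0 \<and> match U (\<lambda>u. u) w z"
proof -
  obtain a where a: "a < w" "sg (poly p a) = lsign U p w" "\<forall>u\<in>U. \<not> (a < u \<and> u < w)"
    using lsign_witness[OF fin] by blast
  obtain b where b: "w < b" "sg (poly p b) = rsign U p w" "\<forall>u\<in>U. \<not> (w < u \<and> u < b)"
    using rsign_witness[OF fin] by blast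
  have "poly (pderiv p) w \<noteq> 0" using assms deriv_nz by blast
  then have "sg (poly p a) * sg (poly p b) = -1"
    using a b assms by (auto simp: sg_def split: if_splits)
  then obtain z where "a < z" "z < b" "poly p z = 0"
    using rcf_ivt[of a b p] a(1) b(1) by auto
  then show ?thesis using same_cell_interval a b assms(1) by blast
qed

text \<open>Without a root the sign at the left end persists. If that end is itself a zero of
  \<open>p\<close>, monotonicity gives the sign of the derivative instead.\<close>

lemma sg_no_root:
  assumes "w \<notin> U" "\<And>z. match U (\<lambda>u. u) w z \<Longrightarrow> poly p z \<noteq> 0"
  shows "sg (poly p w) = (if lsign U p w \<noteq> 0 then lsign U p w else sg (poly (pderiv p) w))"
proof -
  obtain a where a: "a < w" "sg (poly p a) = lsign U p w" "\<forall>u\<in>U. \<not> (a < u \<and> u < w)"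
    using lsign_witness[OF fin] by blast
  show ?thesis
  proof (cases "poly p a = 0")
    case True
    then show ?thesis using monotone_in_cell[OF assms(1) a(3)] a by simp
  next
    case False
    have "poly p c \<noteq> 0" if "a \<le> c" "c \<le> w" for c
    proof (cases "c = a")
      case nz: False
      have "match U (\<lambda>u. u) w c"
        unfolding match_iff
      proof
        fix u assume "u \<in> U"
        then have "u \<le> a \<or> w < u" using a(3) assms(1) by (metis linorder_neqE not_le)
        then show "(u < w \<longleftrightarrow> u < c) \<and> (w < u \<longleftrightarrow> c < u)"
          using nz that by (metis le_less_trans less_le_trans less_asym order.not_eq_order_implies_strict)
      qed
      then show ?thesis by (rule assms(2))
    qed (use False in simp)
    then have "sg (poly p a) = sg (poly p w)" using a(1) by (intro rcf_sg_const)
    then show ?thesis using a(2) False by (metis sg_eq_0_iff)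
  qed
qed

lemma sg_relative_to_root:
  assumes "w \<notin> U" "match U (\<lambda>u. u) w z" "poly p z = 0"
  shows "sg (poly p w) = sg (w - z) * sg (poly (pderiv p) w)"
proof -
  have z: "z \<notin> U" using assms(1,2) unfolding match_iff by (metis less_irrefl linorder_neqE)
  have no: "\<not> (u < z \<and> w < u)" "\<not> (u < w \<and> z < u)" if "u \<in> U" for u
    using assms(2) that unfolding match_iff by (metis less_asym)+
  consider "w < z" | "w = z" | "z < w" by (metis linorder_neqE)
  then show ?thesis
  proof cases
    case 1
    then have "sg (poly p z - poly p w) = sg (poly (pderiv p) w)"
      using no by (intro monotone_in_cell[OF assms(1)]) auto
    moreover have "sg (w - z) = -1" using 1 by (simp add: sg_def)
    ultimately show ?thesis using assms(3) by simp
  next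
    case 2 then show ?thesis using assms(3) by simp
  next
    case 3
    then have "sg (poly p w - poly p z) = sg (poly (pderiv p) w)"
      using no by (intro monotone_in_cell[OF assms(1)]) auto
    moreover have "sg (w - z) = 1" using 3 by (simp add: sg_def)
    ultimately show ?thesis using assms(3) by simp
  qed
qed

end


section \<open>Comparison of two monotone polynomials over matching cells\<close>

lemma match_lsign:
  assumes U: "finite U" "strict_mono_on U h" and m: "match U h y y'"
    and d: "degree p = degree P" "sg (lead_coeff p) = sg (lead_coeff P)"
    and s: "\<And>u. u \<in> U \<Longrightarrow> sg (poly p u) = sg (poly P (h u))"
  shows "lsign U p y = lsign (h ` U) P y'"
proof (cases "\<exists>u\<in>U. u < y")
  case True
  have img: "{v \<in> h ` U. v < y'} = h ` {u \<in> U. u < y}"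
    using m by (auto simp: match_iff)
  define a where "a = Max {u\<in>U. u < y}"
  have fin: "finite {u\<in>U. u < y}" using U by simp
  have a: "a \<in> {u\<in>U. u < y}" unfolding a_def using True fin by (intro Max_in) auto
  have "Max {v \<in> h ` U. v < y'} = h a"
    unfolding img
  proof (rule Max_eqI)
    fix v assume "v \<in> h ` {u \<in> U. u < y}"
    then obtain u where u: "v = h u" "u \<in> U" "u < y" by blast
    then have "u \<le> a" unfolding a_def using fin by auto
    then show "v \<le> h a" using u a U(2) by (auto simp: le_less strict_mono_onD_iff)
  qed (use fin a in auto)
  moreover have "\<exists>v\<in>h ` U. v < y'" using True m by (auto simp: match_iff)
  ultimately show ?thesis using True s[of a] a by (simp add: lsign_def a_def)
next
  case False
  moreover have "\<not> (\<exists>v\<in>h ` U. v < y')" using False m by (auto simp: match_iff)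
  ultimately show ?thesis unfolding lsign_def using d by (simp only: if_False)
qed

lemma match_rsign:
  assumes U: "finite U" "strict_mono_on U h" and m: "match U h y y'"
    and d: "sg (lead_coeff p) = sg (lead_coeff P)"
    and s: "\<And>u. u \<in> U \<Longrightarrow> sg (poly p u) = sg (poly P (h u))"
  shows "rsign U p y = rsign (h ` U) P y'"
proof (cases "\<exists>u\<in>U. y < u")
  case True
  have img: "{v \<in> h ` U. y' < v} = h ` {u \<in> U. y < u}"
    using m by (auto simp: match_iff)
  define a where "a = Min {u\<in>U. y < u}"
  have fin: "finite {u\<in>U. y < u}" using U by simp
  have a: "a \<in> {u\<in>U. y < u}" unfolding a_def using True fin by (intro Min_in) auto
  have "Min {v \<in> h ` U. y' < v} = h a"
    unfolding img
  proof (rule Min_eqI)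
    fix v assume "v \<in> h ` {u \<in> U. y < u}"
    then obtain u where u: "v = h u" "u \<in> U" "y < u" by blast
    then have "a \<le> u" unfolding a_def using fin by auto
    then show "h a \<le> v" using u a U(2) by (auto simp: le_less strict_mono_onD_iff)
  qed (use fin a in auto)
  moreover have "\<exists>v\<in>h ` U. y' < v" using True m by (auto simp: match_iff)
  ultimately show ?thesis using True s[of a] a by (simp add: rsign_def a_def)
next
  case False
  moreover have "\<not> (\<exists>v\<in>h ` U. y' < v)" using False m by (auto simp: match_iff)
  ultimately show ?thesis unfolding rsign_def using d by (simp only: if_False)
qed

lemma match_not_mem:
  assumes "match U h y y'" "y \<notin> U" shows "y' \<notin> h ` U"
  using assms unfolding match_iff by (metis imageE less_irrefl linorder_neqE)

lemma match_mem:
  assumes "match U h y y'" "y \<in> U" shows "y' = h y"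
  using assms unfolding match_iff by (metis less_irrefl linorder_neqE)

lemma match_same_cell:
  "match U h y y' \<Longrightarrow> match U (\<lambda>u. u) y z \<Longrightarrow> match (h ` U) (\<lambda>u. u) y' z' \<Longrightarrow> match U h z z'"
  by (auto simp: match_iff)

lemma match_same_cell':
  assumes "match U h y y'" "match U h z z'" "match U (\<lambda>u. u) y z"
  shows "match (h ` U) (\<lambda>u. u) y' z'"
  using assms by (auto simp: match_iff)

text \<open>Both sides see the same signs at the ends of corresponding cells, and \<open>p\<close> is strictly
  monotone on each cell, so a cell contains a root on one side iff it does on the other.\<close>

lemma extend_by_monotone_poly:
  fixes p :: "'a::real_closed_field poly" and P :: "'b::real_closed_field poly"
  assumes U: "finite U" "strict_mono_on U h"
    and dp: "\<And>x. x \<notin> U \<Longrightarrow> poly (pderiv p) x \<noteq> 0"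
    and dP: "\<And>x. x \<notin> h ` U \<Longrightarrow> poly (pderiv P) x \<noteq> 0"
    and d: "degree p = degree P" "sg (lead_coeff p) = sg (lead_coeff P)"
    and s: "\<And>u. u \<in> U \<Longrightarrow> sg (poly p u) = sg (poly P (h u))"
    and s': "\<And>y y'. match U h y y' \<Longrightarrow> sg (poly (pderiv p) y) = sg (poly (pderiv P) y')"
  shows "\<exists>h'. (\<forall>u\<in>U. h' u = h u) \<and> strict_mono_on (U \<union> {x. poly p x = 0}) h'
    \<and> h' ` (U \<union> {x. poly p x = 0}) = h ` U \<union> {x. poly P x = 0}
    \<and> (\<forall>y y'. match (U \<union> {x. poly p x = 0}) h' y y' \<longrightarrow> sg (poly p y) = sg (poly P y'))"
proof -
  interpret A: monotone_cells U p by unfold_locales (use U dp in auto)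
  interpret B: monotone_cells "h ` U" P by unfold_locales (use U dP in auto)
  note ls = match_lsign[OF U _ d s] and rs = match_rsign[OF U _ d(2) s]
  have transfer: "\<exists>z'. poly P z' = 0 \<and> match U h z z'" if z: "poly p z = 0" "z \<notin> U" for z
  proof -
    obtain w' where w': "match U h z w'" using match_exists[OF U] by blast
    have "lsign (h ` U) P w' = - sg (poly (pderiv P) w')" "rsign (h ` U) P w' = sg (poly (pderiv P) w')"
      using A.ends_of_root[OF z(2,1)] ls[OF w'] rs[OF w'] s'[OF w'] by simp_all
    from B.root_in_cell[OF match_not_mem[OF w' z(2)] this]
    obtain z' where "poly P z' = 0" "match (h ` U) (\<lambda>u. u) w' z'" by blast
    then show ?thesis using match_same_cell[OF w', of z z'] by (auto simp: match_iff)
  qed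
  have transfer_rev: "\<exists>z. poly p z = 0 \<and> match U h z z'" if z': "poly P z' = 0" "z' \<notin> h ` U" for z'
  proof -
    obtain w where w: "match U h w z'" using match_exists_rev[OF U] by blast
    have wU: "w \<notin> U" using w z'(2) match_mem by blast
    have "lsign U p w = - sg (poly (pderiv p) w)" "rsign U p w = sg (poly (pderiv p) w)"
      using B.ends_of_root[OF z'(2,1)] ls[OF w] rs[OF w] s'[OF w] by simp_all
    from A.root_in_cell[OF wU this]
    obtain z where "poly p z = 0" "match U (\<lambda>u. u) w z" by blast
    then show ?thesis using match_same_cell[OF w, of z z'] by (auto simp: match_iff)
  qed
  define h' where "h' u = (if u \<in> U then h u else (SOME z'. poly P z' = 0 \<and> match U h u z'))" for u
  have h'U: "h' u = h u" if "u \<in> U" for u using that by (simp add: h'_def)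
  have h'r: "poly P (h' z) = 0" "match U h z (h' z)" if "poly p z = 0" "z \<notin> U" for z
    using someI_ex[OF transfer[OF that]] that(2) by (simp_all add: h'_def)
  have uniqP: "z' = z''" if "poly P z' = 0" "poly P z'' = 0" "match (h ` U) (\<lambda>u. u) z' z''" "z' \<notin> h ` U" for z' z''
  proof -
    have "sg (z' - z'') * sg (poly (pderiv P) z') = 0"
      using B.sg_relative_to_root[OF that(4,3,2)] that(1) by simp
    then show ?thesis using dP[OF that(4)] by simp
  qed
  have uniqp: "z = w" if "poly p z = 0" "poly p w = 0" "match U (\<lambda>u. u) z w" "z \<notin> U" for z w
  proof -
    have "sg (z - w) * sg (poly (pderiv p) z) = 0"
      using A.sg_relative_to_root[OF that(4,3,2)] that(1) by simp
    then show ?thesis using dp[OF that(4)] by simp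
  qed
  let ?U = "U \<union> {x. poly p x = 0}"
  have mono: "strict_mono_on ?U h'"
    unfolding strict_mono_on_def
  proof (intro allI impI, elim conjE)
    fix a b assume ab: "a \<in> ?U" "b \<in> ?U" "a < b"
    show "h' a < h' b"
    proof (cases "a \<in> U"; cases "b \<in> U")
      assume "a \<in> U" "b \<in> U" then show ?thesis using U ab by (simp add: h'U strict_mono_onD_iff)
    next
      assume "a \<in> U" "b \<notin> U" then show ?thesis using h'r[of b] ab by (simp add: h'U match_iff)
    next
      assume "a \<notin> U" "b \<in> U" then show ?thesis using h'r[of a] ab by (simp add: h'U match_iff)
    next
      assume *: "a \<notin> U" "b \<notin> U"
      then have r: "poly p a = 0" "poly p b = 0" using ab by auto
      \<comment> \<open>Two roots in the same cell coincide, hence distinct new roots are separated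
        by a point of \<open>U\<close>, whose image separates their images.\<close>
      have "\<exists>u\<in>U. a < u \<and> u < b"
      proof (rule ccontr)
        assume no: "\<not> (\<exists>u\<in>U. a < u \<and> u < b)"
        have "match U (\<lambda>u. u) a b"
          unfolding match_iff using no * ab(3) by (metis less_trans linorder_neqE)
        then show False using uniqp[OF r _ *(1)] ab(3) by simp
      qed
      then obtain u where u: "u \<in> U" "a < u" "u < b" by blast
      then have "h' a < h u" "h u < h' b" using h'r(2)[OF r(1) *(1)] h'r(2)[OF r(2) *(2)] by (auto simp: match_iff)
      then show ?thesis by simp
    qed
  qed
  have "h' ` ?U \<subseteq> h ` U \<union> {x. poly P x = 0}"
    using h'U h'r(1) by force
  moreover have "v \<in> h' ` ?U" if v: "v \<in> h ` U \<union> {x. poly P x = 0}" for v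
  proof (cases "v \<in> h ` U")
    case True then show ?thesis using h'U by force
  next
    case False
    then have r: "poly P v = 0" using v by simp
    from transfer_rev[OF r False] obtain z where z: "poly p z = 0" "match U h z v" by blast
    have zU: "z \<notin> U" using match_mem[OF z(2)] False by blast
    have "match (h ` U) (\<lambda>u. u) v (h' z)"
      using match_same_cell'[OF z(2) h'r(2)[OF z(1) zU]] by (simp add: match_iff)
    then have "v = h' z" using uniqP[OF r h'r(1)[OF z(1) zU]] False by blast
    then show ?thesis using z by blast
  qed
  moreover have "sg (poly p y) = sg (poly P y')" if m': "match ?U h' y y'" for y y'
  proof -
    have m: "match U h y y'" using m' h'U by (auto simp: match_iff)
    show ?thesis
    proof (cases "y \<in> U")
      case True then show ?thesis using match_mem[OF m True] s by simp
    next
      case yU: False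
      note y'U = match_not_mem[OF m yU]
      show ?thesis
      proof (cases "\<exists>z. poly p z = 0 \<and> match U (\<lambda>u. u) y z")
        case True
        then obtain z where z: "poly p z = 0" "match U (\<lambda>u. u) y z" by blast
        have zU: "z \<notin> U" using z(2) yU unfolding match_iff by (metis less_irrefl linorder_neqE)
        have c: "match (h ` U) (\<lambda>u. u) y' (h' z)"
          using match_same_cell'[OF m h'r(2)[OF z(1) zU] z(2)] .
        have "sg (z - y) = sg (h' z - y')" using m' z(1) by (auto simp: match_def)
        then have "sg (y - z) = sg (y' - h' z)" by (metis minus_diff_eq sg_minus)
        then show ?thesis
          using A.sg_relative_to_root[OF yU z(2,1)] B.sg_relative_to_root[OF y'U c h'r(1)[OF z(1) zU]] s'[OF m]
          by simp
      next
        case False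
        have no: "poly P z' \<noteq> 0" if c: "match (h ` U) (\<lambda>u. u) y' z'" for z'
        proof
          assume r: "poly P z' = 0"
          have z'U: "z' \<notin> h ` U" using match_not_mem[OF c y'U] by simp
          from transfer_rev[OF r z'U] obtain z where z: "poly p z = 0" "match U h z z'" by blast
          have "match U (\<lambda>u. u) y z" using m z(2) c by (auto simp: match_iff)
          then show False using False z(1) by blast
        qed
        show ?thesis
          using A.sg_no_root[OF yU] B.sg_no_root[OF y'U no] False ls[OF m] s'[OF m] by metis
      qed
    qed
  qed
  ultimately show ?thesis using h'U mono by (intro exI[of _ h']) blast
qed


section \<open>Sign diagrams are determined by signs of coefficients\<close>

definition is_ring_hom :: "('a::comm_ring_1 \<Rightarrow> 'b::comm_ring_1) \<Rightarrow> bool" where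
  "is_ring_hom \<phi> \<longleftrightarrow> \<phi> 0 = 0 \<and> \<phi> 1 = 1 \<and> (\<forall>x y. \<phi> (x + y) = \<phi> x + \<phi> y) \<and> (\<forall>x y. \<phi> (x * y) = \<phi> x * \<phi> y)"

lemma
  assumes "is_ring_hom \<phi>"
  shows is_ring_hom_0: "\<phi> 0 = 0" and is_ring_hom_1: "\<phi> 1 = 1"
    and is_ring_hom_add: "\<phi> (x + y) = \<phi> x + \<phi> y" and is_ring_hom_mult: "\<phi> (x * y) = \<phi> x * \<phi> y"
  using assms by (simp_all add: is_ring_hom_def)

lemma is_ring_hom_uminus: "is_ring_hom \<phi> \<Longrightarrow> \<phi> (- x) = - \<phi> x"
  using is_ring_hom_add[of \<phi> x "-x"] by (simp add: is_ring_hom_0 add_eq_0_iff2)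

lemma is_ring_hom_diff: "is_ring_hom \<phi> \<Longrightarrow> \<phi> (x - y) = \<phi> x - \<phi> y"
  using is_ring_hom_add[of \<phi> x "-y"] by (simp add: is_ring_hom_uminus)

lemma is_ring_hom_power: "is_ring_hom \<phi> \<Longrightarrow> \<phi> (x ^ n) = \<phi> x ^ n"
  by (induct n) (simp_all add: is_ring_hom_1 is_ring_hom_mult)

lemma is_ring_hom_of_nat: "is_ring_hom \<phi> \<Longrightarrow> \<phi> (of_nat n) = of_nat n"
  by (induct n) (simp_all add: is_ring_hom_0 is_ring_hom_1 is_ring_hom_add)

lemma is_ring_hom_sum: "is_ring_hom \<phi> \<Longrightarrow> \<phi> (sum f A) = (\<Sum>a\<in>A. \<phi> (f a))"
  by (induct A rule: infinite_finite_induct) (simp_all add: is_ring_hom_0 is_ring_hom_add)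

lemma is_ring_hom_prod: "is_ring_hom \<phi> \<Longrightarrow> \<phi> (prod f A) = (\<Prod>a\<in>A. \<phi> (f a))"
  by (induct A rule: infinite_finite_induct) (simp_all add: is_ring_hom_1 is_ring_hom_mult)

lemma map_poly_hom_add: "is_ring_hom \<phi> \<Longrightarrow> map_poly \<phi> (p + q) = map_poly \<phi> p + map_poly \<phi> q"
  by (simp add: poly_eq_iff coeff_map_poly is_ring_hom_0 is_ring_hom_add)

lemma map_poly_hom_mult: "is_ring_hom \<phi> \<Longrightarrow> map_poly \<phi> (p * q) = map_poly \<phi> p * map_poly \<phi> q"
  by (simp add: poly_eq_iff coeff_map_poly is_ring_hom_0 coeff_mult is_ring_hom_sum is_ring_hom_mult)

lemma map_poly_hom_smult: "is_ring_hom \<phi> \<Longrightarrow> map_poly \<phi> (smult c p) = smult (\<phi> c) (map_poly \<phi> p)"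
  by (simp add: poly_eq_iff coeff_map_poly is_ring_hom_0 is_ring_hom_mult)

lemma map_poly_hom_pderiv:
  "is_ring_hom (\<phi> :: 'a::comm_ring_1 \<Rightarrow> 'b::linordered_field) \<Longrightarrow>
    (\<And>n. coeff p' n = of_nat (Suc n) * coeff p (Suc n)) \<Longrightarrow> map_poly \<phi> p' = pderiv (map_poly \<phi> p)"
  by (simp add: poly_eq_iff coeff_map_poly is_ring_hom_0 coeff_pderiv is_ring_hom_mult
      is_ring_hom_of_nat is_ring_hom_add is_ring_hom_1 del: of_nat_Suc)

text \<open>The exponent is even because a homomorphism into an ordered field that keeps the leading
  coefficient nonzero then turns the factor into a positive one, which does not disturb
  signs.\<close>

lemma even_pseudo_remainder:
  fixes p q :: "'a::comm_ring_1 poly"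
  shows "\<exists>k s r. smult (lead_coeff q ^ (2 * k)) p = s * q + r \<and> (r = 0 \<or> degree r < degree q)"
proof -
  let ?l = "lead_coeff q"
  have "\<exists>k s r. smult (?l ^ k) p = s * q + r \<and> (r = 0 \<or> degree r < degree q)"
    if "\<forall>i\<ge>n. coeff p i = 0" for n and p :: "'a poly"
    using that
  proof (induct n arbitrary: p)
    case 0
    then have p: "p = 0" by (simp add: poly_eq_iff)
    show ?case unfolding p by (rule exI[of _ 0], rule exI[of _ 0], rule exI[of _ 0], simp)
  next
    case (Suc m)
    show ?case
    proof (cases "Suc m \<le> degree q")
      case True
      have "degree p \<le> m" using Suc(2) by (intro degree_le) auto
      with True have "degree p < degree q" by simp
      then have "smult (?l ^ 0) p = 0 * q + p \<and> (p = 0 \<or> degree p < degree q)" by simp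
      then show ?thesis by blast
    next
      case False
      define t where "t = monom (coeff p m) (m - degree q)"
      define p1 where "p1 = smult ?l p - t * q"
      have "coeff p1 i = 0" if "i \<ge> m" for i
      proof (cases "i = m")
        case True
        then show ?thesis using False by (simp add: p1_def t_def coeff_monom_mult)
      next
        case i: False
        then have "coeff p i = 0" using Suc(2) that by simp
        moreover have "coeff q (i - (m - degree q)) = 0"
          by (rule coeff_eq_0) (use i that False in linarith)
        ultimately show ?thesis by (simp add: p1_def t_def coeff_monom_mult)
      qed
      then obtain k s r where "smult (?l ^ k) p1 = s * q + r" "r = 0 \<or> degree r < degree q"
        using Suc(1) by blast
      moreover have "smult (?l ^ Suc k) p = smult (?l ^ k) p1 + smult (?l ^ k) t * q"
        by (simp add: p1_def smult_diff_right mult.commute)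
      ultimately have "smult (?l ^ Suc k) p = (s + smult (?l ^ k) t) * q + r" "r = 0 \<or> degree r < degree q"
        by (simp_all add: algebra_simps)
      then show ?thesis by blast
    qed
  qed
  from this[of "Suc (degree p)" p] obtain k s r where
    *: "smult (?l ^ k) p = s * q + r" "r = 0 \<or> degree r < degree q"
    by (metis Suc_le_eq coeff_eq_0)
  have "smult (?l ^ (2 * k)) p = smult (?l ^ k) (smult (?l ^ k) p)"
    by (simp add: mult_2 power_add)
  also have "\<dots> = smult (?l ^ k) s * q + smult (?l ^ k) r"
    by (simp add: *(1) smult_add_right)
  finally have "smult (?l ^ (2 * k)) p = smult (?l ^ k) s * q + smult (?l ^ k) r" .
  moreover have "smult (?l ^ k) r = 0 \<or> degree (smult (?l ^ k) r) < degree q"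
    using *(2) degree_smult_le[of "?l ^ k" r] by auto
  ultimately show ?thesis by blast
qed

text \<open>The remainder is fixed in the coefficient ring, so that one polynomial serves all
  homomorphisms at once.\<close>

definition prem :: "'a::comm_ring_1 poly \<Rightarrow> 'a poly \<Rightarrow> 'a poly" where
  "prem p q = (SOME r. (\<exists>k s. smult (lead_coeff q ^ (2 * k)) p = s * q + r) \<and> (r = 0 \<or> degree r < degree q))"

lemma prem:
  "\<exists>k s. smult (lead_coeff q ^ (2 * k)) p = s * q + prem p q" "prem p q = 0 \<or> degree (prem p q) < degree q"
proof -
  have "\<exists>r. (\<exists>k s. smult (lead_coeff q ^ (2 * k)) p = s * q + r) \<and> (r = 0 \<or> degree r < degree q)"
    using even_pseudo_remainder[of q p] by blast
  from someI_ex[OF this] show "\<exists>k s. smult (lead_coeff q ^ (2 * k)) p = s * q + prem p q"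
    "prem p q = 0 \<or> degree (prem p q) < degree q"
    unfolding prem_def by blast+
qed

text \<open>At a root of the divisor the pseudo-division identity says that a positive multiple of
  \<open>p\<close> equals the remainder, which is zero or of smaller degree than
  \<open>q\<close>.\<close>

lemma sg_prem:
  fixes \<phi> :: "'a::comm_ring_1 \<Rightarrow> 'b::linordered_field"
  assumes "is_ring_hom \<phi>" "\<phi> (lead_coeff q) \<noteq> 0" "poly (map_poly \<phi> q) u = 0"
  shows "sg (poly (map_poly \<phi> p) u) = sg (poly (map_poly \<phi> (prem p q)) u)"
proof -
  obtain k s where "smult (lead_coeff q ^ (2 * k)) p = s * q + prem p q" using prem by blast
  then have "map_poly \<phi> (smult (lead_coeff q ^ (2 * k)) p) = map_poly \<phi> (s * q + prem p q)" by simp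
  then have "smult (\<phi> (lead_coeff q) ^ (2 * k)) (map_poly \<phi> p) = map_poly \<phi> s * map_poly \<phi> q + map_poly \<phi> (prem p q)"
    using assms(1) by (simp add: map_poly_hom_add map_poly_hom_mult map_poly_hom_smult is_ring_hom_power)
  from arg_cong[OF this, of "\<lambda>p. poly p u"]
  have e: "\<phi> (lead_coeff q) ^ (2 * k) * poly (map_poly \<phi> p) u = poly (map_poly \<phi> (prem p q)) u"
    using assms(3) by simp
  moreover have "sg (\<phi> (lead_coeff q) ^ (2 * k)) = 1"
    using assms(2) by (simp add: sg_def power_mult)
  ultimately show ?thesis unfolding e[symmetric] sg_mult by simp
qed

text \<open>Polynomials whose image vanishes identically are left out, which keeps the set finite
  for finite \<open>S\<close>.\<close>

definition roots_of :: "('a::comm_ring_1 \<Rightarrow> 'b::linordered_field) \<Rightarrow> 'a poly set \<Rightarrow> 'b set" where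
  "roots_of \<phi> S = {u. \<exists>q\<in>S. map_poly \<phi> q \<noteq> 0 \<and> poly (map_poly \<phi> q) u = 0}"

text \<open>An isomorphism of sign diagrams: roots correspond in order, and every polynomial of
  \<open>S\<close> has equal signs at corresponding positions, gaps included.\<close>

definition diag :: "('a::comm_ring_1 \<Rightarrow> 'b::linordered_field) \<Rightarrow> ('a \<Rightarrow> 'c::linordered_field) \<Rightarrow>
    'a poly set \<Rightarrow> ('b \<Rightarrow> 'c) \<Rightarrow> bool" where
  "diag \<phi> \<psi> S h \<longleftrightarrow> strict_mono_on (roots_of \<phi> S) h \<and> h ` roots_of \<phi> S = roots_of \<psi> S
    \<and> (\<forall>q\<in>S. map_poly \<phi> q = 0 \<longleftrightarrow> map_poly \<psi> q = 0)
    \<and> (\<forall>y y'. match (roots_of \<phi> S) h y y' \<longrightarrow>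
         (\<forall>q\<in>S. sg (poly (map_poly \<phi> q) y) = sg (poly (map_poly \<psi> q) y')))"

lemma finite_roots_of: "finite S \<Longrightarrow> finite (roots_of \<phi> S)"
proof -
  assume "finite S"
  moreover have "roots_of \<phi> S = (\<Union>q\<in>{q\<in>S. map_poly \<phi> q \<noteq> 0}. {u. poly (map_poly \<phi> q) u = 0})"
    by (auto simp: roots_of_def)
  ultimately show ?thesis by (auto intro: poly_roots_finite)
qed

lemma roots_of_mono: "T \<subseteq> S \<Longrightarrow> roots_of \<phi> T \<subseteq> roots_of \<phi> S"
  by (auto simp: roots_of_def)

text \<open>A position relative to the smaller root set is refined to a point \<open>w\<close>
  matched with respect to the larger one. No nonzero image of a polynomial of \<open>T\<close> has a
  root between \<open>w\<close> and \<open>y'\<close>, so the signs there agree.\<close>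

lemma diag_mono:
  fixes \<phi> :: "'a::comm_ring_1 \<Rightarrow> 'b::linordered_field" and \<psi> :: "'a \<Rightarrow> 'c::real_closed_field"
  assumes fin: "finite S" and D: "diag \<phi> \<psi> S h" and TS: "T \<subseteq> S"
  shows "diag \<phi> \<psi> T h"
proof -
  let ?U = "roots_of \<phi> S" and ?W = "roots_of \<phi> T"
  note WU = roots_of_mono[OF TS, of \<phi>]
  have mono: "strict_mono_on ?U h" and img: "h ` ?U = roots_of \<psi> S"
    and z: "\<And>q. q \<in> S \<Longrightarrow> map_poly \<phi> q = 0 \<longleftrightarrow> map_poly \<psi> q = 0"
    and s: "\<And>y y' q. match ?U h y y' \<Longrightarrow> q \<in> S \<Longrightarrow> sg (poly (map_poly \<phi> q) y) = sg (poly (map_poly \<psi> q) y')"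
    using D unfolding diag_def by blast+
  have pt: "sg (poly (map_poly \<phi> q) u) = sg (poly (map_poly \<psi> q) (h u))" if "u \<in> ?U" "q \<in> S" for u q
    using s match_point[OF mono that(1)] that(2) by blast
  have monoW: "strict_mono_on ?W h" using mono WU by (auto simp: strict_mono_on_def)
  have imgW: "h ` ?W = roots_of \<psi> T"
  proof
    show "h ` ?W \<subseteq> roots_of \<psi> T"
    proof
      fix v assume "v \<in> h ` ?W"
      then obtain u q where "v = h u" "u \<in> ?W" "q \<in> T" "map_poly \<phi> q \<noteq> 0" "poly (map_poly \<phi> q) u = 0"
        by (auto simp: roots_of_def)
      then show "v \<in> roots_of \<psi> T"
        using pt[of u q] z[of q] WU TS by (auto simp: roots_of_def)
    qed
    show "roots_of \<psi> T \<subseteq> h ` ?W"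
    proof
      fix v assume v: "v \<in> roots_of \<psi> T"
      then obtain q where q: "q \<in> T" "map_poly \<psi> q \<noteq> 0" "poly (map_poly \<psi> q) v = 0"
        by (auto simp: roots_of_def)
      obtain u where u: "u \<in> ?U" "v = h u" using v img roots_of_mono[OF TS, of \<psi>] by blast
      then have "u \<in> ?W" using pt[OF u(1), of q] z[of q] q TS by (auto simp: roots_of_def)
      then show "v \<in> h ` ?W" using u by blast
    qed
  qed
  have "sg (poly (map_poly \<phi> q) y) = sg (poly (map_poly \<psi> q) y')"
    if m: "match ?W h y y'" and q: "q \<in> T" for y y' q
  proof -
    obtain w where w: "match ?U h y w" using match_exists[OF finite_roots_of[OF fin] mono] by blast
    have sw: "sg (poly (map_poly \<phi> q) y) = sg (poly (map_poly \<psi> q) w)" using s[OF w] q TS by blast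
    have "sg (poly (map_poly \<psi> q) w) = sg (poly (map_poly \<psi> q) y')"
    proof (cases "map_poly \<psi> q = 0 \<or> w = y'")
      case False
      have no: "poly (map_poly \<psi> q) c \<noteq> 0" if c: "min w y' \<le> c" "c \<le> max w y'" for c
      proof
        assume "poly (map_poly \<psi> q) c = 0"
        then have "c \<in> roots_of \<psi> T" using q False by (auto simp: roots_of_def)
        then obtain u where u: "u \<in> ?W" "c = h u" using imgW by blast
        then have "(u < y \<longleftrightarrow> c < w) \<and> (y < u \<longleftrightarrow> w < c)" "(u < y \<longleftrightarrow> c < y') \<and> (y < u \<longleftrightarrow> y' < c)"
          using w m WU by (auto simp: match_iff)
        then show False using c False by (auto simp: min_def max_def split: if_splits)
      qed
      consider "w < y'" | "y' < w" using False by (metis linorder_neqE)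
      then show ?thesis
      proof cases
        case 1 then show ?thesis using no by (intro rcf_sg_const) auto
      next
        case 2 then show ?thesis using no by (intro rcf_sg_const[symmetric]) auto
      qed
    qed auto
    then show ?thesis using sw by simp
  qed
  then show ?thesis unfolding diag_def using monoW imgW z TS by blast
qed


text \<open>The coefficient ring may have zero divisors; after a homomorphism into a field the
  result is the usual \<open>pderiv\<close>.\<close>

definition formal_deriv :: "'a::comm_ring_1 poly \<Rightarrow> 'a poly" where
  "formal_deriv p = (\<Sum>i<degree p. monom (of_nat (Suc i) * coeff p (Suc i)) i)"

lemma coeff_formal_deriv: "coeff (formal_deriv p) n = of_nat (Suc n) * coeff p (Suc n)"
  by (simp add: formal_deriv_def coeff_sum coeff_eq_0 del: of_nat_Suc)

lemma degree_formal_deriv: "degree p = Suc d \<Longrightarrow> degree (formal_deriv p) \<le> d"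
  by (intro degree_le) (simp add: coeff_formal_deriv coeff_eq_0)

lemma degree_poly_cutoff_le: "degree (poly_cutoff (Suc n) p) \<le> n" "degree (poly_cutoff j p) \<le> degree p"
  by (intro degree_le, simp add: coeff_poly_cutoff coeff_eq_0)+

lemma map_poly_formal_deriv:
  "is_ring_hom (\<phi> :: 'a::comm_ring_1 \<Rightarrow> 'b::linordered_field) \<Longrightarrow> map_poly \<phi> (formal_deriv p) = pderiv (map_poly \<phi> p)"
  by (intro map_poly_hom_pderiv) (simp_all add: coeff_formal_deriv)

lemma diag_insert_same_image:
  assumes "diag \<phi> \<psi> S h" "q \<in> S" "map_poly \<phi> p = map_poly \<phi> q" "map_poly \<psi> p = map_poly \<psi> q"
  shows "diag \<phi> \<psi> (insert p S) h"
proof -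
  have "roots_of \<phi> (insert p S) = roots_of \<phi> S" "roots_of \<psi> (insert p S) = roots_of \<psi> S"
    using assms(2,3,4) by (auto simp: roots_of_def)
  then show ?thesis using assms unfolding diag_def by auto
qed

lemma diag_constants:
  fixes \<phi> :: "'a::comm_ring_1 \<Rightarrow> 'b::linordered_field" and \<psi> :: "'a \<Rightarrow> 'c::linordered_field"
  assumes "is_ring_hom \<phi>" "is_ring_hom \<psi>" "\<And>p. p \<in> S \<Longrightarrow> degree p = 0"
    and "\<And>p. p \<in> S \<Longrightarrow> sg (\<phi> (coeff p 0)) = sg (\<psi> (coeff p 0))"
  shows "diag \<phi> \<psi> S h"
proof -
  have m: "map_poly \<phi> p = [:\<phi> (coeff p 0):]" "map_poly \<psi> p = [:\<psi> (coeff p 0):]" if "p \<in> S" for p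
    using assms(1-2) assms(3)[OF that]
    by (auto simp: poly_eq_iff coeff_map_poly is_ring_hom_0 coeff_pCons coeff_eq_0 split: nat.splits)
  then have "roots_of \<phi> S = {}" "roots_of \<psi> S = {}" by (auto simp: roots_of_def)
  moreover have "\<phi> (coeff p 0) = 0 \<longleftrightarrow> \<psi> (coeff p 0) = 0" if "p \<in> S" for p
    using assms(4)[OF that] by (metis sg_eq_0_iff)
  ultimately show ?thesis using assms(4) m by (simp add: diag_def strict_mono_on_def)
qed

text \<open>Since the derivative of \<open>p\<close> is in \<open>T\<close>, the roots of
  \<open>T\<close> cut the line into cells on which \<open>p\<close> is monotone. The signs of
  \<open>p\<close> at these roots are those of the remainders in the given diagram, and
  \<open>extend_by_monotone_poly\<close> then inserts the roots of \<open>p\<close>.\<close>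

lemma diag_step:
  fixes \<phi> :: "'a::comm_ring_1 \<Rightarrow> 'b::real_closed_field" and \<psi> :: "'a \<Rightarrow> 'c::real_closed_field"
  assumes hom: "is_ring_hom \<phi>" "is_ring_hom \<psi>" and fin: "finite T"
    and deg: "degree p = Suc d" "\<phi> (lead_coeff p) \<noteq> 0" and dp: "formal_deriv p \<in> T"
    and degT: "\<And>q. q \<in> T \<Longrightarrow> degree q \<le> Suc d"
    and coefs: "\<And>q i. q \<in> insert p T \<Longrightarrow> sg (\<phi> (coeff q i)) = sg (\<psi> (coeff q i))"
    and D: "diag \<phi> \<psi> (T \<union> (\<lambda>(q, j). prem p (poly_cutoff j q)) ` (T \<times> {..Suc (Suc d)})) h"
  shows "\<exists>h'. diag \<phi> \<psi> (insert p T) h'"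
proof -
  let ?Sb = "T \<union> (\<lambda>(q, j). prem p (poly_cutoff j q)) ` (T \<times> {..Suc (Suc d)})"
  let ?U = "roots_of \<phi> T"
  have zero: "\<phi> (coeff q i) = 0 \<longleftrightarrow> \<psi> (coeff q i) = 0" if "q \<in> insert p T" for q i
    using coefs[OF that] by (metis sg_eq_0_iff)
  have finb: "finite ?Sb" using fin by auto
  have DT: "diag \<phi> \<psi> T h" using diag_mono[OF finb D] by blast
  note cm = coeff_map_poly[of \<phi>, OF is_ring_hom_0[OF hom(1)]] coeff_map_poly[of \<psi>, OF is_ring_hom_0[OF hom(2)]]
  have dq: "degree (map_poly \<phi> q) = degree (map_poly \<psi> q)" if "q \<in> insert p T" for q
  proof -
    have "coeff (map_poly \<phi> q) i = 0 \<longleftrightarrow> coeff (map_poly \<psi> q) i = 0" for i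
      using zero[OF that] by (simp add: cm)
    then show ?thesis unfolding Polynomial.degree_def by simp
  qed
  have dp\<phi>: "degree (map_poly \<phi> p) = Suc d"
    using deg hom(1) by (metis map_poly_degree_eq)
  have dp\<psi>: "degree (map_poly \<psi> p) = Suc d" using dq[of p] dp\<phi> by simp
  have pd\<phi>: "pderiv (map_poly \<phi> p) = map_poly \<phi> (formal_deriv p)" "pderiv (map_poly \<phi> p) \<noteq> 0"
    using map_poly_formal_deriv[OF hom(1)] dp\<phi> by (simp_all add: pderiv_eq_0_iff)
  have pd\<psi>: "pderiv (map_poly \<psi> p) = map_poly \<psi> (formal_deriv p)" "pderiv (map_poly \<psi> p) \<noteq> 0"
    using map_poly_formal_deriv[OF hom(2)] dp\<psi> by (simp_all add: pderiv_eq_0_iff)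
  have mono: "strict_mono_on ?U h" and img: "h ` ?U = roots_of \<psi> T"
    and z: "\<And>q. q \<in> T \<Longrightarrow> map_poly \<phi> q = 0 \<longleftrightarrow> map_poly \<psi> q = 0"
    and s: "\<And>y y' q. match ?U h y y' \<Longrightarrow> q \<in> T \<Longrightarrow> sg (poly (map_poly \<phi> q) y) = sg (poly (map_poly \<psi> q) y')"
    using DT unfolding diag_def by blast+
  have s_root: "sg (poly (map_poly \<phi> p) u) = sg (poly (map_poly \<psi> p) (h u))" if u: "u \<in> ?U" for u
  proof -
    obtain q where q: "q \<in> T" "map_poly \<phi> q \<noteq> 0" "poly (map_poly \<phi> q) u = 0"
      using u by (auto simp: roots_of_def)
    \<comment> \<open>\<open>e\<close> is the degree after mapping; cutting \<open>q\<close> off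
      above \<open>e\<close> gives a divisor with the same image whose leading coefficient is not
      mapped to 0.\<close>
    define e where "e = degree (map_poly \<phi> q)"
    define q' where "q' = poly_cutoff (Suc e) q"
    have e: "e = degree (map_poly \<psi> q)" using dq[of q] q(1) by (simp add: e_def)
    have eq\<phi>: "map_poly \<phi> q' = map_poly \<phi> q"
      unfolding poly_eq_iff cm q'_def coeff_poly_cutoff
      using coeff_eq_0[of "map_poly \<phi> q"] hom(1) by (auto simp: e_def cm is_ring_hom_0)
    have eq\<psi>: "map_poly \<psi> q' = map_poly \<psi> q"
      unfolding poly_eq_iff cm q'_def coeff_poly_cutoff
      using coeff_eq_0[of "map_poly \<psi> q"] hom(2) by (auto simp: e cm is_ring_hom_0)
    have ne: "\<phi> (coeff q e) \<noteq> 0" using q(2) unfolding cm(1)[symmetric] e_def by simp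
    then have "coeff q' e \<noteq> 0" using hom(1) by (auto simp: q'_def coeff_poly_cutoff is_ring_hom_0)
    then have "degree q' = e"
      using degree_poly_cutoff_le(1)[of e q] by (metis q'_def le_antisym le_degree)
    then have lc: "lead_coeff q' = coeff q e" by (simp add: q'_def coeff_poly_cutoff)
    have r: "poly (map_poly \<psi> q) (h u) = 0"
      using s[OF match_point[OF mono u] q(1)] q(3) by (metis sg_eq_0_iff)
    have "e \<le> degree q" using ne hom(1) by (metis is_ring_hom_0 le_degree)
    then have mem: "prem p q' \<in> ?Sb" using degT[OF q(1)] q(1) unfolding q'_def by force
    have "u \<in> roots_of \<phi> ?Sb" using u roots_of_mono[of T ?Sb \<phi>] by blast
    moreover have "strict_mono_on (roots_of \<phi> ?Sb) h" using D by (simp add: diag_def)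
    ultimately have "match (roots_of \<phi> ?Sb) h u (h u)" by (simp add: match_point)
    then have "sg (poly (map_poly \<phi> (prem p q')) u) = sg (poly (map_poly \<psi> (prem p q')) (h u))"
      using D mem unfolding diag_def by blast
    then show ?thesis
      using sg_prem[OF hom(1), of q' u p] sg_prem[OF hom(2), of q' "h u" p] ne zero[of q e] q r
      by (simp add: lc eq\<phi> eq\<psi>)
  qed
  have "\<exists>h'. (\<forall>u\<in>?U. h' u = h u) \<and> strict_mono_on (?U \<union> {x. poly (map_poly \<phi> p) x = 0}) h'
    \<and> h' ` (?U \<union> {x. poly (map_poly \<phi> p) x = 0}) = h ` ?U \<union> {x. poly (map_poly \<psi> p) x = 0}
    \<and> (\<forall>y y'. match (?U \<union> {x. poly (map_poly \<phi> p) x = 0}) h' y y' \<longrightarrow>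
        sg (poly (map_poly \<phi> p) y) = sg (poly (map_poly \<psi> p) y'))"
  proof (rule extend_by_monotone_poly[OF finite_roots_of[OF fin] mono])
    show "poly (pderiv (map_poly \<phi> p)) x \<noteq> 0" if "x \<notin> ?U" for x
      using that pd\<phi> dp by (auto simp: roots_of_def)
    show "poly (pderiv (map_poly \<psi> p)) x \<noteq> 0" if "x \<notin> h ` ?U" for x
      using that pd\<psi> dp unfolding img by (auto simp: roots_of_def)
    show "degree (map_poly \<phi> p) = degree (map_poly \<psi> p)" using dp\<phi> dp\<psi> by simp
    show "sg (lead_coeff (map_poly \<phi> p)) = sg (lead_coeff (map_poly \<psi> p))"
      unfolding dp\<phi> dp\<psi> cm using coefs by simp
    show "sg (poly (pderiv (map_poly \<phi> p)) y) = sg (poly (pderiv (map_poly \<psi> p)) y')"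
      if "match ?U h y y'" for y y'
      unfolding pd\<phi> pd\<psi> using s[OF that dp] .
  qed (rule s_root)
  then obtain h' where h': "\<forall>u\<in>?U. h' u = h u" "strict_mono_on (?U \<union> {x. poly (map_poly \<phi> p) x = 0}) h'"
    "h' ` (?U \<union> {x. poly (map_poly \<phi> p) x = 0}) = h ` ?U \<union> {x. poly (map_poly \<psi> p) x = 0}"
    "\<And>y y'. match (?U \<union> {x. poly (map_poly \<phi> p) x = 0}) h' y y' \<Longrightarrow>
        sg (poly (map_poly \<phi> p) y) = sg (poly (map_poly \<psi> p) y')" by blast
  have p0: "map_poly \<phi> p \<noteq> 0" "map_poly \<psi> p \<noteq> 0" using dp\<phi> dp\<psi> by auto
  have ri: "roots_of \<phi> (insert p T) = ?U \<union> {x. poly (map_poly \<phi> p) x = 0}"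
    "roots_of \<psi> (insert p T) = h ` ?U \<union> {x. poly (map_poly \<psi> p) x = 0}"
    unfolding img using p0 by (auto simp: roots_of_def)
  have "sg (poly (map_poly \<phi> q) y) = sg (poly (map_poly \<psi> q) y')"
    if m: "match (?U \<union> {x. poly (map_poly \<phi> p) x = 0}) h' y y'" and q: "q \<in> insert p T" for y y' q
  proof -
    have "match ?U h y y'" using m h'(1) by (auto simp: match_iff)
    then show ?thesis using s h'(4)[OF m] q by blast
  qed
  then have "diag \<phi> \<psi> (insert p T) h'"
    unfolding diag_def ri using h'(2,3) z p0 by auto
  then show ?thesis by blast
qed

text \<open>The type arguments name the two target fields, which \<open>S\<close> does not mention.
  \<open>C\<close> is fixed before the homomorphisms; this uniformity makes the statement an
  elimination of the variable.\<close>

definition determined :: "'b::real_closed_field itself \<Rightarrow> 'c::real_closed_field itself \<Rightarrow> 'a::comm_ring_1 poly set \<Rightarrow> bool" where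
  "determined TB TC S \<longleftrightarrow> (\<exists>C. finite C \<and> (\<forall>(\<phi> :: 'a \<Rightarrow> 'b) (\<psi> :: 'a \<Rightarrow> 'c).
     is_ring_hom \<phi> \<longrightarrow> is_ring_hom \<psi> \<longrightarrow> (\<forall>c\<in>C. sg (\<phi> c) = sg (\<psi> c)) \<longrightarrow> (\<exists>h. diag \<phi> \<psi> S h)))"

text \<open>If the leading coefficient of \<open>p\<close> is mapped to 0, the truncation has the
  same image; otherwise \<open>p\<close> can be inserted over its derivative and the remainders. The
  coefficients put into \<open>C\<close> make both homomorphisms take the same branch.\<close>

lemma determined_step:
  fixes S :: "'a::comm_ring_1 poly set"
  assumes fin: "finite S" and p: "p \<in> S" "degree p = Suc d" and deg: "\<And>q. q \<in> S \<Longrightarrow> degree q \<le> Suc d"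
    and T: "T = insert (formal_deriv p) (S - {p})"
    and a: "determined TYPE('b::real_closed_field) TYPE('c::real_closed_field) (insert (poly_cutoff (Suc d) p) (S - {p}))"
    and b: "determined TYPE('b) TYPE('c) (T \<union> (\<lambda>(q, j). prem p (poly_cutoff j q)) ` (T \<times> {..Suc (Suc d)}))"
  shows "determined TYPE('b) TYPE('c) S"
proof -
  obtain Ca where Ca: "finite Ca" "\<And>(\<phi> :: 'a \<Rightarrow> 'b) (\<psi> :: 'a \<Rightarrow> 'c). is_ring_hom \<phi> \<Longrightarrow> is_ring_hom \<psi> \<Longrightarrow>
      (\<forall>c\<in>Ca. sg (\<phi> c) = sg (\<psi> c)) \<Longrightarrow> \<exists>h. diag \<phi> \<psi> (insert (poly_cutoff (Suc d) p) (S - {p})) h"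
    using a unfolding determined_def by blast
  obtain Cb where Cb: "finite Cb" "\<And>(\<phi> :: 'a \<Rightarrow> 'b) (\<psi> :: 'a \<Rightarrow> 'c). is_ring_hom \<phi> \<Longrightarrow> is_ring_hom \<psi> \<Longrightarrow>
      (\<forall>c\<in>Cb. sg (\<phi> c) = sg (\<psi> c)) \<Longrightarrow> \<exists>h. diag \<phi> \<psi> (T \<union> (\<lambda>(q, j). prem p (poly_cutoff j q)) ` (T \<times> {..Suc (Suc d)})) h"
    using b unfolding determined_def by blast
  have finT: "finite T" using fin T by simp
  define C where "C = Ca \<union> Cb \<union> (\<Union>q\<in>insert p T. range (coeff q))"
  have "finite C" using Ca(1) Cb(1) finT by (auto simp: C_def range_coeff)
  moreover have "\<exists>h. diag \<phi> \<psi> S h"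
    if hom: "is_ring_hom \<phi>" "is_ring_hom \<psi>" and C: "\<forall>c\<in>C. sg (\<phi> c) = sg (\<psi> c)"
    for \<phi> :: "'a \<Rightarrow> 'b" and \<psi> :: "'a \<Rightarrow> 'c"
  proof (cases "\<phi> (lead_coeff p) = 0")
    case True
    have "sg (\<phi> (lead_coeff p)) = sg (\<psi> (lead_coeff p))" using C by (auto simp: C_def)
    then have z: "\<phi> (coeff p (Suc d)) = 0" "\<psi> (coeff p (Suc d)) = 0"
      using True p(2) by (metis sg_eq_0_iff)+
    obtain h where h: "diag \<phi> \<psi> (insert (poly_cutoff (Suc d) p) (S - {p})) h"
      using Ca(2)[OF hom] C unfolding C_def by blast
    have cutoff: "\<theta> (if i < Suc d then coeff p i else 0) = \<theta> (coeff p i)" if "\<theta> 0 = 0" "\<theta> (coeff p (Suc d)) = 0"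
      for \<theta> :: "'a \<Rightarrow> 'd::zero" and i
    proof -
      consider "i < Suc d" | "i = Suc d" | "degree p < i" using p(2) by linarith
      then show ?thesis using that by cases (simp_all add: coeff_eq_0)
    qed
    have "map_poly \<phi> p = map_poly \<phi> (poly_cutoff (Suc d) p)" "map_poly \<psi> p = map_poly \<psi> (poly_cutoff (Suc d) p)"
      using hom z unfolding poly_eq_iff
      by (simp_all only: coeff_map_poly is_ring_hom_0 coeff_poly_cutoff cutoff simp_thms)
    from diag_insert_same_image[OF h _ this]
    have "diag \<phi> \<psi> (insert p (insert (poly_cutoff (Suc d) p) (S - {p}))) h" by simp
    then have "diag \<phi> \<psi> S h" by (rule diag_mono[rotated]) (use fin in auto)
    then show ?thesis by blast
  next
    case False
    obtain h where h: "diag \<phi> \<psi> (T \<union> (\<lambda>(q, j). prem p (poly_cutoff j q)) ` (T \<times> {..Suc (Suc d)})) h"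
      using Cb(2)[OF hom] C unfolding C_def by blast
    have "\<exists>h'. diag \<phi> \<psi> (insert p T) h'"
    proof (rule diag_step[OF hom finT p(2) False _ _ _ h])
      show "formal_deriv p \<in> T" by (simp add: T)
      show "degree q \<le> Suc d" if "q \<in> T" for q
        using that deg degree_formal_deriv[OF p(2)] by (auto simp: T)
      show "sg (\<phi> (coeff q i)) = sg (\<psi> (coeff q i))" if "q \<in> insert p T" for q i
        using C that unfolding C_def by blast
    qed
    then obtain h' where "diag \<phi> \<psi> (insert p T) h'" by blast
    then have "diag \<phi> \<psi> S h'" by (rule diag_mono[rotated]) (use finT T in auto)
    then show ?thesis by blast
  qed
  ultimately show ?thesis unfolding determined_def by blast
qed

text \<open>The recursion removes a polynomial of maximal degree in favour of its derivative and of
  remainders of smaller degree; the truncations of the divisors account for leading coefficients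
  that are mapped to \<open>0\<close>.\<close>

theorem finite_polys_determined:
  fixes S :: "'a::comm_ring_1 poly set"
  assumes "finite S"
  shows "determined TYPE('b::real_closed_field) TYPE('c::real_closed_field) S"
proof -
  have "determined TYPE('b) TYPE('c) S" if "finite S" "\<And>p. p \<in> S \<Longrightarrow> degree p \<le> d"
    for d and S :: "'a poly set"
    using that
  proof (induct d arbitrary: S)
    case 0
    have "finite ((\<lambda>p. coeff p 0) ` S)" using 0 by simp
    moreover have "diag \<phi> \<psi> S h" if "is_ring_hom \<phi>" "is_ring_hom \<psi>" "\<forall>c\<in>(\<lambda>p. coeff p 0) ` S. sg (\<phi> c) = sg (\<psi> c)"
      for \<phi> :: "'a \<Rightarrow> 'b" and \<psi> :: "'a \<Rightarrow> 'c" and h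
      using that 0 by (intro diag_constants) auto
    ultimately show ?case unfolding determined_def by blast
  next
    case (Suc d)
    \<comment> \<open>Inner induction on the number \<open>n\<close> of polynomials of top degree:
      truncation, and the passage to derivative and remainders, both remove one of them and add only
      smaller degrees.\<close>
    have "determined TYPE('b) TYPE('c) S"
      if "finite S" "\<And>p. p \<in> S \<Longrightarrow> degree p \<le> Suc d" "card {p\<in>S. degree p = Suc d} = n" for n and S :: "'a poly set"
      using that
    proof (induct n arbitrary: S)
      case 0
      then have "{p\<in>S. degree p = Suc d} = {}" by simp
      then have "degree p \<le> d" if "p \<in> S" for p using 0(2)[OF that] that by (auto simp: le_Suc_eq)
      then show ?case using Suc(1) 0(1) by blast
    next
      case (Suc n)
      then have "{p\<in>S. degree p = Suc d} \<noteq> {}" by (metis card.empty nat.distinct(1))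
      then obtain p where p: "p \<in> S" "degree p = Suc d" by blast
      have cardp: "card ({p\<in>S. degree p = Suc d} - {p}) = n"
        using Suc(2,4) p by (subst card_Diff_singleton) auto
      define T where "T = insert (formal_deriv p) (S - {p})"
      let ?R = "(\<lambda>(q, j). prem p (poly_cutoff j q)) ` (T \<times> {..Suc (Suc d)})"
      have dfp: "degree (formal_deriv p) \<le> d" by (rule degree_formal_deriv[OF p(2)])
      have dT: "degree q \<le> Suc d" if "q \<in> T" for q using that Suc(3) dfp by (auto simp: T_def)
      have dR: "degree r \<le> d" if "r \<in> ?R" for r
      proof -
        obtain q j where q: "q \<in> T" "r = prem p (poly_cutoff j q)" using \<open>r \<in> ?R\<close> by auto
        then have "r = 0 \<or> degree r < degree q"
          using prem(2)[of p "poly_cutoff j q"] degree_poly_cutoff_le(2)[of j q] by auto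
        then show ?thesis using dT[OF q(1)] by auto
      qed
      show ?case
      proof (rule determined_step[OF Suc(2) p Suc(3) T_def])
        let ?A = "insert (poly_cutoff (Suc d) p) (S - {p})"
        have "{q \<in> ?A. degree q = Suc d} = {p\<in>S. degree p = Suc d} - {p}"
          using degree_poly_cutoff_le(1)[of d p] by auto
        then have cardA: "card {q \<in> ?A. degree q = Suc d} = n" using cardp by simp
        have degA: "degree q \<le> Suc d" if "q \<in> ?A" for q
          using that Suc(3) degree_poly_cutoff_le(1)[of d p] by (auto intro: le_SucI)
        show "determined TYPE('b) TYPE('c) ?A"
          by (rule Suc(1)[OF _ degA cardA]) (use Suc(2) in simp)
        have "q \<notin> ?R" "q \<noteq> formal_deriv p" if "degree q = Suc d" for q
          using dR[of q] dfp that by (metis Suc_n_not_le_n)+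
        then have "{q \<in> T \<union> ?R. degree q = Suc d} = {p\<in>S. degree p = Suc d} - {p}"
          unfolding T_def by blast
        then have cardB: "card {q \<in> T \<union> ?R. degree q = Suc d} = n" using cardp by simp
        have finB: "finite (T \<union> ?R)" using Suc(2) by (simp add: T_def)
        have degB: "degree q \<le> Suc d" if "q \<in> T \<union> ?R" for q
          using that dT dR le_SucI by blast
        show "determined TYPE('b) TYPE('c) (T \<union> ?R)"
          by (rule Suc(1)[OF finB degB cardB])
      qed simp
    qed
    then show ?case using Suc(2,3) by blast
  qed
  from this[of S "Max (degree ` S)"] show ?thesis using assms by simp
qed


section \<open>Evaluation of multivariate polynomials\<close>

text \<open>Coefficients are carried into the field by \<iota>, so that one polynomial can be
  evaluated over different real closed fields.\<close>

definition mpoly_ev :: "(real \<Rightarrow> 'k::comm_ring_1) \<Rightarrow> ('n::finite \<Rightarrow> 'k) \<Rightarrow> 'n real_mpoly \<Rightarrow> 'k" where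
  "mpoly_ev \<iota> b p = (\<Sum>a\<in>Poly_Mapping.keys p.
     \<iota> (Poly_Mapping.lookup p a) * (\<Prod>i\<in>UNIV. b i ^ Poly_Mapping.lookup a i))"

lemma mpoly_eval_conv_ev: "mpoly_eval p x = mpoly_ev (\<lambda>r. r) (($) x) p"
  by (simp add: mpoly_eval_def mpoly_ev_def)

lemma mpoly_ev_superset:
  assumes "\<iota> 0 = 0" "finite A" "Poly_Mapping.keys p \<subseteq> A"
  shows "mpoly_ev \<iota> b p = (\<Sum>a\<in>A. \<iota> (Poly_Mapping.lookup p a) * (\<Prod>i\<in>UNIV. b i ^ Poly_Mapping.lookup a i))"
  unfolding mpoly_ev_def
  by (rule sum.mono_neutral_left) (use assms in \<open>auto simp: in_keys_iff\<close>)

lemma mpoly_ev_add: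
  assumes "is_ring_hom \<iota>"
  shows "mpoly_ev \<iota> b (p + q) = mpoly_ev \<iota> b p + mpoly_ev \<iota> b q"
proof -
  let ?A = "Poly_Mapping.keys p \<union> Poly_Mapping.keys q"
  have s: "mpoly_ev \<iota> b r = (\<Sum>a\<in>?A. \<iota> (Poly_Mapping.lookup r a) * (\<Prod>i\<in>UNIV. b i ^ Poly_Mapping.lookup a i))"
    if "Poly_Mapping.keys r \<subseteq> ?A" for r
    by (rule mpoly_ev_superset) (use that assms in \<open>auto simp: is_ring_hom_0\<close>)
  show ?thesis
    by (subst (1 2 3) s)
       (use assms in \<open>auto simp: lookup_add is_ring_hom_add distrib_right sum.distrib dest: subsetD[OF Poly_Mapping.keys_add]\<close>)
qed

lemma mpoly_ev_0: "mpoly_ev \<iota> b 0 = 0"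
  by (simp add: mpoly_ev_def)

lemma mpoly_ev_sum:
  assumes "is_ring_hom \<iota>"
  shows "mpoly_ev \<iota> b (sum f A) = (\<Sum>a\<in>A. mpoly_ev \<iota> b (f a))"
  by (induct A rule: infinite_finite_induct) (simp_all add: mpoly_ev_0 mpoly_ev_add[OF assms])

lemma mpoly_ev_single:
  assumes "is_ring_hom \<iota>"
  shows "mpoly_ev \<iota> b (Poly_Mapping.single a c) = \<iota> c * (\<Prod>i\<in>UNIV. b i ^ Poly_Mapping.lookup a i)"
  using assms by (cases "c = 0") (simp_all add: mpoly_ev_def is_ring_hom_0)

lemma mpoly_sum_singles:
  "p = (\<Sum>a\<in>Poly_Mapping.keys p. Poly_Mapping.single a (Poly_Mapping.lookup p a))"
  by (rule poly_mapping_eqI) (auto simp: lookup_sum lookup_single when_def in_keys_iff)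

lemma mpoly_ev_mult_single:
  assumes "is_ring_hom \<iota>"
  shows "mpoly_ev \<iota> b (Poly_Mapping.single a c * Poly_Mapping.single a' c') =
    mpoly_ev \<iota> b (Poly_Mapping.single a c) * mpoly_ev \<iota> b (Poly_Mapping.single a' c')"
  by (simp add: mult_single mpoly_ev_single[OF assms] lookup_add power_add prod.distrib
      is_ring_hom_mult[OF assms])

lemma mpoly_ev_mult:
  assumes "is_ring_hom \<iota>"
  shows "mpoly_ev \<iota> b (p * q :: 'n::finite real_mpoly) = mpoly_ev \<iota> b p * mpoly_ev \<iota> b q"
proof -
  let ?m = "\<lambda>(p :: 'n real_mpoly) a. Poly_Mapping.single a (Poly_Mapping.lookup p a)"
  have "p * q = (\<Sum>a\<in>Poly_Mapping.keys p. \<Sum>a'\<in>Poly_Mapping.keys q. ?m p a * ?m q a')"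
    by (subst mpoly_sum_singles[of p], subst mpoly_sum_singles[of q]) (rule sum_product)
  then have "mpoly_ev \<iota> b (p * q) =
    (\<Sum>a\<in>Poly_Mapping.keys p. \<Sum>a'\<in>Poly_Mapping.keys q. mpoly_ev \<iota> b (?m p a) * mpoly_ev \<iota> b (?m q a'))"
    by (simp add: mpoly_ev_sum[OF assms] mpoly_ev_mult_single[OF assms])
  also have "\<dots> = (\<Sum>a\<in>Poly_Mapping.keys p. mpoly_ev \<iota> b (?m p a)) * (\<Sum>a'\<in>Poly_Mapping.keys q. mpoly_ev \<iota> b (?m q a'))"
    by (rule sum_product[symmetric])
  also have "\<dots> = mpoly_ev \<iota> b p * mpoly_ev \<iota> b q"
    unfolding mpoly_ev_sum[OF assms, symmetric] mpoly_sum_singles[symmetric] ..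
  finally show ?thesis .
qed

lemma mpoly_ev_1: "is_ring_hom \<iota> \<Longrightarrow> mpoly_ev \<iota> b 1 = 1"
  using mpoly_ev_single[of \<iota> b 0 1] by (simp add: is_ring_hom_1)

lemma is_ring_hom_mpoly_ev: "is_ring_hom \<iota> \<Longrightarrow> is_ring_hom (mpoly_ev \<iota> b)"
  by (simp add: is_ring_hom_def[of "mpoly_ev \<iota> b"] mpoly_ev_0 mpoly_ev_1 mpoly_ev_add mpoly_ev_mult)

lemma is_ring_hom_id: "is_ring_hom (\<lambda>x. x)"
  by (simp add: is_ring_hom_def)

lemma is_ring_hom_mpoly_eval: "is_ring_hom (\<lambda>p. mpoly_eval p x)"
  using is_ring_hom_mpoly_ev[OF is_ring_hom_id, of "($) x"] by (simp add: mpoly_eval_conv_ev[abs_def])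

definition mconst :: "real \<Rightarrow> 'n::finite real_mpoly" where
  "mconst c = Poly_Mapping.single 0 c"

definition mvar :: "'n::finite \<Rightarrow> 'n real_mpoly" where
  "mvar i = Poly_Mapping.single (Poly_Mapping.single i 1) 1"

lemma mpoly_ev_mconst: "is_ring_hom \<iota> \<Longrightarrow> mpoly_ev \<iota> b (mconst c) = \<iota> c"
  by (simp add: mconst_def mpoly_ev_single)

lemma mpoly_ev_mvar: "is_ring_hom \<iota> \<Longrightarrow> mpoly_ev \<iota> b (mvar i) = b i"
proof -
  assume "is_ring_hom \<iota>"
  moreover have "(\<Prod>j\<in>UNIV. b j ^ Poly_Mapping.lookup (Poly_Mapping.single i 1) j) = (\<Prod>j\<in>UNIV. if j = i then b i else 1)"
    by (rule prod.cong) (auto simp: lookup_single when_def)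
  ultimately show ?thesis by (simp add: mvar_def mpoly_ev_single is_ring_hom_1)
qed

lemma is_ring_hom_mconst: "is_ring_hom mconst"
  by (simp add: is_ring_hom_def mconst_def single_add mult_single)

lemma mpoly_induct [case_names const var add mult]:
  fixes p :: "'n::finite real_mpoly"
  assumes const: "\<And>c. P (mconst c)" and var: "\<And>i. P (mvar i)"
    and add: "\<And>p q. P p \<Longrightarrow> P q \<Longrightarrow> P (p + q)" and mult: "\<And>p q. P p \<Longrightarrow> P q \<Longrightarrow> P (p * q)"
  shows "P p"
proof -
  have P0: "P 0" using const[of 0] by (simp add: mconst_def)
  have P1: "P 1" using const[of 1] by (simp add: mconst_def)
  have 1: "P (Poly_Mapping.single (Poly_Mapping.single i n) 1)" for i n
  proof (induct n)
    case 0 then show ?case using P1 by simp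
  next
    case (Suc n)
    have "Poly_Mapping.single (Poly_Mapping.single i (Suc n)) (1::real) = mvar i * Poly_Mapping.single (Poly_Mapping.single i n) 1"
      by (simp add: mvar_def mult_single flip: single_add)
    then show ?case using Suc var mult by metis
  qed
  have 2: "P (Poly_Mapping.single (\<Sum>i\<in>A. Poly_Mapping.single i (n i)) 1)" if "finite A" for A and n :: "'n \<Rightarrow> nat"
    using that
  proof induct
    case empty then show ?case using P1 by simp
  next
    case (insert i A)
    have "Poly_Mapping.single (\<Sum>i\<in>insert i A. Poly_Mapping.single i (n i)) (1::real) =
      Poly_Mapping.single (Poly_Mapping.single i (n i)) 1 * Poly_Mapping.single (\<Sum>i\<in>A. Poly_Mapping.single i (n i)) 1"
      using insert(1,2) by (simp add: mult_single)
    then show ?case using insert(3) 1 mult by metis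
  qed
  have 3: "P (Poly_Mapping.single a c)" for a c
  proof -
    have "a = (\<Sum>i\<in>Poly_Mapping.keys a. Poly_Mapping.single i (Poly_Mapping.lookup a i))"
      by (rule poly_mapping_eqI) (auto simp: lookup_sum lookup_single when_def in_keys_iff)
    then have "P (Poly_Mapping.single a 1)" using 2 by (metis finite_keys)
    moreover have "Poly_Mapping.single a c = mconst c * Poly_Mapping.single a 1"
      by (simp add: mconst_def mult_single)
    ultimately show ?thesis using const mult by metis
  qed
  have "P (sum f A)" if "\<And>a. a \<in> A \<Longrightarrow> P (f a)" "finite A" for f :: "_ \<Rightarrow> 'n real_mpoly" and A :: "('n \<Rightarrow>\<^sub>0 nat) set"
    using that(2,1) by induct (auto simp: P0 add)
  then show ?thesis using 3 by (subst mpoly_sum_singles) simp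
qed

section \<open>Transfer of sign conditions between real closed fields\<close>

text \<open>One \<open>q\<close> has to serve two fields of different types, hence the conjunction.
  Setting coordinate \<open>k\<close> to 0 in the coefficients records that they do not involve that
  variable.\<close>

lemma mpoly_as_univariate:
  fixes p :: "'n::finite real_mpoly" and k :: 'n
  shows "\<exists>q. (\<forall>(\<iota> :: real \<Rightarrow> 'b::comm_ring_1) e. is_ring_hom \<iota> \<longrightarrow>
      mpoly_ev \<iota> e p = poly (map_poly (mpoly_ev \<iota> (e(k := 0))) q) (e k)) \<and>
    (\<forall>(\<iota> :: real \<Rightarrow> 'c::comm_ring_1) e. is_ring_hom \<iota> \<longrightarrow>
      mpoly_ev \<iota> e p = poly (map_poly (mpoly_ev \<iota> (e(k := 0))) q) (e k))"
proof (induct p rule: mpoly_induct)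
  case (const c)
  show ?case
    by (rule exI[of _ "[:mconst c:]"]) (simp add: mpoly_ev_mconst map_poly_pCons mpoly_ev_0)
next
  case (var i)
  show ?case
  proof (cases "i = k")
    case True
    then show ?thesis
      by (intro exI[of _ "[:0, 1:]"]) (simp add: mpoly_ev_mvar map_poly_pCons mpoly_ev_0 mpoly_ev_1)
  next
    case False
    then show ?thesis
      by (intro exI[of _ "[:mvar i:]"]) (simp add: mpoly_ev_mvar map_poly_pCons mpoly_ev_0)
  qed
next
  case (add p q)
  then obtain p' q' where *:
    "\<And>(\<iota> :: real \<Rightarrow> 'b) e. is_ring_hom \<iota> \<Longrightarrow> mpoly_ev \<iota> e p = poly (map_poly (mpoly_ev \<iota> (e(k := 0))) p') (e k)"
    "\<And>(\<iota> :: real \<Rightarrow> 'c) e. is_ring_hom \<iota> \<Longrightarrow> mpoly_ev \<iota> e p = poly (map_poly (mpoly_ev \<iota> (e(k := 0))) p') (e k)"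
    "\<And>(\<iota> :: real \<Rightarrow> 'b) e. is_ring_hom \<iota> \<Longrightarrow> mpoly_ev \<iota> e q = poly (map_poly (mpoly_ev \<iota> (e(k := 0))) q') (e k)"
    "\<And>(\<iota> :: real \<Rightarrow> 'c) e. is_ring_hom \<iota> \<Longrightarrow> mpoly_ev \<iota> e q = poly (map_poly (mpoly_ev \<iota> (e(k := 0))) q') (e k)"
    by blast
  show ?case
    by (rule exI[of _ "p' + q'"]) (simp add: mpoly_ev_add map_poly_hom_add is_ring_hom_mpoly_ev * del: fun_upd_apply)
next
  case (mult p q)
  then obtain p' q' where *:
    "\<And>(\<iota> :: real \<Rightarrow> 'b) e. is_ring_hom \<iota> \<Longrightarrow> mpoly_ev \<iota> e p = poly (map_poly (mpoly_ev \<iota> (e(k := 0))) p') (e k)"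
    "\<And>(\<iota> :: real \<Rightarrow> 'c) e. is_ring_hom \<iota> \<Longrightarrow> mpoly_ev \<iota> e p = poly (map_poly (mpoly_ev \<iota> (e(k := 0))) p') (e k)"
    "\<And>(\<iota> :: real \<Rightarrow> 'b) e. is_ring_hom \<iota> \<Longrightarrow> mpoly_ev \<iota> e q = poly (map_poly (mpoly_ev \<iota> (e(k := 0))) q') (e k)"
    "\<And>(\<iota> :: real \<Rightarrow> 'c) e. is_ring_hom \<iota> \<Longrightarrow> mpoly_ev \<iota> e q = poly (map_poly (mpoly_ev \<iota> (e(k := 0))) q') (e k)"
    by blast
  show ?case
    by (rule exI[of _ "p' * q'"]) (simp add: mpoly_ev_mult map_poly_hom_mult is_ring_hom_mpoly_ev * del: fun_upd_apply)
qed

text \<open>Positive reals are invertible squares, so every ring homomorphism into an ordered field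
  preserves the order.\<close>

lemma sg_real_hom:
  fixes \<iota> :: "real \<Rightarrow> 'b::linordered_field"
  assumes "is_ring_hom \<iota>"
  shows "sg (\<iota> r) = sg r"
proof -
  have pos: "0 < \<iota> r" if "0 < r" for r
  proof -
    have "\<iota> r = \<iota> (sqrt r) * \<iota> (sqrt r)"
      using that by (simp flip: is_ring_hom_mult[OF assms])
    moreover have "\<iota> r * \<iota> (inverse r) = 1"
      using that by (simp add: is_ring_hom_1[OF assms] flip: is_ring_hom_mult[OF assms])
    then have "\<iota> r \<noteq> 0" by auto
    ultimately show ?thesis by (metis mult_eq_0_iff not_square_less_zero linorder_neqE)
  qed
  consider "r = 0" | "0 < r" | "0 < - r" by linarith
  then show ?thesis
  proof cases
    case 3
    then show ?thesis using pos[OF 3] is_ring_hom_uminus[OF assms, of r] by (simp add: sg_def)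
  qed (use pos[of r] assms in \<open>auto simp: sg_def is_ring_hom_0\<close>)
qed

lemma mpoly_ev_zero_point: "is_ring_hom \<iota> \<Longrightarrow> mpoly_ev \<iota> (\<lambda>i. 0) p = \<iota> (mpoly_ev (\<lambda>r. r) (\<lambda>i. 0) p)"
  by (simp add: mpoly_ev_def is_ring_hom_sum is_ring_hom_mult is_ring_hom_prod is_ring_hom_power is_ring_hom_0)

text \<open>Coordinates are eliminated one at a time: the signs of finitely many polynomials in the
  other coordinates fix the sign diagram in the \<open>k\<close>-th one, and a real number in the
  matching position is taken as its value.\<close>

theorem sign_conditions_transfer:
  fixes \<iota> :: "real \<Rightarrow> 'k::real_closed_field" and b :: "'n::finite \<Rightarrow> 'k"
  assumes \<iota>: "is_ring_hom \<iota>" and S: "finite S"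
  shows "\<exists>a. \<forall>p\<in>S. sg (mpoly_ev \<iota> b p) = sg (mpoly_ev (\<lambda>r. r) a p)"
proof -
  \<comment> \<open>The set of variables belongs to the type and cannot shrink; instead the
    coordinates outside \<open>W\<close> are kept at 0, and for empty \<open>W\<close> only
    constants are left to compare.\<close>
  have "\<exists>a. (\<forall>i. i \<notin> W \<longrightarrow> a i = 0) \<and> (\<forall>p\<in>S. sg (mpoly_ev \<iota> b p) = sg (mpoly_ev (\<lambda>r. r) a p))"
    if "finite W" "finite S" "\<And>i. i \<notin> W \<Longrightarrow> b i = 0" for W S and b :: "'n \<Rightarrow> 'k"
    using that
  proof (induct W arbitrary: S b)
    case empty
    then have "b = (\<lambda>i. 0)" by auto
    then show ?case
      by (intro exI[of _ "\<lambda>i. 0"]) (simp add: mpoly_ev_zero_point[OF \<iota>] sg_real_hom[OF \<iota>])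
  next
    case (insert k W)
    have "\<forall>p. \<exists>q. (\<forall>(\<iota> :: real \<Rightarrow> 'k) e. is_ring_hom \<iota> \<longrightarrow>
          mpoly_ev \<iota> e p = poly (map_poly (mpoly_ev \<iota> (e(k := 0))) q) (e k)) \<and>
        (\<forall>(\<iota> :: real \<Rightarrow> real) e. is_ring_hom \<iota> \<longrightarrow>
          mpoly_ev \<iota> e p = poly (map_poly (mpoly_ev \<iota> (e(k := 0))) q) (e k))"
      by (blast intro: mpoly_as_univariate)
    from choice[OF this] obtain q where
      q1: "\<And>p e. mpoly_ev \<iota> e p = poly (map_poly (mpoly_ev \<iota> (e(k := 0))) (q p)) (e k)" and
      q2: "\<And>p e. mpoly_ev (\<lambda>r::real. r) e p = poly (map_poly (mpoly_ev (\<lambda>r. r) (e(k := 0))) (q p)) (e k)"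
      using \<iota> is_ring_hom_id by blast
    have finq: "finite (q ` S)" using insert(4) by simp
    then obtain C where C: "finite C" "\<And>(\<phi> :: 'n real_mpoly \<Rightarrow> 'k) (\<psi> :: 'n real_mpoly \<Rightarrow> real).
        is_ring_hom \<phi> \<Longrightarrow> is_ring_hom \<psi> \<Longrightarrow> (\<forall>c\<in>C. sg (\<phi> c) = sg (\<psi> c)) \<Longrightarrow> \<exists>h. diag \<phi> \<psi> (q ` S) h"
      using finite_polys_determined[where 'b = 'k and 'c = real, OF finq] unfolding determined_def by blast
    define b0 where "b0 = b(k := 0)"
    have "\<exists>a. (\<forall>i. i \<notin> W \<longrightarrow> a i = 0) \<and> (\<forall>p\<in>C. sg (mpoly_ev \<iota> b0 p) = sg (mpoly_ev (\<lambda>r. r) a p))"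
      by (rule insert(3)[OF C(1)]) (use insert(5) in \<open>simp add: b0_def\<close>)
    then obtain a0 where "(\<forall>i. i \<notin> W \<longrightarrow> a0 i = 0) \<and>
      (\<forall>c\<in>C. sg (mpoly_ev \<iota> b0 c) = sg (mpoly_ev (\<lambda>r. r) a0 c))" by (rule exE)
    note a0 = conjunct1[OF this] conjunct2[OF this]
    obtain h where h: "diag (mpoly_ev \<iota> b0) (mpoly_ev (\<lambda>r. r) a0) (q ` S) h"
      using C(2)[OF is_ring_hom_mpoly_ev[OF \<iota>] is_ring_hom_mpoly_ev[OF is_ring_hom_id] a0(2)] by blast
    have "strict_mono_on (roots_of (mpoly_ev \<iota> b0) (q ` S)) h" using h by (simp only: diag_def)
    from match_exists[OF finite_roots_of[OF finq] this, of "b k"]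
    obtain y where y: "match (roots_of (mpoly_ev \<iota> b0) (q ` S)) h (b k) y" by (rule exE)
    have a0k: "(a0(k := y))(k := 0) = a0" using a0(1) insert(2) by auto
    have hq: "sg (poly (map_poly (mpoly_ev \<iota> b0) r) (b k)) = sg (poly (map_poly (mpoly_ev (\<lambda>r. r) a0) r) y)"
      if "r \<in> q ` S" for r
      using h[unfolded diag_def, THEN conjunct2, THEN conjunct2, THEN conjunct2, rule_format, OF y that] .
    have "sg (mpoly_ev \<iota> b p) = sg (mpoly_ev (\<lambda>r. r) (a0(k := y)) p)" if "p \<in> S" for p
      using hq[OF imageI[OF that]] unfolding q1[of b] q2[of "a0(k := y)"] a0k b0_def[symmetric] by simp
    moreover have "\<forall>i. i \<notin> insert k W \<longrightarrow> (a0(k := y)) i = 0" using a0(1) by simp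
    ultimately show ?case by blast
  qed
  from this[of UNIV S b] S show ?thesis by auto
qed


section \<open>Maximal ordered subfields of an algebraically closed field\<close>

text \<open>The differences of a field cone form a subfield on which the cone is a field preordering.\<close>

definition field_cone :: "'z::field set \<Rightarrow> bool" where
  "field_cone Q \<longleftrightarrow> 1 \<in> Q \<and> -1 \<notin> Q \<and> (\<forall>x\<in>Q. \<forall>y\<in>Q. x + y \<in> Q \<and> x * y \<in> Q \<and> (x - y)\<^sup>2 \<in> Q) \<and>
     (\<forall>x\<in>Q. inverse x \<in> Q)"

lemma field_cone_maximal_exists:
  assumes "field_cone Q0"
  shows "\<exists>Q. field_cone Q \<and> Q0 \<subseteq> Q \<and> (\<forall>Q'. field_cone Q' \<longrightarrow> Q \<subseteq> Q' \<longrightarrow> Q' = Q)"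
proof -
  let ?A = "{Q. field_cone Q \<and> Q0 \<subseteq> Q}"
  have "\<exists>M\<in>?A. \<forall>N1\<in>?A. M \<subseteq> N1 \<longrightarrow> N1 = M"
  proof (rule subset_Zorn_nonempty)
    show "?A \<noteq> {}" using assms by blast
    fix C assume ne: "C \<noteq> {}" and ch: "subset.chain ?A C"
    have mem: "field_cone Q" "Q0 \<subseteq> Q" if "Q \<in> C" for Q
      using ch that by (auto simp: subset.chain_def)
    have two: "\<exists>Q\<in>C. x \<in> Q \<and> y \<in> Q" if xy: "x \<in> \<Union>C" "y \<in> \<Union>C" for x y
    proof -
      obtain N1 N2 where "N1 \<in> C" "N2 \<in> C" "x \<in> N1" "y \<in> N2" using xy by blast
      moreover have "N1 \<subseteq> N2 \<or> N2 \<subseteq> N1" using ch calculation unfolding subset.chain_def by blast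
      ultimately show ?thesis by blast
    qed
    have "field_cone (\<Union>C)"
      unfolding field_cone_def
    proof (intro conjI ballI)
      show "1 \<in> \<Union>C" using ne mem by (auto simp: field_cone_def)
      show "-1 \<notin> \<Union>C" using mem by (auto simp: field_cone_def)
      fix x assume x: "x \<in> \<Union>C"
      show "inverse x \<in> \<Union>C" using two[OF x x] mem(1) unfolding field_cone_def by (meson UnionI)
      fix y assume y: "y \<in> \<Union>C"
      obtain Q where "Q \<in> C" "x \<in> Q" "y \<in> Q" using two[OF x y] by blast
      with mem show "x + y \<in> \<Union>C" "x * y \<in> \<Union>C" "(x - y)\<^sup>2 \<in> \<Union>C"
        by (auto simp: field_cone_def)
    qed
    then show "\<Union>C \<in> ?A" using ne mem by blast
  qed
  then obtain M where M: "field_cone M" "Q0 \<subseteq> M" "\<forall>N1\<in>?A. M \<subseteq> N1 \<longrightarrow> N1 = M" by blast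
  have "Q' = M" if "field_cone Q'" "M \<subseteq> Q'" for Q'
    using M(2,3) that by blast
  then show ?thesis using M(1,2) by blast
qed

locale maximal_field_cone =
  fixes Q :: "'z::alg_closed_field set"
  assumes cone: "field_cone Q" and maximal: "\<And>Q'. field_cone Q' \<Longrightarrow> Q \<subseteq> Q' \<Longrightarrow> Q' = Q"
begin

lemma Q_1: "1 \<in> Q" and Q_m1: "-1 \<notin> Q"
  and Q_add: "x \<in> Q \<Longrightarrow> y \<in> Q \<Longrightarrow> x + y \<in> Q" and Q_mult: "x \<in> Q \<Longrightarrow> y \<in> Q \<Longrightarrow> x * y \<in> Q"
  and Q_diff_sq: "x \<in> Q \<Longrightarrow> y \<in> Q \<Longrightarrow> (x - y)\<^sup>2 \<in> Q" and Q_inverse: "x \<in> Q \<Longrightarrow> inverse x \<in> Q"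
  using cone unfolding field_cone_def by blast+

lemma Q_0: "0 \<in> Q"
  using Q_diff_sq[OF Q_1 Q_1] by simp

section \<open>The subfield of differences of the cone\<close>

definition E :: "'z set" where "E = {x - y |x y. x \<in> Q \<and> y \<in> Q}"

lemma E_I: "x \<in> Q \<Longrightarrow> y \<in> Q \<Longrightarrow> x - y \<in> E"
  by (auto simp: E_def)

lemma Q_E: "x \<in> Q \<Longrightarrow> x \<in> E"
  using E_I[of x 0] Q_0 by simp

lemma E_sq: "x \<in> E \<Longrightarrow> x\<^sup>2 \<in> Q"
  using Q_diff_sq by (auto simp: E_def)

lemma E_add: "x \<in> E \<Longrightarrow> y \<in> E \<Longrightarrow> x + y \<in> E"
proof -
  assume "x \<in> E" "y \<in> E"
  then obtain a b c d where xy: "x = a - b" "y = c - d" and "a \<in> Q" "b \<in> Q" "c \<in> Q" "d \<in> Q" by (auto simp: E_def)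
  then have "(a + c) - (b + d) \<in> E" by (intro E_I Q_add)
  then show ?thesis unfolding xy by (simp add: algebra_simps)
qed

lemma E_minus: "x \<in> E \<Longrightarrow> - x \<in> E"
proof -
  assume "x \<in> E"
  then obtain a b where "x = a - b" "a \<in> Q" "b \<in> Q" by (auto simp: E_def)
  then show ?thesis using E_I[of b a] by simp
qed

lemma E_diff: "x \<in> E \<Longrightarrow> y \<in> E \<Longrightarrow> x - y \<in> E"
  using E_add[of x "- y"] E_minus by simp

lemma E_mult: "x \<in> E \<Longrightarrow> y \<in> E \<Longrightarrow> x * y \<in> E"
proof -
  assume "x \<in> E" "y \<in> E"
  then obtain a b c d where xy: "x = a - b" "y = c - d" and "a \<in> Q" "b \<in> Q" "c \<in> Q" "d \<in> Q" by (auto simp: E_def)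
  then have "(a * c + b * d) - (a * d + b * c) \<in> E" by (intro E_I Q_add Q_mult)
  then show ?thesis unfolding xy by (simp add: algebra_simps)
qed

lemma inverse_eq: "inverse x = x * inverse (x\<^sup>2)" for x :: 'z
  by (cases "x = 0") (simp_all add: power2_eq_square)

lemma E_inverse: "x \<in> E \<Longrightarrow> inverse x \<in> E"
  using inverse_eq E_mult Q_E[OF Q_inverse[OF E_sq]] by metis

text \<open>If -x is not in \<open>Q\<close>, then Q + x Q is still a field cone: from -1 = a + x b
  one would get -x = (1 + a) / b, an element of \<open>Q\<close>. Maximality then puts x into
  \<open>Q\<close>.\<close>

lemma E_total: "x \<in> E \<Longrightarrow> x \<in> Q \<or> - x \<in> Q"
proof (rule disjCI)
  assume x: "x \<in> E" and "- x \<notin> Q"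
  define Q' where "Q' = {a + x * b |a b. a \<in> Q \<and> b \<in> Q}"
  have I: "a + x * b \<in> Q'" if "a \<in> Q" "b \<in> Q" for a b using that by (auto simp: Q'_def)
  have sub: "Q \<subseteq> Q'" using I[OF _ Q_0] by auto
  have Q'E: "Q' \<subseteq> E" using x E_add E_mult Q_E by (auto simp: Q'_def)
  have m: "y * z \<in> Q'" if yz: "y \<in> Q'" "z \<in> Q'" for y z
  proof -
    obtain a b c d where "y = a + x * b" "z = c + x * d" "a \<in> Q" "b \<in> Q" "c \<in> Q" "d \<in> Q"
      using yz by (auto simp: Q'_def)
    then show ?thesis
      using I[of "a * c + x\<^sup>2 * (b * d)" "a * d + b * c"] Q_add Q_mult E_sq[OF x]
      by (simp add: algebra_simps power2_eq_square)
  qed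
  have "field_cone Q'"
    unfolding field_cone_def
  proof (intro conjI ballI)
    show "1 \<in> Q'" using sub Q_1 by blast
    show "-1 \<notin> Q'"
    proof
      assume "-1 \<in> Q'"
      then obtain a b where ab: "-1 = a + x * b" "a \<in> Q" "b \<in> Q" by (auto simp: Q'_def)
      then have xb: "(- x) * b = 1 + a" by (metis add.commute add_diff_cancel_left' diff_minus_eq_add minus_mult_left uminus_add_conv_diff add.inverse_inverse)
      have "b \<noteq> 0" using ab Q_m1 by auto
      then have "- x = (1 + a) * inverse b" using xb by (metis mult.assoc mult.right_neutral right_inverse)
      then show False using \<open>- x \<notin> Q\<close> Q_mult[OF Q_add[OF Q_1 ab(2)] Q_inverse[OF ab(3)]] by simp
    qed
    fix y assume y: "y \<in> Q'"
    have "inverse (y\<^sup>2) \<in> Q'" using sub Q_inverse E_sq Q'E y by blast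
    then show "inverse y \<in> Q'" using inverse_eq[of y] m[OF y] by metis
    fix z assume z: "z \<in> Q'"
    show "y * z \<in> Q'" using m y z .
    show "(y - z)\<^sup>2 \<in> Q'" using sub E_sq E_diff Q'E y z by blast
    obtain a b c d where "y = a + x * b" "z = c + x * d" "a \<in> Q" "b \<in> Q" "c \<in> Q" "d \<in> Q"
      using y z by (auto simp: Q'_def)
    then show "y + z \<in> Q'" using I[of "a + c" "b + d"] Q_add by (simp add: algebra_simps)
  qed
  then have "Q' = Q" using maximal sub by blast
  then show "x \<in> Q" using I[OF Q_0 Q_1] by simp
qed

lemma Q_antisym: "x \<in> Q \<Longrightarrow> - x \<in> Q \<Longrightarrow> x = 0"
proof (rule ccontr)
  assume x: "x \<in> Q" "- x \<in> Q" "x \<noteq> 0"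
  then have "(- x) * inverse x \<in> Q" using Q_mult Q_inverse by blast
  then show False using x(3) Q_m1 by simp
qed

lemma Q_mult_neg: "x \<in> E \<Longrightarrow> y \<in> E \<Longrightarrow> x \<noteq> 0 \<Longrightarrow> y \<noteq> 0 \<Longrightarrow> x * y \<in> Q \<longleftrightarrow> (x \<in> Q \<longleftrightarrow> y \<in> Q)"
proof -
  assume xy: "x \<in> E" "y \<in> E" "x \<noteq> 0" "y \<noteq> 0"
  have n: "x * y \<in> Q \<Longrightarrow> - (x * y) \<notin> Q" using Q_antisym[of "x * y"] xy by auto
  consider "x \<in> Q" "y \<in> Q" | "x \<in> Q" "- y \<in> Q" "y \<notin> Q" | "- x \<in> Q" "y \<in> Q" "x \<notin> Q" | "- x \<in> Q" "- y \<in> Q" "x \<notin> Q" "y \<notin> Q"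
    using E_total xy by blast
  then show ?thesis
    by cases (use n Q_mult[of x y] Q_mult[of x "-y"] Q_mult[of "-x" y] Q_mult[of "-x" "-y"] in auto)
qed

section \<open>Polynomials with coefficients in the subfield\<close>

definition polE :: "'z poly \<Rightarrow> bool" where "polE p \<longleftrightarrow> (\<forall>i. coeff p i \<in> E)"

lemma E_0: "0 \<in> E" and E_1: "1 \<in> E"
  using Q_E Q_0 Q_1 by auto

lemma E_sum: "(\<And>i. i \<in> A \<Longrightarrow> f i \<in> E) \<Longrightarrow> sum f A \<in> E"
  by (induct A rule: infinite_finite_induct) (auto simp: E_0 E_add)

lemma polE_0: "polE 0" and polE_add: "polE p \<Longrightarrow> polE q \<Longrightarrow> polE (p + q)"
  and polE_diff: "polE p \<Longrightarrow> polE q \<Longrightarrow> polE (p - q)"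
  and polE_smult: "c \<in> E \<Longrightarrow> polE p \<Longrightarrow> polE (smult c p)"
  by (auto simp: polE_def E_0 E_add E_diff E_mult)

lemma polE_mult: "polE p \<Longrightarrow> polE q \<Longrightarrow> polE (p * q)"
  by (auto simp: polE_def coeff_mult intro!: E_sum E_mult)

lemma polE_pCons: "c \<in> E \<Longrightarrow> polE p \<Longrightarrow> polE (pCons c p)"
  by (auto simp: polE_def coeff_pCons split: nat.splits)

lemma polE_monom: "c \<in> E \<Longrightarrow> polE (monom c n)"
  by (auto simp: polE_def E_0)

lemma polE_1: "polE 1"
  by (simp add: one_pCons polE_pCons E_1 polE_0)

lemma poly_E: "polE p \<Longrightarrow> x \<in> E \<Longrightarrow> poly p x \<in> E"
proof (induct p)
  case (pCons a p)
  then have "a \<in> E" "polE p" unfolding polE_def by (metis coeff_pCons_0, metis coeff_pCons_Suc)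
  then show ?case using pCons by (auto intro!: E_add E_mult)
qed (simp add: E_0)

lemma polE_division:
  assumes "polE r" "r \<noteq> 0" "polE p"
  shows "\<exists>q s. polE q \<and> polE s \<and> p = q * r + s \<and> (s = 0 \<or> degree s < degree r)"
  using assms(3)
proof (induct "degree p" arbitrary: p rule: less_induct)
  case less
  show ?case
  proof (cases "p = 0 \<or> degree p < degree r")
    case True
    then show ?thesis using less(2) polE_0 by (intro exI[of _ 0] exI[of _ p]) auto
  next
    case False
    define t where "t = monom (lead_coeff p * inverse (lead_coeff r)) (degree p - degree r)"
    have tE: "polE t" unfolding t_def using less(2) assms(1) by (intro polE_monom E_mult E_inverse) (auto simp: polE_def)
    have t0: "t \<noteq> 0" using False assms(2) by (simp add: t_def)
    have dt: "degree (t * r) = degree p"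
      using False assms(2) t0 by (subst degree_mult_eq) (auto simp: t_def degree_monom_eq)
    have ct: "coeff (t * r) (degree p) = lead_coeff p"
      using False assms(2) by (simp add: t_def coeff_monom_mult)
    show ?thesis
    proof (cases "degree p = 0")
      case True
      have "p - t * r = 0" using dt ct True
        by (metis (no_types, opaque_lifting) coeff_diff degree_diff_le diff_self le_zero_eq leading_coeff_0_iff order_refl)
      then show ?thesis using tE polE_0 by (intro exI[of _ t] exI[of _ 0]) auto
    next
      case d0: False
      have "degree (p - t * r) < degree p"
        using d0 dt ct by (intro degree_lessI) (auto intro: le_less_trans simp: coeff_eq_0 le_less)
      moreover have "polE (p - t * r)" using tE less(2) assms(1) by (intro polE_diff polE_mult)
      ultimately obtain q s where "polE q" "polE s" "p - t * r = q * r + s" "s = 0 \<or> degree s < degree r"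
        using less(1) by blast
      then show ?thesis using tE by (intro exI[of _ "q + t"] exI[of _ s]) (auto simp: polE_add algebra_simps)
    qed
  qed
qed

text \<open>The values at a point \<open>c\<close> of these weighted sums of squares are the natural
  candidate for a cone that extends \<open>Q\<close> to E[c].\<close>

inductive_set wsos :: "'z poly set" where
  zero: "0 \<in> wsos"
| step: "q \<in> Q \<Longrightarrow> polE s \<Longrightarrow> \<sigma> \<in> wsos \<Longrightarrow> smult q (s * s) + \<sigma> \<in> wsos"

lemma wsos_single: "q \<in> Q \<Longrightarrow> polE s \<Longrightarrow> smult q (s * s) \<in> wsos"
  using wsos.step[OF _ _ wsos.zero] by simp

lemma wsos_add: "\<sigma> \<in> wsos \<Longrightarrow> \<tau> \<in> wsos \<Longrightarrow> \<sigma> + \<tau> \<in> wsos"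
  by (induct rule: wsos.induct) (auto simp: add.assoc intro: wsos.step)

lemma wsos_mult_single: "\<sigma> \<in> wsos \<Longrightarrow> q \<in> Q \<Longrightarrow> polE s \<Longrightarrow> smult q (s * s) * \<sigma> \<in> wsos"
proof (induct rule: wsos.induct)
  case (step q' s' \<sigma>)
  have "smult q (s * s) * (smult q' (s' * s') + \<sigma>) = smult (q * q') ((s * s') * (s * s')) + smult q (s * s) * \<sigma>"
    by (simp add: algebra_simps)
  then show ?case using step by (simp only:) (intro wsos.step Q_mult polE_mult, auto)
qed (simp add: wsos.zero)

lemma wsos_mult: "\<sigma> \<in> wsos \<Longrightarrow> \<tau> \<in> wsos \<Longrightarrow> \<sigma> * \<tau> \<in> wsos"
proof (induct rule: wsos.induct)
  case (step q s \<sigma>)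
  then show ?case unfolding distrib_right by (intro wsos_add wsos_mult_single) auto
qed (simp add: wsos.zero)

lemma wsos_polE: "\<sigma> \<in> wsos \<Longrightarrow> polE \<sigma>"
  by (induct rule: wsos.induct) (auto intro!: polE_0 polE_add polE_smult polE_mult Q_E)

lemma wsos_eval: "\<sigma> \<in> wsos \<Longrightarrow> x \<in> E \<Longrightarrow> poly \<sigma> x \<in> Q"
proof (induct rule: wsos.induct)
  case (step q s \<sigma>)
  then have "q * (poly s x)\<^sup>2 + poly \<sigma> x \<in> Q" by (intro Q_add Q_mult E_sq poly_E)
  then show ?case by (simp add: power2_eq_square)
qed (simp add: Q_0)

text \<open>Each polynomial under a square is reduced modulo \<open>m\<close>, which does not change
  its value at \<open>c\<close>. The degree bound later makes the cofactor of the minimal polynomial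
  smaller than that polynomial.\<close>

lemma wsos_reduce:
  assumes "polE m" "m \<noteq> 0" "poly m c = 0" "0 < degree m" "\<sigma> \<in> wsos"
  shows "\<exists>\<tau>\<in>wsos. poly \<tau> c = poly \<sigma> c \<and> degree \<tau> \<le> 2 * (degree m - 1)"
  using assms(5)
proof (induct rule: wsos.induct)
  case zero
  then show ?case by (intro bexI[of _ 0] wsos.zero) auto
next
  case (step q s \<sigma>)
  then obtain \<tau> where \<tau>: "\<tau> \<in> wsos" "poly \<tau> c = poly \<sigma> c" "degree \<tau> \<le> 2 * (degree m - 1)" by blast
  obtain t r where r: "polE r" "s = t * m + r" "r = 0 \<or> degree r < degree m"
    using polE_division[OF assms(1,2) step(2)] by blast
  have dr: "degree r \<le> degree m - 1" using r(3) assms(4) by auto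
  have "degree (smult q (r * r)) \<le> 2 * (degree m - 1)"
    using degree_smult_le[of q "r * r"] degree_mult_le[of r r] dr by linarith
  then have "degree (smult q (r * r) + \<tau>) \<le> 2 * (degree m - 1)" using \<tau>(3) degree_add_le by blast
  moreover have "poly (smult q (r * r) + \<tau>) c = poly (smult q (s * s) + \<sigma>) c"
    using \<tau>(2) r(2) assms(3) by simp
  ultimately show ?case using wsos.step[OF step(1) r(1) \<tau>(1)] by blast
qed

text \<open>E[c] is a field. The recursion on remainders of \<open>p\<close> does not break down,
  because minimality forbids a nonzero remainder of smaller degree to vanish at
  \<open>c\<close>.\<close>

lemma inverse_of_poly_value:
  assumes p: "polE p" "p \<noteq> 0" "poly p c = 0"
    and min: "\<And>m. polE m \<Longrightarrow> m \<noteq> 0 \<Longrightarrow> poly m c = 0 \<Longrightarrow> degree p \<le> degree m"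
    and r: "polE r" "poly r c \<noteq> 0"
  shows "\<exists>t. polE t \<and> poly t c * poly r c = 1"
proof -
  have *: "\<exists>t. polE t \<and> poly t c * poly r c = 1"
    if "polE r" "poly r c \<noteq> 0" "degree r < degree p" for r
    using that
  proof (induct "degree r" arbitrary: r rule: less_induct)
    case less
    have r0: "r \<noteq> 0" using less(3) by auto
    obtain q r' where q: "polE q" "polE r'" "p = q * r + r'" "r' = 0 \<or> degree r' < degree r"
      using polE_division[OF less(2) r0 p(1)] by blast
    have e: "poly q c * poly r c + poly r' c = 0" using p(3) q(3) by simp
    show ?case
    proof (cases "r' = 0")
      case True
      \<comment> \<open>Here p = q r with q(c) = 0, so minimality gives \<open>q\<close> the full
        degree of \<open>p\<close> and leaves \<open>r\<close> constant.\<close>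
      then have "poly q c = 0" "q \<noteq> 0" using e less(3) p(2) q(3) by auto
      then have "degree p \<le> degree q" using min q(1) by blast
      moreover have "degree p = degree q + degree r" using True q(3) \<open>q \<noteq> 0\<close> r0 by (simp add: degree_mult_eq)
      ultimately have "degree r = 0" by simp
      then obtain k where k: "r = [:k:]" by (rule degree_eq_zeroE)
      then have "k \<in> E" "k \<noteq> 0" using less(2) r0 unfolding polE_def by (metis coeff_pCons_0, simp)
      then show ?thesis using k by (intro exI[of _ "[:inverse k:]"]) (auto simp: E_inverse polE_pCons polE_0)
    next
      case False
      then have d: "degree r' < degree r" using q(4) by simp
      have "poly r' c \<noteq> 0" using min[OF q(2) False] d less(4) by auto
      then obtain t where t: "polE t" "poly t c * poly r' c = 1"
        using less(1)[OF d q(2)] d less(4) by auto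
      have "poly r' c = - (poly q c * poly r c)" using e by (simp add: add_eq_0_iff)
      then have "(- (poly t c * poly q c)) * poly r c = 1" using t(2) by (simp add: mult.assoc)
      then show ?thesis using t(1) q(1) polE_diff[OF polE_0 polE_mult[OF t(1) q(1)]]
        by (intro exI[of _ "- (t * q)"]) auto
    qed
  qed
  obtain q s where s: "polE s" "r = q * p + s" "s = 0 \<or> degree s < degree p"
    using polE_division[OF p(1,2) r(1)] by blast
  have "poly s c = poly r c" using s(2) p(3) by simp
  moreover have "s \<noteq> 0" using r(2) calculation by auto
  ultimately show ?thesis using *[OF s(1)] s(3) r(2) by auto
qed

text \<open>If no polynomial over \<open>E\<close> of smaller degree than \<open>p\<close> vanishes at \<open>c\<close>, then the cone of weighted
  sums of squares in \<open>E[c]\<close> is proper: otherwise \<open>p\<close> would divide some \<open>1 + \<sigma>\<close> with cofactor of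
  degree less than that of \<open>p\<close> and changing sign between \<open>a\<close> and \<open>b\<close>.\<close>

lemma minimal_root_in_E:
  assumes p: "polE p" "p \<noteq> 0" "poly p c = 0" "0 < degree p"
    and min: "\<And>m. polE m \<Longrightarrow> m \<noteq> 0 \<Longrightarrow> poly m c = 0 \<Longrightarrow> degree p \<le> degree m"
    and ab: "a \<in> E" "b \<in> E" "poly p a \<notin> Q" "- poly p b \<notin> Q"
    and ivt: "\<And>g. polE g \<Longrightarrow> degree g < degree p \<Longrightarrow> poly g a \<notin> Q \<Longrightarrow> - poly g b \<notin> Q \<Longrightarrow> \<exists>e\<in>E. poly g e = 0"
  shows "c \<in> E"
proof -
  define Q1 where "Q1 = {poly \<sigma> c |\<sigma>. \<sigma> \<in> wsos}"
  have I: "poly \<sigma> c \<in> Q1" if "\<sigma> \<in> wsos" for \<sigma> using that by (auto simp: Q1_def)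
  have sub: "Q \<subseteq> Q1" using I[OF wsos_single[OF _ polE_1]] by auto
  have sqI: "(poly s c)\<^sup>2 \<in> Q1" if "polE s" for s
    using I[OF wsos_single[OF Q_1 that]] by (simp add: power2_eq_square)
  have "field_cone Q1"
    unfolding field_cone_def
  proof (intro conjI ballI)
    show "1 \<in> Q1" using sub Q_1 by blast
    show "-1 \<notin> Q1"
    proof
      assume "-1 \<in> Q1"
      then obtain \<sigma>0 where "\<sigma>0 \<in> wsos" "poly \<sigma>0 c = -1" by (auto simp: Q1_def)
      then obtain \<sigma> where \<sigma>: "\<sigma> \<in> wsos" "poly \<sigma> c = -1" "degree \<sigma> \<le> 2 * (degree p - 1)"
        using wsos_reduce[OF p(1-4)] by metis
      obtain g s where g: "polE g" "polE s" "1 + \<sigma> = g * p + s" "s = 0 \<or> degree s < degree p"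
        using polE_division[OF p(1,2) polE_add[OF polE_1 wsos_polE[OF \<sigma>(1)]]] by blast
      have "poly (1 + \<sigma>) c = 0" using \<sigma>(2) by simp
      then have "poly s c = 0" unfolding g(3) using p(3) by simp
      then have "s = 0" using min[OF g(2)] g(4) by (meson not_le)
      then have gp: "1 + \<sigma> = g * p" using g(3) by simp
      have pos: "- (1 + poly \<sigma> x) \<notin> Q" if "x \<in> E" for x
      proof
        assume "- (1 + poly \<sigma> x) \<in> Q"
        then have "- (1 + poly \<sigma> x) + poly \<sigma> x \<in> Q" using wsos_eval[OF \<sigma>(1) that] by (rule Q_add)
        then show False using Q_m1 by simp
      qed
      have ev: "1 + poly \<sigma> x = poly g x * poly p x" for x
        using arg_cong[OF gp, of "\<lambda>p. poly p x"] by simp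
      have g0: "g \<noteq> 0" using pos[OF E_0] ev[of 0] Q_0 by auto
      have "degree (1 + \<sigma>) \<le> 2 * (degree p - 1)" using \<sigma>(3) by (intro degree_add_le) auto
      then have "degree g + degree p \<le> 2 * (degree p - 1)"
        unfolding gp using g0 p(2) by (simp add: degree_mult_eq)
      then have dg: "degree g < degree p" using p(4) by linarith
      have E: "poly g x \<in> E" "poly p x \<in> E" if "x \<in> E" for x using poly_E g(1) p(1) that by auto
      have nz: "poly g x \<noteq> 0" "poly p x \<noteq> 0" "poly g x * poly p x \<in> Q" if "x \<in> E" for x
        using pos[OF that] ev[of x] Q_0 E_total[OF E_mult[OF E(1)[OF that] E(2)[OF that]]] by auto
      have "poly g a \<notin> Q"
        using nz[OF ab(1)] Q_mult_neg[OF E(1)[OF ab(1)] E(2)[OF ab(1)]] ab(3) by blast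
      moreover have "poly p b \<in> Q" using ab(4) E_total[OF E(2)[OF ab(2)]] by blast
      then have "poly g b \<in> Q"
        using nz[OF ab(2)] Q_mult_neg[OF E(1)[OF ab(2)] E(2)[OF ab(2)]] by blast
      then have "- poly g b \<notin> Q" using Q_antisym nz(1)[OF ab(2)] by blast
      ultimately obtain e where "e \<in> E" "poly g e = 0" using ivt[OF g(1) dg] by blast
      then show False using nz(1) by blast
    qed
    fix x assume "x \<in> Q1"
    then obtain \<sigma> where x: "x = poly \<sigma> c" "\<sigma> \<in> wsos" by (auto simp: Q1_def)
    show "inverse x \<in> Q1"
    proof (cases "x = 0")
      case True then show ?thesis using sub Q_0 by auto
    next
      case False
      then obtain t where t: "polE t" "poly t c * x = 1"
        using inverse_of_poly_value[OF p(1-3) min wsos_polE[OF x(2)]] x(1) by blast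
      have "inverse x = poly (smult 1 (t * t) * \<sigma>) c"
      proof -
        have "inverse x = poly t c" using t(2) False by (metis inverse_unique mult.commute)
        also have "\<dots> = poly t c * (poly t c * x)" using t(2) by simp
        finally show ?thesis by (simp add: x(1) mult.assoc)
      qed
      then show ?thesis using I[OF wsos_mult_single[OF x(2) Q_1 t(1)]] by simp
    qed
    fix y assume "y \<in> Q1"
    then obtain \<tau> where y: "y = poly \<tau> c" "\<tau> \<in> wsos" by (auto simp: Q1_def)
    show "x + y \<in> Q1" using I[OF wsos_add[OF x(2) y(2)]] x(1) y(1) by simp
    show "x * y \<in> Q1" using I[OF wsos_mult[OF x(2) y(2)]] x(1) y(1) by simp
    show "(x - y)\<^sup>2 \<in> Q1" using sqI[OF polE_diff[OF wsos_polE[OF x(2)] wsos_polE[OF y(2)]]] x(1) y(1) by simp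
  qed
  then have Q1: "Q1 = Q" using maximal sub by blast
  have two: "(2::'z) \<noteq> 0"
  proof
    assume "(2::'z) = 0"
    then have "(-1::'z) = 1" by (metis add_eq_0_iff one_add_one)
    then show False using Q_1 Q_m1 by metis
  qed
  \<comment> \<open>With h = 1/2, \<open>c\<close> is the difference of the squares of (c + 1)/2 and
    (c - 1)/2. Both squares lie in \<open>Q1\<close>, now equal to \<open>Q\<close>, so
    \<open>c\<close> lies in \<open>E\<close>.\<close>
  define h :: 'z where "h = inverse 2"
  have hE: "h \<in> E" using E_inverse[OF E_add[OF E_1 E_1]] by (simp add: h_def)
  have "(poly [:h, h:] c)\<^sup>2 - (poly [:-h, h:] c)\<^sup>2 = c"
  proof -
    have "(poly [:h, h:] c)\<^sup>2 - (poly [:-h, h:] c)\<^sup>2 = (h * 2) * (h * 2) * c"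
      by (simp add: power2_eq_square algebra_simps)
    moreover have "h * 2 = 1" using two by (simp add: h_def)
    ultimately show ?thesis by simp
  qed
  moreover have "(poly [:h, h:] c)\<^sup>2 - (poly [:-h, h:] c)\<^sup>2 \<in> E"
    using hE by (intro E_I sqI[unfolded Q1] polE_pCons polE_0 E_minus)
  ultimately show ?thesis by simp
qed

text \<open>The end points may come in either order, because the induction exchanges
  \<open>a\<close> and \<open>b\<close> when the sign changes the other way.\<close>

definition between :: "'z \<Rightarrow> 'z \<Rightarrow> 'z \<Rightarrow> bool" where
  "between c a b \<longleftrightarrow> c - a \<in> Q \<and> b - c \<in> Q \<or> c - b \<in> Q \<and> a - c \<in> Q"

text \<open>Strong induction on the degree. A root \<open>c\<close> in the algebraic closure has a
  minimal polynomial \<open>m\<close>. If \<open>m\<close> has smaller degree, \<open>p\<close>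
  splits and one factor changes sign between \<open>a\<close> and \<open>b\<close>; otherwise
  \<open>c\<close> lies in \<open>E\<close>, which forces \<open>p\<close> to be linear with root
  \<open>c\<close>.\<close>

theorem ivt_E:
  assumes "polE p" "a \<in> E" "b \<in> E" "poly p a \<notin> Q" "- poly p b \<notin> Q"
  shows "\<exists>c\<in>E. between c a b \<and> poly p c = 0"
  using assms
proof (induct "degree p" arbitrary: p a b rule: less_induct)
  case less
  note a = less(3) and b = less(4)
  have pE: "poly p x \<in> E" if "x \<in> E" for x using poly_E less(2) that by blast
  have d0: "0 < degree p"
  proof (rule ccontr)
    assume "\<not> 0 < degree p"
    then obtain k where "p = [:k:]" by (auto elim: degree_eq_zeroE)
    then show False using less(5,6) pE[OF a] E_total by auto
  qed
  then have p0: "p \<noteq> 0" by auto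
  obtain c where c: "poly p c = 0" using alg_closed_imp_poly_has_root[OF d0] by blast
  obtain m where m: "polE m" "m \<noteq> 0" "poly m c = 0"
    and min: "\<And>m'. polE m' \<and> m' \<noteq> 0 \<and> poly m' c = 0 \<Longrightarrow> degree m \<le> degree m'"
    using ex_has_least_nat[of "\<lambda>m. polE m \<and> m \<noteq> 0 \<and> poly m c = 0" p degree] less(2) p0 c by blast
  show ?case
  proof (cases "degree m < degree p")
    case True
    obtain q s where q: "polE q" "polE s" "p = q * m + s" "s = 0 \<or> degree s < degree m"
      using polE_division[OF m(1,2) less(2)] by blast
    have "poly s c = 0" using c m(3) q(3) by simp
    then have "s = 0" using min[of s] q(2,4) by (meson not_le)
    then have p: "p = q * m" using q(3) by simp
    have dm: "0 < degree m"
      using m(2,3) by (metis degree_eq_zeroE gr0I mult_zero_right add_0_right poly_pCons poly_0 pCons_0_0)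
    have dq: "degree q < degree p"
      using p p0 dm by (simp add: degree_mult_eq)
    have E: "poly q x \<in> E" "poly m x \<in> E" if "x \<in> E" for x using poly_E q(1) m(1) that by auto
    have na: "poly q a \<noteq> 0" "poly m a \<noteq> 0" and nb: "poly q b \<noteq> 0" "poly m b \<noteq> 0"
      using less(5,6) p Q_0 by auto
    have sa: "\<not> (poly q a \<in> Q \<longleftrightarrow> poly m a \<in> Q)"
      using less(5) Q_mult_neg[OF E(1)[OF a] E(2)[OF a] na] p by simp
    have "poly p b \<in> Q" using less(6) E_total[OF pE[OF b]] by blast
    then have sb: "poly q b \<in> Q \<longleftrightarrow> poly m b \<in> Q"
      using Q_mult_neg[OF E(1)[OF b] E(2)[OF b] nb] p by simp
    have neg: "- x \<notin> Q" if "x \<in> Q" "x \<noteq> 0" for x using Q_antisym that by blast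
    have *: "\<exists>e\<in>E. between e a b \<and> poly r e = 0"
      if "polE r" "degree r < degree p" "poly r a \<noteq> 0" "poly r b \<noteq> 0" "\<not> (poly r a \<in> Q \<longleftrightarrow> poly r b \<in> Q)" for r
    proof (cases "poly r a \<in> Q")
      case True
      then have "\<exists>e\<in>E. between e b a \<and> poly r e = 0" using that a b neg by (intro less(1)) auto
      then show ?thesis by (auto simp: between_def)
    next
      case False
      then show ?thesis using that a b neg by (intro less(1)) auto
    qed
    have "(\<exists>e\<in>E. between e a b \<and> poly q e = 0) \<or> (\<exists>e\<in>E. between e a b \<and> poly m e = 0)"
      using *[OF q(1) dq na(1) nb(1)] *[OF m(1) True na(2) nb(2)] sa sb by blast
    then show ?thesis using p by auto
  next
    case False
    then have min': "degree p \<le> degree m'" if "polE m'" "m' \<noteq> 0" "poly m' c = 0" for m'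
      using min that by (metis leI le_trans)
    have cE: "c \<in> E"
    proof (rule minimal_root_in_E[OF less(2) p0 c d0 min' a b less(5,6)])
      fix g assume g: "polE g" "degree g < degree p"
      show "\<exists>e\<in>E. poly g e = 0" if "poly g a \<notin> Q" "- poly g b \<notin> Q" using less(1)[OF g(2,1) a b] that by blast
    qed
    have "polE [:-c, 1:]" using cE by (intro polE_pCons polE_0 E_minus E_1)
    then have "degree p \<le> 1" using min'[of "[:-c, 1:]"] by simp
    then have d1: "degree p = 1" using d0 by simp
    obtain k where k: "p = [:-c, 1:] * k" using c by (metis dvdE poly_eq_0_iff_dvd)
    have "k \<noteq> 0" using p0 k by auto
    then have "degree p = degree [:-c, 1:] + degree k" unfolding k by (intro degree_mult_eq) auto
    then have "degree k = 0" using d1 by simp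
    then obtain l where l: "k = [:l:]" by (rule degree_eq_zeroE)
    have px: "poly p x = (x - c) * l" for x by (simp add: k l algebra_simps)
    have lE: "l \<in> E" using pE[OF E_add[OF cE E_1]] px[of "c + 1"] by simp
    have l0: "l \<noteq> 0" using \<open>k \<noteq> 0\<close> l by simp
    have n: "a - c \<noteq> 0" "b - c \<noteq> 0" using less(5,6) px Q_0 by auto
    have ac: "\<not> (a - c \<in> Q \<longleftrightarrow> l \<in> Q)"
      using less(5) Q_mult_neg[OF E_diff[OF a cE] lE n(1) l0] px by simp
    have "poly p b \<in> Q" using less(6) E_total[OF pE[OF b]] by blast
    then have bc: "b - c \<in> Q \<longleftrightarrow> l \<in> Q"
      using Q_mult_neg[OF E_diff[OF b cE] lE n(2) l0] px by simp
    have "between c a b"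
      using ac bc E_total[OF E_diff[OF a cE]] E_total[OF E_diff[OF b cE]] by (auto simp: between_def)
    then show ?thesis using cE c by blast
  qed
qed

end


section \<open>Preorderings and prime cones\<close>

definition ring_preordering :: "'a::comm_ring_1 set \<Rightarrow> bool" where
  "ring_preordering T \<longleftrightarrow> (\<forall>x\<in>T. \<forall>y\<in>T. x + y \<in> T \<and> x * y \<in> T) \<and> (\<forall>x. x\<^sup>2 \<in> T)"

lemma preordering_add: "ring_preordering T \<Longrightarrow> x \<in> T \<Longrightarrow> y \<in> T \<Longrightarrow> x + y \<in> T"
  and preordering_mult: "ring_preordering T \<Longrightarrow> x \<in> T \<Longrightarrow> y \<in> T \<Longrightarrow> x * y \<in> T"
  and preordering_sq: "ring_preordering T \<Longrightarrow> x\<^sup>2 \<in> T"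
  by (simp_all add: ring_preordering_def)

lemma preordering_0: "ring_preordering T \<Longrightarrow> 0 \<in> T" and preordering_1: "ring_preordering T \<Longrightarrow> 1 \<in> T"
  using preordering_sq[of T 0] preordering_sq[of T 1] by simp_all

text \<open>A point of the real spectrum: the same data as a prime ideal together with an ordering
  of the quotient domain.\<close>

definition prime_cone :: "'a::comm_ring_1 set \<Rightarrow> bool" where
  "prime_cone P \<longleftrightarrow> ring_preordering P \<and> -1 \<notin> P \<and> (\<forall>x y. x * y \<in> P \<longrightarrow> x \<in> P \<or> - y \<in> P)"

lemma preordering_adjoin:
  assumes "ring_preordering T"
  shows "ring_preordering {s + x * t |s t. s \<in> T \<and> t \<in> T}" (is "ring_preordering ?T")
    and "T \<subseteq> {s + x * t |s t. s \<in> T \<and> t \<in> T}" and "x \<in> {s + x * t |s t. s \<in> T \<and> t \<in> T}"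
proof -
  have I: "s + x * t \<in> ?T" if "s \<in> T" "t \<in> T" for s t using that by blast
  show sub: "T \<subseteq> ?T" using I[OF _ preordering_0[OF assms]] by auto
  show "x \<in> ?T" using I[OF preordering_0[OF assms] preordering_1[OF assms]] by simp
  show "ring_preordering ?T"
    unfolding ring_preordering_def
  proof (intro conjI ballI allI)
    fix y z assume "y \<in> ?T" "z \<in> ?T"
    then obtain s t s' t' where yz: "y = s + x * t" "z = s' + x * t'" and m: "s \<in> T" "t \<in> T" "s' \<in> T" "t' \<in> T"
      by blast
    have "(s + s') + x * (t + t') \<in> ?T"
      by (intro I preordering_add[OF assms] m)
    then show "y + z \<in> ?T" unfolding yz by (simp add: algebra_simps)
    have "(s * s' + x\<^sup>2 * (t * t')) + x * (s * t' + t * s') \<in> ?T"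
      by (intro I preordering_add[OF assms] preordering_mult[OF assms] preordering_sq[OF assms] m)
    then show "y * z \<in> ?T" unfolding yz by (simp add: algebra_simps power2_eq_square)
  next
    fix y show "y\<^sup>2 \<in> ?T" using sub preordering_sq[OF assms] by blast
  qed
qed

text \<open>A maximal proper preordering is a prime cone: if x and -y both fail to belong to it,
  adjoining either produces -1, and for x y inside, the two certificates multiply to one inside the
  preordering itself.\<close>

lemma prime_cone_exists:
  assumes "ring_preordering T" "-1 \<notin> T"
  shows "\<exists>P. prime_cone P \<and> T \<subseteq> P"
proof -
  let ?A = "{P. ring_preordering P \<and> -1 \<notin> P \<and> T \<subseteq> P}"
  have "\<exists>M\<in>?A. \<forall>N1\<in>?A. M \<subseteq> N1 \<longrightarrow> N1 = M"
  proof (rule subset_Zorn_nonempty)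
    show "?A \<noteq> {}" using assms by blast
    fix C assume ne: "C \<noteq> {}" and ch: "subset.chain ?A C"
    have mem: "ring_preordering P" "-1 \<notin> P" "T \<subseteq> P" if "P \<in> C" for P
      using ch that by (auto simp: subset.chain_def)
    have two: "\<exists>Q\<in>C. x \<in> Q \<and> y \<in> Q" if xy: "x \<in> \<Union>C" "y \<in> \<Union>C" for x y
    proof -
      obtain N1 N2 where "N1 \<in> C" "N2 \<in> C" "x \<in> N1" "y \<in> N2" using xy by blast
      moreover have "N1 \<subseteq> N2 \<or> N2 \<subseteq> N1" using ch calculation unfolding subset.chain_def by blast
      ultimately show ?thesis by blast
    qed
    have "ring_preordering (\<Union>C)"
      unfolding ring_preordering_def
    proof (intro conjI ballI allI)
      fix x y assume "x \<in> \<Union>C" "y \<in> \<Union>C"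
      then obtain Q where "Q \<in> C" "x \<in> Q" "y \<in> Q" using two by blast
      then show "x + y \<in> \<Union>C" "x * y \<in> \<Union>C" using mem(1) preordering_add preordering_mult by blast+
    next
      fix x show "x\<^sup>2 \<in> \<Union>C" using ne mem(1) preordering_sq by blast
    qed
    then show "\<Union>C \<in> ?A" using ne mem by blast
  qed
  then obtain M where "M \<in> ?A" and mx: "\<forall>N1\<in>?A. M \<subseteq> N1 \<longrightarrow> N1 = M" by (rule bexE)
  then have M: "ring_preordering M" "-1 \<notin> M" "T \<subseteq> M" by simp_all
  have max: "N1 = M" if "ring_preordering N1" "-1 \<notin> N1" "M \<subseteq> N1" for N1
    using mx[rule_format, of N1] that M(3) by simp
  have ext: "\<exists>s\<in>M. \<exists>t\<in>M. -1 = s + x * t" if "x \<notin> M" for x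
  proof (rule ccontr)
    assume *: "\<not> ?thesis"
    let ?N1 = "{s + x * t |s t. s \<in> M \<and> t \<in> M}"
    have "-1 \<notin> ?N1" using * by blast
    then have "?N1 = M"
      using preordering_adjoin(1,2)[OF M(1), of x] by (intro max)
    then show False using preordering_adjoin(3)[OF M(1), of x] that by blast
  qed
  have "x \<in> M \<or> - y \<in> M" if xy: "x * y \<in> M" for x y
  proof (rule ccontr)
    assume "\<not> ?thesis"
    then obtain s t u v where st: "-1 = s + x * t" "-1 = u + (- y) * v"
      and m: "s \<in> M" "t \<in> M" "u \<in> M" "v \<in> M" using ext[of x] ext[of "- y"] by blast
    have "s = -1 - x * t" using st(1) by (simp add: eq_diff_eq)
    moreover have "u = -1 - (- y) * v" unfolding eq_diff_eq by (rule st(2)[symmetric])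
    \<comment> \<open>Expansion of (1 + s) (1 + u) = - x y t v, where 1 + s = - x t and 1 + u = y
      v.\<close>
    moreover have "-1 = (-1 - x * t) + (-1 - (- y) * v) + (-1 - x * t) * (-1 - (- y) * v) + (x * y) * (t * v)"
      by (simp add: algebra_simps)
    ultimately have "-1 = s + u + s * u + (x * y) * (t * v)" by simp
    moreover have "s + u + s * u + (x * y) * (t * v) \<in> M"
      by (intro preordering_add[OF M(1)] m preordering_mult[OF M(1) m(1) m(3)]
          preordering_mult[OF M(1) xy preordering_mult[OF M(1) m(2) m(4)]])
    ultimately show False using M(2) by simp
  qed
  then show ?thesis using M unfolding prime_cone_def by blast
qed

lemma prime_cone_total: "prime_cone P \<Longrightarrow> x \<in> P \<or> - x \<in> P"
  unfolding prime_cone_def ring_preordering_def by (metis power2_eq_square)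

section \<open>The support of a prime cone, a prime ideal\<close>

definition cone_support :: "'a::comm_ring_1 set \<Rightarrow> 'a set" where
  "cone_support P = {x. x \<in> P \<and> - x \<in> P}"

lemma cone_support_add: "prime_cone P \<Longrightarrow> x \<in> cone_support P \<Longrightarrow> y \<in> cone_support P \<Longrightarrow> x + y \<in> cone_support P"
  using preordering_add[of P "-x" "-y"] by (auto simp: cone_support_def prime_cone_def preordering_add)

lemma cone_support_minus: "x \<in> cone_support P \<Longrightarrow> - x \<in> cone_support P"
  by (auto simp: cone_support_def)

lemma cone_support_diff: "prime_cone P \<Longrightarrow> x \<in> cone_support P \<Longrightarrow> y \<in> cone_support P \<Longrightarrow> x - y \<in> cone_support P"
  using cone_support_add[of P x "- y"] cone_support_minus[of y P] by simp

lemma cone_support_0: "prime_cone P \<Longrightarrow> 0 \<in> cone_support P"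
  by (simp add: cone_support_def prime_cone_def preordering_0)

lemma cone_support_1: "prime_cone P \<Longrightarrow> 1 \<notin> cone_support P"
  by (simp add: cone_support_def prime_cone_def)

lemma cone_support_mult:
  assumes P: "prime_cone P" and x: "x \<in> cone_support P"
  shows "a * x \<in> cone_support P"
proof -
  have p: "ring_preordering P" using P by (simp add: prime_cone_def)
  have x: "x \<in> P" "- x \<in> P" using x by (auto simp: cone_support_def)
  from prime_cone_total[OF P, of a] show ?thesis
    using preordering_mult[OF p _ x(1), of a] preordering_mult[OF p _ x(2), of a]
      preordering_mult[OF p _ x(1), of "- a"] preordering_mult[OF p _ x(2), of "- a"]
    by (auto simp: cone_support_def)
qed

lemma cone_support_prime:
  assumes P: "prime_cone P" and xy: "x * y \<in> cone_support P"
  shows "x \<in> cone_support P \<or> y \<in> cone_support P"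
proof -
  have pr: "a \<in> P \<or> - b \<in> P" if "a * b \<in> P" for a b using P that by (simp add: prime_cone_def)
  have "x * y \<in> P" "x * (- y) \<in> P" "(- x) * y \<in> P" "(- x) * (- y) \<in> P"
    using xy by (auto simp: cone_support_def)
  from this[THEN pr] show ?thesis by (auto simp: cone_support_def)
qed

lemma prime_cone_add_support:
  assumes "prime_cone P" "x \<in> P" "y - x \<in> cone_support P"
  shows "y \<in> P"
  using preordering_add[of P x "y - x"] assms by (auto simp: prime_cone_def cone_support_def)


section \<open>Every prime cone is realised by real points\<close>

text \<open>Finitely many conditions at a time are what the transfer of signs provides and what a
  description by finitely many generators asks for.\<close>

definition realised :: "'n::finite real_mpoly set \<Rightarrow> bool" where
  "realised P \<longleftrightarrow> (\<forall>S. finite S \<longrightarrow> S \<subseteq> P \<longrightarrow> (\<exists>x. \<forall>p\<in>S. 0 \<le> mpoly_eval p x))"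

text \<open>Nonnegativity at the origin. It ensures that a cone can be chosen even if there is no
  counterexample.\<close>

lemma ex_prime_cone: "\<exists>P :: 'n::finite real_mpoly set. prime_cone P"
proof
  have h: "is_ring_hom (\<lambda>p :: 'n real_mpoly. mpoly_eval p 0)" by (rule is_ring_hom_mpoly_eval)
  show "prime_cone {p :: 'n real_mpoly. 0 \<le> mpoly_eval p 0}"
    unfolding prime_cone_def ring_preordering_def
    by (auto simp: is_ring_hom_add[OF h] is_ring_hom_mult[OF h] is_ring_hom_uminus[OF h] is_ring_hom_1[OF h]
        is_ring_hom_power[OF h] zero_le_mult_iff)
qed

text \<open>A real closed field that extends the quotient by a prime cone has to be a type of its own.
  As types cannot depend on local data, a single cone is chosen globally, and it is chosen to be
  a counterexample to the claim whenever there is one.\<close>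

definition chosen_cone :: "'n::finite real_mpoly set" where
  "chosen_cone = (SOME P. prime_cone P \<and> ((\<exists>P' :: 'n real_mpoly set. prime_cone P' \<and> \<not> realised P') \<longrightarrow> \<not> realised P))"

lemma chosen_cone:
  "prime_cone (chosen_cone :: 'n::finite real_mpoly set)"
  "realised (chosen_cone :: 'n real_mpoly set) \<Longrightarrow> prime_cone P \<Longrightarrow> realised (P :: 'n real_mpoly set)"
proof -
  have "\<exists>P :: 'n real_mpoly set. prime_cone P \<and> ((\<exists>P' :: 'n real_mpoly set. prime_cone P' \<and> \<not> realised P') \<longrightarrow> \<not> realised P)"
    using ex_prime_cone by blast
  note * = someI_ex[OF this, folded chosen_cone_def]
  show "prime_cone (chosen_cone :: 'n real_mpoly set)" using * ..
  show "realised (chosen_cone :: 'n real_mpoly set) \<Longrightarrow> prime_cone P \<Longrightarrow> realised (P :: 'n real_mpoly set)"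
    using * by blast
qed

section \<open>The quotient domain and its ordering\<close>

lemma equivp_cone_support:
  "equivp (\<lambda>x y :: 'n::finite real_mpoly. x - y \<in> cone_support chosen_cone)"
proof (rule equivpI)
  show "reflp (\<lambda>x y :: 'n real_mpoly. x - y \<in> cone_support chosen_cone)"
    by (simp add: reflp_def cone_support_0 chosen_cone(1))
  show "symp (\<lambda>x y :: 'n real_mpoly. x - y \<in> cone_support chosen_cone)"
    unfolding symp_def by (intro allI impI) (drule cone_support_minus, simp)
  show "transp (\<lambda>x y :: 'n real_mpoly. x - y \<in> cone_support chosen_cone)"
    unfolding transp_def by (intro allI impI) (drule (1) cone_support_add[OF chosen_cone(1)], simp)
qed

quotient_type (overloaded) 'n cone_quotient = "'n::finite real_mpoly" / "\<lambda>x y. x - y \<in> cone_support chosen_cone"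
  by (rule equivp_cone_support)

instantiation cone_quotient :: (finite) idom
begin

lift_definition zero_cone_quotient :: "'a cone_quotient" is 0 .
lift_definition one_cone_quotient :: "'a cone_quotient" is 1 .
lift_definition plus_cone_quotient :: "'a cone_quotient \<Rightarrow> 'a cone_quotient \<Rightarrow> 'a cone_quotient" is "(+)"
  unfolding add_diff_add by (rule cone_support_add[OF chosen_cone(1)])
lift_definition uminus_cone_quotient :: "'a cone_quotient \<Rightarrow> 'a cone_quotient" is uminus
  unfolding minus_diff_minus by (rule cone_support_minus)
lift_definition minus_cone_quotient :: "'a cone_quotient \<Rightarrow> 'a cone_quotient \<Rightarrow> 'a cone_quotient" is "(-)"
proof -
  fix a b c d :: "'a real_mpoly"
  assume "a - b \<in> cone_support chosen_cone" "c - d \<in> cone_support chosen_cone"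
  then have "(a - b) - (c - d) \<in> cone_support chosen_cone"
    by (rule cone_support_diff[OF chosen_cone(1)])
  then show "a - c - (b - d) \<in> cone_support chosen_cone" by (simp add: algebra_simps)
qed
lift_definition times_cone_quotient :: "'a cone_quotient \<Rightarrow> 'a cone_quotient \<Rightarrow> 'a cone_quotient" is "(*)"
proof -
  fix a b c d :: "'a real_mpoly"
  assume "a - b \<in> cone_support chosen_cone" "c - d \<in> cone_support chosen_cone"
  then have "c * (a - b) + b * (c - d) \<in> cone_support chosen_cone"
    by (intro cone_support_add cone_support_mult chosen_cone(1))
  then show "a * c - b * d \<in> cone_support chosen_cone" by (simp add: algebra_simps)
qed

instance
proof
  fix a b c :: "'a cone_quotient"
  show "a + b + c = a + (b + c)" by transfer (simp add: cone_support_0 chosen_cone(1) algebra_simps)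
  show "a + b = b + a" by transfer (simp add: cone_support_0 chosen_cone(1) algebra_simps)
  show "0 + a = a" by transfer (simp add: cone_support_0 chosen_cone(1))
  show "- a + a = 0" by transfer (simp add: cone_support_0 chosen_cone(1))
  show "a - b = a + - b" by transfer (simp add: cone_support_0 chosen_cone(1))
  show "a * b * c = a * (b * c)" by transfer (simp add: cone_support_0 chosen_cone(1) algebra_simps)
  show "a * b = b * a" by transfer (simp add: cone_support_0 chosen_cone(1) algebra_simps)
  show "1 * a = a" by transfer (simp add: cone_support_0 chosen_cone(1))
  show "(a + b) * c = a * c + b * c" by transfer (simp add: cone_support_0 chosen_cone(1) algebra_simps)
  show "0 * a = 0" by transfer (simp add: cone_support_0 chosen_cone(1))
  show "a * 0 = 0" by transfer (simp add: cone_support_0 chosen_cone(1))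
  show "a * (b + c) = a * b + a * c" by transfer (simp add: cone_support_0 chosen_cone(1) algebra_simps)
  show "(0 :: 'a cone_quotient) \<noteq> 1" by transfer (use cone_support_minus[of "0 - 1"] cone_support_1[OF chosen_cone(1)] in auto)
  show "a \<noteq> 0 \<Longrightarrow> b \<noteq> 0 \<Longrightarrow> a * b \<noteq> 0" by transfer (use cone_support_prime[OF chosen_cone(1)] in auto)
qed

end

lift_definition cone_pos :: "'n::finite cone_quotient \<Rightarrow> bool" is "\<lambda>p. p \<in> chosen_cone"
proof -
  fix p q :: "'n real_mpoly"
  assume "p - q \<in> cone_support chosen_cone"
  moreover have "q - p \<in> cone_support chosen_cone" using cone_support_minus[OF calculation] by simp
  ultimately show "(p \<in> chosen_cone) = (q \<in> chosen_cone)"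
    using prime_cone_add_support[OF chosen_cone(1)] by blast
qed

lemma preordering_chosen_cone: "ring_preordering (chosen_cone :: 'n::finite real_mpoly set)"
  by (rule chosen_cone(1)[unfolded prime_cone_def, THEN conjunct1])

lemma cone_pos_add: "cone_pos x \<Longrightarrow> cone_pos y \<Longrightarrow> cone_pos (x + y)"
  by transfer (rule preordering_add[OF preordering_chosen_cone])

lemma cone_pos_mult: "cone_pos x \<Longrightarrow> cone_pos y \<Longrightarrow> cone_pos (x * y)"
  by transfer (rule preordering_mult[OF preordering_chosen_cone])

lemma cone_pos_sq: "cone_pos (x * x)"
  by transfer (rule preordering_sq[OF preordering_chosen_cone, unfolded power2_eq_square])

lemma cone_pos_antisym: "cone_pos x \<Longrightarrow> cone_pos (- x) \<Longrightarrow> x = 0"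
  by transfer (simp add: cone_support_def)

lemma cone_pos_total: "cone_pos x \<or> cone_pos (- x)"
  by transfer (rule prime_cone_total[OF chosen_cone(1)])

text \<open>The induced ordering of the fraction field, embedded in its algebraic closure. The sign
  of a/b is that of a b, so denominators need no normalisation.\<close>

definition fract_cone :: "'n::finite cone_quotient fract alg_closure set" where
  "fract_cone = {to_ac (Fract a b) |a b. b \<noteq> 0 \<and> cone_pos (a * b)}"

lemma fract_coneI: "b \<noteq> 0 \<Longrightarrow> cone_pos (a * b) \<Longrightarrow> to_ac (Fract a b) \<in> fract_cone"
  by (auto simp: fract_cone_def)

lemma field_cone_fract_cone: "field_cone (fract_cone :: 'n::finite cone_quotient fract alg_closure set)"
  unfolding field_cone_def
proof (intro conjI ballI)
  have one: "1 = to_ac (Fract 1 1 :: 'n cone_quotient fract)" by (simp add: One_fract_def[symmetric])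
  show "(1 :: 'n cone_quotient fract alg_closure) \<in> fract_cone"
    unfolding one by (rule fract_coneI) (use cone_pos_sq[of 1] in auto)
  show "(-1 :: 'n cone_quotient fract alg_closure) \<notin> fract_cone"
  proof
    assume "(-1 :: 'n cone_quotient fract alg_closure) \<in> fract_cone"
    then obtain a b :: "'n cone_quotient" where ab: "-1 = to_ac (Fract a b)" "b \<noteq> 0" "cone_pos (a * b)"
      by (auto simp: fract_cone_def)
    have "to_ac (Fract (-1) 1 :: 'n cone_quotient fract) = to_ac (Fract a b)"
      using ab(1) one by (simp flip: minus_fract)
    then have "a = - b" using ab(2) by (simp add: eq_fract)
    then have "cone_pos (- (b * b))" using ab(3) by simp
    then show False using cone_pos_antisym[OF cone_pos_sq[of b]] ab(2) by simp
  qed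
  fix x assume "x \<in> (fract_cone :: 'n cone_quotient fract alg_closure set)"
  then obtain a b where x: "x = to_ac (Fract a b)" "b \<noteq> 0" "cone_pos (a * b)" by (auto simp: fract_cone_def)
  show "inverse x \<in> fract_cone"
  proof (cases "a = 0")
    case True
    then have "inverse x = to_ac (Fract 0 1)" using x(1) by (simp flip: to_ac_inverse add: Zero_fract_def eq_fract)
    then show ?thesis using fract_coneI[of 1 0] cone_pos_sq[of 0] by simp
  next
    case False
    have "inverse x = to_ac (Fract b a)" using x(1) by (simp flip: to_ac_inverse)
    then show ?thesis using fract_coneI[of a b] False x(3) by (simp add: mult.commute)
  qed
  fix y assume "y \<in> (fract_cone :: 'n cone_quotient fract alg_closure set)"
  then obtain c d where y: "y = to_ac (Fract c d)" "d \<noteq> 0" "cone_pos (c * d)" by (auto simp: fract_cone_def)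
  have bd: "b * d \<noteq> 0" using x(2) y(2) by simp
  have "(a * d + c * b) * (b * d) = (a * b) * (d * d) + (c * d) * (b * b)" by (simp add: algebra_simps)
  then have "cone_pos ((a * d + c * b) * (b * d))"
    using x(3) y(3) by (simp only: cone_pos_add cone_pos_mult cone_pos_sq)
  from fract_coneI[OF bd this] show "x + y \<in> fract_cone"
    unfolding x(1) y(1) to_ac_add[symmetric] add_fract[OF x(2) y(2)] .
  have "(a * c) * (b * d) = (a * b) * (c * d)" by (simp add: algebra_simps)
  then have "cone_pos ((a * c) * (b * d))" using x(3) y(3) by (simp only: cone_pos_mult)
  from fract_coneI[OF bd this] show "x * y \<in> fract_cone"
    unfolding x(1) y(1) to_ac_mult[symmetric] mult_fract .
  define e where "e = a * d - c * b"
  have "cone_pos ((e * e) * ((b * d) * (b * d)))" by (intro cone_pos_mult cone_pos_sq)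
  moreover have "(b * d) * (b * d) \<noteq> 0" using bd by simp
  ultimately show "(x - y)\<^sup>2 \<in> fract_cone"
    unfolding x(1) y(1) power2_eq_square to_ac_diff[symmetric] diff_fract[OF x(2) y(2)] to_ac_mult[symmetric] mult_fract
      e_def[symmetric] by (intro fract_coneI)
qed

text \<open>By maximality the differences of this cone form a real closed field whose ordering
  extends that of the fractions.\<close>

definition real_cone :: "'n::finite cone_quotient fract alg_closure set" where
  "real_cone = (SOME Q. field_cone Q \<and> fract_cone \<subseteq> Q \<and> (\<forall>Q'. field_cone Q' \<longrightarrow> Q \<subseteq> Q' \<longrightarrow> Q' = Q))"

lemma real_cone:
  "field_cone (real_cone :: 'n::finite cone_quotient fract alg_closure set)"
  "fract_cone \<subseteq> (real_cone :: 'n cone_quotient fract alg_closure set)"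
  "field_cone Q' \<Longrightarrow> real_cone \<subseteq> Q' \<Longrightarrow> Q' = (real_cone :: 'n cone_quotient fract alg_closure set)"
  using someI_ex[OF field_cone_maximal_exists[OF field_cone_fract_cone], folded real_cone_def] by blast+

interpretation rc: maximal_field_cone "real_cone :: 'n::finite cone_quotient fract alg_closure set"
  by unfold_locales (use real_cone in blast)+

section \<open>The real closure as an ordered field\<close>

typedef (overloaded) 'n real_closure =
  "maximal_field_cone.E (real_cone :: 'n::finite cone_quotient fract alg_closure set)"
  by (rule exI[of _ 0]) (rule rc.E_0)

setup_lifting type_definition_real_closure

instantiation real_closure :: (finite) linordered_field
begin

lift_definition zero_real_closure :: "'a real_closure" is 0 by (rule rc.E_0)
lift_definition one_real_closure :: "'a real_closure" is 1 by (rule rc.E_1)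
lift_definition plus_real_closure :: "'a real_closure \<Rightarrow> 'a real_closure \<Rightarrow> 'a real_closure" is "(+)" by (rule rc.E_add)
lift_definition minus_real_closure :: "'a real_closure \<Rightarrow> 'a real_closure \<Rightarrow> 'a real_closure" is "(-)" by (rule rc.E_diff)
lift_definition times_real_closure :: "'a real_closure \<Rightarrow> 'a real_closure \<Rightarrow> 'a real_closure" is "(*)" by (rule rc.E_mult)
lift_definition uminus_real_closure :: "'a real_closure \<Rightarrow> 'a real_closure" is uminus by (rule rc.E_minus)
lift_definition inverse_real_closure :: "'a real_closure \<Rightarrow> 'a real_closure" is inverse by (rule rc.E_inverse)
definition divide_real_closure :: "'a real_closure \<Rightarrow> 'a real_closure \<Rightarrow> 'a real_closure" where
  "divide_real_closure x y = x * inverse y"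
lift_definition less_eq_real_closure :: "'a real_closure \<Rightarrow> 'a real_closure \<Rightarrow> bool" is "\<lambda>x y. y - x \<in> real_cone" .
definition less_real_closure :: "'a real_closure \<Rightarrow> 'a real_closure \<Rightarrow> bool" where
  "less_real_closure x y \<longleftrightarrow> x \<le> y \<and> \<not> y \<le> x"
definition abs_real_closure :: "'a real_closure \<Rightarrow> 'a real_closure" where
  "abs_real_closure x = (if x < 0 then - x else x)"
definition sgn_real_closure :: "'a real_closure \<Rightarrow> 'a real_closure" where
  "sgn_real_closure x = (if x = 0 then 0 else if 0 < x then 1 else - 1)"

instance
proof
  fix a b c :: "'a real_closure"
  show "a + b + c = a + (b + c)" by transfer simp
  show "a + b = b + a" by transfer simp
  show "0 + a = a" by transfer simp
  show "- a + a = 0" by transfer simp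
  show "a - b = a + - b" by transfer simp
  show "a * b * c = a * (b * c)" by transfer simp
  show "a * b = b * a" by transfer simp
  show "1 * a = a" by transfer simp
  show "(a + b) * c = a * c + b * c" by transfer (simp add: distrib_right)
  show "a + b - a = b" by transfer simp
  show "a - b - c = a - (b + c)" by transfer (simp add: algebra_simps)
  show "0 * a = 0" by transfer simp
  show "a * 0 = 0" by transfer simp
  show "(0 :: 'a real_closure) \<noteq> 1" by transfer simp
  show "a \<noteq> 0 \<Longrightarrow> inverse a * a = 1" by transfer simp
  show "a div b = a * inverse b" by (rule divide_real_closure_def)
  show "inverse (0 :: 'a real_closure) = 0" by transfer simp
  show "(a < b) = (a \<le> b \<and> \<not> b \<le> a)" by (rule less_real_closure_def)
  show "a \<le> a" by transfer (simp add: rc.Q_0)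
  show "a \<le> b \<Longrightarrow> b \<le> c \<Longrightarrow> a \<le> c"
    by transfer (drule (1) rc.Q_add, simp)
  show anti: "a \<le> b \<Longrightarrow> b \<le> a \<Longrightarrow> a = b"
    by transfer (drule rc.Q_antisym, simp_all)
  show "a \<le> b \<or> b \<le> a"
    by transfer (drule (1) rc.E_diff, drule rc.E_total, auto)
  show "a \<le> b \<Longrightarrow> c + a \<le> c + b" by transfer simp
  show "\<bar>a\<bar> = (if a < 0 then - a else a)" by (rule abs_real_closure_def)
  show "sgn a = (if a = 0 then 0 else if 0 < a then 1 else - 1)" by (rule sgn_real_closure_def)
  show "a < b \<Longrightarrow> 0 < c \<Longrightarrow> c * a < c * b"
    unfolding less_real_closure_def
  proof transfer
    fix a b c :: "'a cone_quotient fract alg_closure"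
    assume E: "a \<in> rc.E" "b \<in> rc.E" "c \<in> rc.E"
      and h: "b - a \<in> real_cone \<and> a - b \<notin> real_cone" "c - 0 \<in> real_cone \<and> 0 - c \<notin> real_cone"
    have nz: "b - a \<noteq> 0" "c \<noteq> 0" using h rc.Q_0 by auto
    have "c * (b - a) \<in> real_cone" using h by (intro rc.Q_mult) simp_all
    moreover have "- (c * (b - a)) \<notin> real_cone" using rc.Q_antisym[OF calculation] nz by auto
    ultimately show "c * b - c * a \<in> real_cone \<and> c * a - c * b \<notin> real_cone" by (simp add: algebra_simps)
  qed
qed

end

lemma Rep_real_closure_sum: "Rep_real_closure (sum f A) = (\<Sum>i\<in>A. Rep_real_closure (f i))"
  by (induct A rule: infinite_finite_induct) (simp_all add: zero_real_closure.rep_eq plus_real_closure.rep_eq)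

lemma Rep_real_closure_power: "Rep_real_closure (x ^ n) = Rep_real_closure x ^ n"
  by (induct n) (simp_all add: one_real_closure.rep_eq times_real_closure.rep_eq)

instance real_closure :: (finite) real_closed_field
proof
  fix a b :: "'a real_closure" and n f
  assume ab: "a < b" "(\<Sum>k\<le>n. f k * a ^ k) < 0" "0 < (\<Sum>k\<le>n. f k * b ^ k)"
  define p where "p = (\<Sum>k\<le>n. Polynomial.monom (Rep_real_closure (f k)) k)"
  have ev: "poly p (Rep_real_closure x) = Rep_real_closure (\<Sum>k\<le>n. f k * x ^ k)" for x
    by (simp add: p_def poly_sum poly_monom Rep_real_closure_sum Rep_real_closure_power times_real_closure.rep_eq)
  have "rc.polE p"
    unfolding rc.polE_def p_def coeff_sum
    by (auto intro!: rc.E_sum simp: Rep_real_closure rc.E_0)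
  moreover have "poly p (Rep_real_closure a) \<notin> real_cone" "- poly p (Rep_real_closure b) \<notin> real_cone"
    using ab(2,3) unfolding ev less_real_closure_def
    by (simp_all add: less_eq_real_closure.rep_eq zero_real_closure.rep_eq)
  ultimately obtain c where c: "c \<in> rc.E" "rc.between c (Rep_real_closure a) (Rep_real_closure b)" "poly p c = 0"
    using rc.ivt_E Rep_real_closure by blast
  define c' where "c' = Abs_real_closure c"
  have c': "c = Rep_real_closure c'" using c(1) by (simp add: c'_def Abs_real_closure_inverse)
  have z: "(\<Sum>k\<le>n. f k * c' ^ k) = 0"
    using c(3) unfolding c' ev by (simp add: zero_real_closure.rep_eq[symmetric] Rep_real_closure_inject)
  have "a \<le> c' \<and> c' \<le> b \<or> b \<le> c' \<and> c' \<le> a"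
    using c(2) unfolding rc.between_def c' by (simp add: less_eq_real_closure.rep_eq)
  then have "a \<le> c' \<and> c' \<le> b" using ab(1) by auto
  moreover have "c' \<noteq> a" "c' \<noteq> b" using z ab(2,3) by auto
  ultimately show "\<exists>c. a < c \<and> c < b \<and> (\<Sum>k\<le>n. f k * c ^ k) = 0" using z by (intro exI[of _ c']) auto
qed

text \<open>The value lies in the subfield because the ordering of the quotient is total: the
  fraction or its negative belongs to the cone.\<close>

lift_definition closure_hom :: "'n::finite real_mpoly \<Rightarrow> 'n real_closure" is "\<lambda>p. to_ac (Fract (abs_cone_quotient p) 1)"
proof -
  fix p :: "'n real_mpoly"
  define a where "a = abs_cone_quotient p"
  from cone_pos_total[of a] have "to_ac (Fract a 1) \<in> real_cone \<or> - to_ac (Fract a 1) \<in> real_cone"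
    using fract_coneI[of 1 a] fract_coneI[of 1 "- a"] real_cone(2) by (auto simp flip: to_ac_minus)
  then show "to_ac (Fract (abs_cone_quotient p) 1) \<in> rc.E"
    unfolding a_def using rc.Q_E rc.E_minus by (metis add.inverse_inverse)
qed

lemma is_ring_hom_closure_hom: "is_ring_hom (closure_hom :: 'n::finite real_mpoly \<Rightarrow> _)"
proof -
  have "closure_hom (0 :: 'n real_mpoly) = 0"
    by (simp add: Rep_real_closure_inject[symmetric] closure_hom.rep_eq zero_real_closure.rep_eq
        zero_cone_quotient_def[symmetric] Zero_fract_def[symmetric])
  moreover have "closure_hom (1 :: 'n real_mpoly) = 1"
    by (simp add: Rep_real_closure_inject[symmetric] closure_hom.rep_eq one_real_closure.rep_eq
        one_cone_quotient_def[symmetric] One_fract_def[symmetric])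
  moreover have "closure_hom (p + q) = closure_hom p + closure_hom q" for p q :: "'n real_mpoly"
    by (simp add: Rep_real_closure_inject[symmetric] closure_hom.rep_eq plus_real_closure.rep_eq
        plus_cone_quotient.abs_eq[symmetric] to_ac_add[symmetric] del: to_ac_add)
  moreover have "closure_hom (p * q) = closure_hom p * closure_hom q" for p q :: "'n real_mpoly"
    by (simp add: Rep_real_closure_inject[symmetric] closure_hom.rep_eq times_real_closure.rep_eq
        times_cone_quotient.abs_eq[symmetric] to_ac_mult[symmetric] del: to_ac_mult)
  ultimately show ?thesis unfolding is_ring_hom_def by blast
qed

lemma closure_hom_nonneg: "p \<in> chosen_cone \<Longrightarrow> 0 \<le> closure_hom p"
proof -
  assume "p \<in> chosen_cone"
  then have "cone_pos (abs_cone_quotient p * 1)" by (simp add: cone_pos.abs_eq)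
  then have "to_ac (Fract (abs_cone_quotient p) 1) \<in> real_cone"
    by (rule subsetD[OF real_cone(2) fract_coneI, rotated]) simp
  then show "0 \<le> closure_hom p"
    by (simp add: less_eq_real_closure.rep_eq closure_hom.rep_eq zero_real_closure.rep_eq)
qed

text \<open>The images of the variables form a point of the real closure at which evaluation is
  \<open>closure_hom\<close>, so the chosen cone is nonnegative there. Transfer yields a real point
  for each finite subset, and the choice of the cone extends this to all prime cones.\<close>

theorem prime_cone_realised:
  fixes P :: "'n::finite real_mpoly set"
  assumes "prime_cone P"
  shows "realised P"
proof (rule chosen_cone(2)[OF _ assms])
  show "realised (chosen_cone :: 'n real_mpoly set)"
    unfolding realised_def
  proof (intro allI impI)
    fix S :: "'n real_mpoly set" assume S: "finite S" "S \<subseteq> chosen_cone"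
    define \<iota> where "\<iota> = (\<lambda>r. closure_hom (mconst r :: 'n real_mpoly))"
    define b where "b = (\<lambda>i. closure_hom (mvar i :: 'n real_mpoly))"
    note H = is_ring_hom_closure_hom
    have \<iota>: "is_ring_hom \<iota>"
      unfolding is_ring_hom_def \<iota>_def
      by (simp add: is_ring_hom_0[OF is_ring_hom_mconst] is_ring_hom_1[OF is_ring_hom_mconst]
          is_ring_hom_add[OF is_ring_hom_mconst] is_ring_hom_mult[OF is_ring_hom_mconst]
          is_ring_hom_0[OF H] is_ring_hom_1[OF H] is_ring_hom_add[OF H] is_ring_hom_mult[OF H])
    have ev: "mpoly_ev \<iota> b p = closure_hom p" for p
      by (induct p rule: mpoly_induct)
         (simp_all add: mpoly_ev_mconst[OF \<iota>] mpoly_ev_mvar[OF \<iota>] mpoly_ev_add[OF \<iota>] mpoly_ev_mult[OF \<iota>]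
            is_ring_hom_add[OF H] is_ring_hom_mult[OF H], simp_all add: \<iota>_def b_def)
    obtain a where a: "\<forall>p\<in>S. sg (mpoly_ev \<iota> b p) = sg (mpoly_ev (\<lambda>r. r) a p)"
      using sign_conditions_transfer[OF \<iota> S(1)] by blast
    have "0 \<le> mpoly_eval p (\<chi> i. a i)" if "p \<in> S" for p
    proof -
      have "0 \<le> closure_hom p" using closure_hom_nonneg S(2) that by blast
      then have "sg (closure_hom p) \<noteq> -1" by (simp add: sg_def)
      then have "sg (mpoly_ev (\<lambda>r. r) a p) \<noteq> -1" using a that ev by simp
      moreover have "mpoly_ev (\<lambda>r. r) a p = mpoly_eval p (\<chi> i. a i)" by (simp add: mpoly_eval_conv_ev mpoly_ev_def)
      ultimately show ?thesis by (auto simp: sg_def split: if_splits)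
    qed
    then show "\<exists>x. \<forall>p\<in>S. 0 \<le> mpoly_eval p x" by blast
  qed
qed


section \<open>Quadratic modules\<close>

lemma sums_of_squares_0: "0 \<in> sums_of_squares"
  unfolding sums_of_squares_def by (rule CollectI, rule exI[of _ 0]) simp

lemma sums_of_squares_add_square:
  assumes "x \<in> sums_of_squares" shows "x + q\<^sup>2 \<in> sums_of_squares"
proof -
  obtain k r where "x = (\<Sum>i<(k::nat). (r i)\<^sup>2)" using assms by (auto simp: sums_of_squares_def)
  then have "x + q\<^sup>2 = (\<Sum>i<Suc k. ((r(k := q)) i)\<^sup>2)" by simp
  then show ?thesis unfolding sums_of_squares_def by blast
qed

lemma sums_of_squares_sq: "q\<^sup>2 \<in> sums_of_squares"
  using sums_of_squares_add_square[OF sums_of_squares_0] by simp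

lemma sums_of_squares_1: "1 \<in> sums_of_squares"
  using sums_of_squares_sq[of 1] by simp

lemma sums_of_squares_induct [consumes 1, case_names zero add]:
  assumes "x \<in> sums_of_squares" "P 0" "\<And>x q. x \<in> sums_of_squares \<Longrightarrow> P x \<Longrightarrow> P (x + q\<^sup>2)"
  shows "P x"
proof -
  have "P (\<Sum>i<k. (r i)\<^sup>2) \<and> (\<Sum>i<k. (r i)\<^sup>2) \<in> sums_of_squares" for k :: nat and r
    by (induct k) (simp_all add: assms(2,3) sums_of_squares_0 sums_of_squares_add_square)
  then show ?thesis using assms(1) by (auto simp: sums_of_squares_def)
qed

definition quad_module :: "'a::comm_ring_1 set \<Rightarrow> bool" where
  "quad_module M \<longleftrightarrow> 1 \<in> M \<and> (\<forall>x\<in>M. \<forall>y\<in>M. x + y \<in> M) \<and> (\<forall>x\<in>M. \<forall>q. q\<^sup>2 * x \<in> M)"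

lemma
  assumes "quad_module M"
  shows quad_module_1: "1 \<in> M" and quad_module_add: "x \<in> M \<Longrightarrow> y \<in> M \<Longrightarrow> x + y \<in> M"
    and quad_module_sq_mult: "x \<in> M \<Longrightarrow> q\<^sup>2 * x \<in> M"
  using assms by (auto simp: quad_module_def)

lemma quad_module_0: "quad_module M \<Longrightarrow> 0 \<in> M" and quad_module_sq: "quad_module M \<Longrightarrow> q\<^sup>2 \<in> M"
  using quad_module_sq_mult[of M 1 0] quad_module_sq_mult[of M 1 q] by (simp_all add: quad_module_1)

lemma quad_module_sum: "quad_module M \<Longrightarrow> (\<And>i. i \<in> A \<Longrightarrow> f i \<in> M) \<Longrightarrow> sum f A \<in> M"
  by (induct A rule: infinite_finite_induct) (auto simp: quad_module_0 quad_module_add)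

lemma quad_module_sos_mult:
  assumes "quad_module M" "s \<in> sums_of_squares" "x \<in> M" shows "s * x \<in> M"
  using assms(2)
  by (induct rule: sums_of_squares_induct)
     (simp_all add: quad_module_0[OF assms(1)] distrib_right quad_module_add[OF assms(1)] quad_module_sq_mult[OF assms(1,3)])

lemma sos_subset_quad_module: "quad_module M \<Longrightarrow> s \<in> sums_of_squares \<Longrightarrow> s \<in> M"
  using quad_module_sos_mult[OF _ _ quad_module_1] by fastforce

lemma preordering_imp_quad_module: "ring_preordering T \<Longrightarrow> quad_module T"
  by (simp add: quad_module_def preordering_1 preordering_add preordering_mult preordering_sq)

lemma sums_of_squares_add: "x \<in> sums_of_squares \<Longrightarrow> y \<in> sums_of_squares \<Longrightarrow> x + y \<in> sums_of_squares"
proof -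
  assume x: "x \<in> sums_of_squares" and "y \<in> sums_of_squares"
  from this(2) show ?thesis
    by (induct rule: sums_of_squares_induct) (use x in \<open>auto simp: sums_of_squares_add_square simp flip: add.assoc\<close>)
qed

lemma quad_module_sums_of_squares: "quad_module sums_of_squares"
  unfolding quad_module_def
proof (intro conjI ballI allI)
  show "1 \<in> sums_of_squares" using sums_of_squares_sq[of 1] by simp
  fix x :: 'a and q assume "x \<in> sums_of_squares"
  then show "q\<^sup>2 * x \<in> sums_of_squares"
    by (induct rule: sums_of_squares_induct)
       (auto simp: sums_of_squares_0 distrib_left sums_of_squares_add_square simp flip: power_mult_distrib)
qed (rule sums_of_squares_add)

lemma preordering_sums_of_squares: "ring_preordering sums_of_squares"
  unfolding ring_preordering_def
  using quad_module_sos_mult[OF quad_module_sums_of_squares] sums_of_squares_add sums_of_squares_sq by blast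

lemma quad_module_adjoin:
  assumes "quad_module M"
  shows "quad_module {m + s * f |m s. m \<in> M \<and> s \<in> sums_of_squares}" (is "quad_module ?N")
    and "M \<subseteq> {m + s * f |m s. m \<in> M \<and> s \<in> sums_of_squares}" and "f \<in> {m + s * f |m s. m \<in> M \<and> s \<in> sums_of_squares}"
proof -
  have I: "m + s * f \<in> ?N" if "m \<in> M" "s \<in> sums_of_squares" for m s using that by blast
  show sub: "M \<subseteq> ?N" using I[OF _ sums_of_squares_0] by auto
  show "f \<in> ?N" using I[OF quad_module_0[OF assms] sums_of_squares_sq[of 1]] by simp
  show "quad_module ?N"
    unfolding quad_module_def
  proof (intro conjI ballI allI)
    show "1 \<in> ?N" using sub quad_module_1[OF assms] by blast
    fix x assume "x \<in> ?N"
    then obtain m s where x: "x = m + s * f" "m \<in> M" "s \<in> sums_of_squares" by blast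
    show "q\<^sup>2 * x \<in> ?N" for q
      using I[OF quad_module_sq_mult[OF assms x(2), of q] quad_module_sq_mult[OF quad_module_sums_of_squares x(3), of q]]
      by (simp add: x(1) algebra_simps)
    fix y assume "y \<in> ?N"
    then obtain m' s' where y: "y = m' + s' * f" "m' \<in> M" "s' \<in> sums_of_squares" by blast
    show "x + y \<in> ?N"
      using I[OF quad_module_add[OF assms x(2) y(2)] sums_of_squares_add[OF x(3) y(3)]]
      by (simp add: x(1) y(1) algebra_simps)
  qed
qed

section \<open>Quadratic modules and preorderings generated by finitely many elements\<close>

lemma quad_module_generated: "quad_module (generated_quadratic_module m g)"
proof -
  let ?M = "generated_quadratic_module m g"
  have I: "s 0 + (\<Sum>i=1..m. s i * g i) \<in> ?M" if "\<And>i. i \<le> m \<Longrightarrow> s i \<in> sums_of_squares" for s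
    unfolding generated_quadratic_module_def using that by blast
  show ?thesis
    unfolding quad_module_def
  proof (intro conjI ballI allI)
    show "1 \<in> ?M" using I[of "\<lambda>i. if i = 0 then 1 else 0"] by (simp add: sums_of_squares_0 sums_of_squares_1)
    fix x assume "x \<in> ?M"
    then obtain s where x: "x = s 0 + (\<Sum>i=1..m. s i * g i)" and s: "\<forall>i\<le>m. s i \<in> sums_of_squares"
      unfolding generated_quadratic_module_def by blast
    show "q\<^sup>2 * x \<in> ?M" for q
    proof -
      have "q\<^sup>2 * s 0 + (\<Sum>i=1..m. (q\<^sup>2 * s i) * g i) \<in> ?M"
        by (rule I) (use s quad_module_sq_mult[OF quad_module_sums_of_squares] in blast)
      then show ?thesis by (simp add: x distrib_left sum_distrib_left mult.assoc)
    qed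
    fix y assume "y \<in> ?M"
    then obtain t where y: "y = t 0 + (\<Sum>i=1..m. t i * g i)" and t: "\<forall>i\<le>m. t i \<in> sums_of_squares"
      unfolding generated_quadratic_module_def by blast
    show "x + y \<in> ?M"
    proof -
      have "(s 0 + t 0) + (\<Sum>i=1..m. (s i + t i) * g i) \<in> ?M"
        by (rule I) (use s t sums_of_squares_add in blast)
      then show ?thesis by (simp add: x y distrib_right sum.distrib add_ac)
    qed
  qed
qed

lemma generator_in_quadratic_module:
  assumes "j \<in> {1..m}" shows "g j \<in> generated_quadratic_module m g"
proof -
  define s where "s i = (if i = j then 1 else 0 :: 'a)" for i
  have "(\<Sum>i=1..m. s i * g i) = g j" using assms by (simp add: s_def if_distrib[of "\<lambda>x. x * _"] cong: if_cong)
  then have e: "g j = s 0 + (\<Sum>i=1..m. s i * g i)" using assms by (simp add: s_def)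
  have "\<forall>i\<le>m. s i \<in> sums_of_squares" by (simp add: s_def sums_of_squares_0 sums_of_squares_1)
  then show ?thesis unfolding generated_quadratic_module_def using e by blast
qed

lemma preordering_generated: "ring_preordering (generated_preordering m g)"
proof -
  let ?T = "generated_preordering m g" and ?I = "{1..m} \<rightarrow>\<^sub>E {0, 1::nat}"
  let ?g = "\<lambda>\<sigma> :: nat \<Rightarrow> nat. \<Prod>i=1..m. g i ^ \<sigma> i"
  have fin: "finite ?I" by (intro finite_PiE) auto
  have I: "(\<Sum>\<sigma>\<in>?I. s \<sigma> * ?g \<sigma>) \<in> ?T" if "\<And>\<sigma>. \<sigma> \<in> ?I \<Longrightarrow> s \<sigma> \<in> sums_of_squares" for s
    unfolding generated_preordering_def using that by blast
  have E: "\<exists>s. (\<forall>\<sigma>\<in>?I. s \<sigma> \<in> sums_of_squares) \<and> x = (\<Sum>\<sigma>\<in>?I. s \<sigma> * ?g \<sigma>)" if "x \<in> ?T" for x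
    using that unfolding generated_preordering_def by blast
  have one: "c * ?g \<sigma> \<in> ?T" if "\<sigma> \<in> ?I" "c \<in> sums_of_squares" for c \<sigma>
  proof -
    have "(\<Sum>\<tau>\<in>?I. (if \<tau> = \<sigma> then c else 0) * ?g \<tau>) \<in> ?T"
      using that(2) by (intro I) (simp add: sums_of_squares_0)
    moreover have "(\<Sum>\<tau>\<in>?I. (if \<tau> = \<sigma> then c else 0) * ?g \<tau>) = c * ?g \<sigma>"
      using that(1) fin by (simp add: if_distrib[of "\<lambda>x. x * _"] cong: if_cong)
    ultimately show ?thesis by simp
  qed
  have add: "x + y \<in> ?T" if xy: "x \<in> ?T" "y \<in> ?T" for x y
  proof -
    obtain s t where s: "\<forall>\<sigma>\<in>?I. s \<sigma> \<in> sums_of_squares" "x = (\<Sum>\<sigma>\<in>?I. s \<sigma> * ?g \<sigma>)"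
      and t: "\<forall>\<sigma>\<in>?I. t \<sigma> \<in> sums_of_squares" "y = (\<Sum>\<sigma>\<in>?I. t \<sigma> * ?g \<sigma>)"
      using E[OF xy(1)] E[OF xy(2)] by blast
    have "(\<Sum>\<sigma>\<in>?I. (s \<sigma> + t \<sigma>) * ?g \<sigma>) \<in> ?T" using s(1) t(1) by (intro I sums_of_squares_add) auto
    then show ?thesis by (simp add: s(2) t(2) distrib_right sum.distrib)
  qed
  have zero: "0 \<in> ?T" using I[of "\<lambda>_. 0"] by (simp add: sums_of_squares_0)
  have sum: "sum f A \<in> ?T" if "\<And>i. i \<in> A \<Longrightarrow> f i \<in> ?T" for f and A :: "(nat \<Rightarrow> nat) set"
    using that by (induct A rule: infinite_finite_induct) (auto simp: zero add)
  have mult: "x * y \<in> ?T" if xy: "x \<in> ?T" "y \<in> ?T" for x y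
  proof -
    obtain s t where s: "\<forall>\<sigma>\<in>?I. s \<sigma> \<in> sums_of_squares" "x = (\<Sum>\<sigma>\<in>?I. s \<sigma> * ?g \<sigma>)"
      and t: "\<forall>\<sigma>\<in>?I. t \<sigma> \<in> sums_of_squares" "y = (\<Sum>\<sigma>\<in>?I. t \<sigma> * ?g \<sigma>)"
      using E[OF xy(1)] E[OF xy(2)] by blast
    have "(s \<sigma> * ?g \<sigma>) * (t \<tau> * ?g \<tau>) \<in> ?T" if st: "\<sigma> \<in> ?I" "\<tau> \<in> ?I" for \<sigma> \<tau>
    proof -
      \<comment> \<open>Exponents are added modulo 2; where both are 1, the square of the generator
        is moved into the weight.\<close>
      define \<rho> where "\<rho> = (\<lambda>i\<in>{1..m}. (\<sigma> i + \<tau> i) mod 2)"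
      have \<rho>: "\<rho> \<in> ?I" by (auto simp: \<rho>_def)
      have "g i ^ \<sigma> i * g i ^ \<tau> i = g i ^ \<rho> i * (g i ^ (\<sigma> i * \<tau> i))\<^sup>2" if "i \<in> {1..m}" for i
      proof -
        have "\<sigma> i \<in> {0, 1}" "\<tau> i \<in> {0, 1}" using st that by auto
        then show ?thesis using that by (auto simp: \<rho>_def power2_eq_square)
      qed
      then have "?g \<sigma> * ?g \<tau> = ?g \<rho> * (\<Prod>i=1..m. g i ^ (\<sigma> i * \<tau> i))\<^sup>2"
        by (simp add: prod.distrib[symmetric] prod_power_distrib)
      moreover have "(a * u) * (b * v) = ((a * b) * z) * w" if "u * v = w * z" for a b u v w z :: 'a
      proof -
        have "(a * u) * (b * v) = (a * b) * (u * v)" by (simp add: ac_simps)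
        then show ?thesis unfolding that by (simp add: ac_simps)
      qed
      ultimately have "(s \<sigma> * ?g \<sigma>) * (t \<tau> * ?g \<tau>) = ((s \<sigma> * t \<tau>) * (\<Prod>i=1..m. g i ^ (\<sigma> i * \<tau> i))\<^sup>2) * ?g \<rho>"
        by blast
      moreover have "(s \<sigma> * t \<tau>) * (\<Prod>i=1..m. g i ^ (\<sigma> i * \<tau> i))\<^sup>2 \<in> sums_of_squares"
        using s(1) t(1) st by (intro preordering_mult[OF preordering_sums_of_squares] sums_of_squares_sq) auto
      ultimately show ?thesis using one[OF \<rho>] by simp
    qed
    then have "(\<Sum>\<sigma>\<in>?I. \<Sum>\<tau>\<in>?I. (s \<sigma> * ?g \<sigma>) * (t \<tau> * ?g \<tau>)) \<in> ?T" by (intro sum)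
    then show ?thesis unfolding s(2) t(2) sum_product .
  qed
  have "x\<^sup>2 \<in> ?T" for x
  proof -
    define \<sigma>0 where "\<sigma>0 = (\<lambda>i\<in>{1..m}. 0::nat)"
    have "\<sigma>0 \<in> ?I" by (auto simp: \<sigma>0_def)
    moreover have "?g \<sigma>0 = 1" by (simp add: \<sigma>0_def)
    ultimately show ?thesis using one[of \<sigma>0 "x\<^sup>2"] by (simp add: sums_of_squares_sq)
  qed
  then show ?thesis using add mult unfolding ring_preordering_def by blast
qed

lemma generator_in_preordering:
  assumes "j \<in> {1..m}" shows "g j \<in> generated_preordering m g"
proof -
  let ?I = "{1..m} \<rightarrow>\<^sub>E {0, 1::nat}"
  define \<sigma> where "\<sigma> = (\<lambda>i\<in>{1..m}. if i = j then 1 else 0::nat)"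
  define s where "s \<tau> = (if \<tau> = \<sigma> then 1 else 0 :: 'a)" for \<tau>
  have \<sigma>: "\<sigma> \<in> ?I" by (auto simp: \<sigma>_def)
  have fin: "finite ?I" by (intro finite_PiE) auto
  have "(\<Prod>i=1..m. g i ^ \<sigma> i) = (\<Prod>i=1..m. if i = j then g j else 1)"
    by (rule prod.cong) (auto simp: \<sigma>_def)
  then have "(\<Prod>i=1..m. g i ^ \<sigma> i) = g j" using assms by simp
  then have e: "g j = (\<Sum>\<tau>\<in>?I. s \<tau> * (\<Prod>i=1..m. g i ^ \<tau> i))"
    using \<sigma> fin by (simp add: s_def if_distrib[of "\<lambda>x. x * _"] cong: if_cong)
  have "\<forall>\<tau>\<in>?I. s \<tau> \<in> sums_of_squares" by (simp add: s_def sums_of_squares_0 sums_of_squares_1)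
  then show ?thesis unfolding generated_preordering_def using e by blast
qed

section \<open>Bounded elements\<close>

lemma mconst_simps:
  "mconst 0 = 0" "mconst 1 = 1" "mconst (a + b) = mconst a + mconst b" "mconst (a * b) = mconst a * mconst b"
  "mconst (- a) = - mconst a" "mconst (a - b) = mconst a - mconst b" "mconst (real k) = of_nat k" "mconst (a ^ j) = mconst a ^ j"
  by (simp_all add: is_ring_hom_0[OF is_ring_hom_mconst] is_ring_hom_1[OF is_ring_hom_mconst]
      is_ring_hom_add[OF is_ring_hom_mconst] is_ring_hom_mult[OF is_ring_hom_mconst]
      is_ring_hom_uminus[OF is_ring_hom_mconst] is_ring_hom_diff[OF is_ring_hom_mconst]
      is_ring_hom_of_nat[OF is_ring_hom_mconst] is_ring_hom_power[OF is_ring_hom_mconst])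

lemma mconst_numeral: "mconst (numeral k) = numeral k"
  using mconst_simps(7)[of "numeral k"] by simp

lemma mconst_nonneg_mult:
  assumes "quad_module M" "0 \<le> r" "x \<in> M" shows "mconst r * x \<in> M"
proof -
  have "(mconst (sqrt r))\<^sup>2 * x \<in> M" by (rule quad_module_sq_mult[OF assms(1,3)])
  then show ?thesis using assms(2) by (simp flip: mconst_simps(8))
qed

lemma mconst_nonneg_mem: "quad_module M \<Longrightarrow> 0 \<le> r \<Longrightarrow> mconst r \<in> M"
  using mconst_nonneg_mult[OF _ _ quad_module_1] by fastforce

lemma mconst_cancel:
  assumes "quad_module M" "0 < r" "mconst r * x \<in> M" shows "x \<in> M"
proof -
  have "mconst (inverse r) * (mconst r * x) \<in> M"
    by (rule mconst_nonneg_mult[OF assms(1) _ assms(3)]) (use assms(2) in simp)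
  also have "mconst (inverse r) * (mconst r * x) = mconst (inverse r * r) * x"
    by (simp only: mconst_simps(4) mult.assoc)
  also have "inverse r * r = 1" using assms(2) by simp
  finally show ?thesis by (simp add: mconst_simps)
qed

text \<open>(r + a)^2 (r - a) + (r - a)^2 (r + a) = 2 r (r^2 - a^2). For r = 0 this is trivial, and
  (a + 1)^2 (- a) + (a - 1)^2 a = - 4 a^2 is used instead.\<close>

lemma square_bound:
  assumes M: "quad_module M" and r: "0 \<le> r" and a: "mconst r + a \<in> M" "mconst r - a \<in> M"
  shows "mconst (r\<^sup>2) - a\<^sup>2 \<in> M"
proof (cases "r = 0")
  case True
  have "a \<in> M" "- a \<in> M" using a True by (simp_all add: mconst_simps)
  then have "(a + 1)\<^sup>2 * (- a) + (a - 1)\<^sup>2 * a \<in> M" by (intro quad_module_add[OF M] quad_module_sq_mult[OF M])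
  moreover have "(a + 1)\<^sup>2 * (- a) + (a - 1)\<^sup>2 * a = mconst 4 * (- (a\<^sup>2))"
    by (simp add: mconst_numeral power2_eq_square algebra_simps)
  ultimately have "mconst 4 * (- (a\<^sup>2)) \<in> M" by simp
  then have "- (a\<^sup>2) \<in> M" by (rule mconst_cancel[OF M, rotated]) simp
  then show ?thesis using True by (simp add: mconst_simps)
next
  case False
  have "(mconst r + a)\<^sup>2 * (mconst r - a) + (mconst r - a)\<^sup>2 * (mconst r + a) \<in> M"
    by (intro quad_module_add[OF M] quad_module_sq_mult[OF M] a)
  moreover have "(mconst r + a)\<^sup>2 * (mconst r - a) + (mconst r - a)\<^sup>2 * (mconst r + a) = mconst (2 * r) * (mconst (r\<^sup>2) - a\<^sup>2)"
    by (simp add: power2_eq_square mconst_simps mconst_numeral algebra_simps)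
  ultimately have "mconst (2 * r) * (mconst (r\<^sup>2) - a\<^sup>2) \<in> M" by simp
  then show ?thesis by (rule mconst_cancel[OF M, rotated]) (use r False in simp)
qed

text \<open>Real bounds instead of the integers in \<open>archimedean\<close> allow scaling; imposed
  on all polynomials, the two notions agree for a quadratic module.\<close>

definition bounded_elt :: "'n::finite real_mpoly set \<Rightarrow> 'n real_mpoly \<Rightarrow> bool" where
  "bounded_elt M p \<longleftrightarrow> (\<exists>r\<ge>0. mconst r + p \<in> M \<and> mconst r - p \<in> M)"

lemma bounded_elt_mono:
  assumes "quad_module M" "r \<le> r'" "mconst r + p \<in> M" shows "mconst r' + p \<in> M"
  using quad_module_add[OF assms(1) mconst_nonneg_mem[OF assms(1), of "r' - r"] assms(3)] assms(2)
  by (simp add: mconst_simps)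

lemma bounded_elt_add:
  assumes M: "quad_module M" "bounded_elt M p" "bounded_elt M q" shows "bounded_elt M (p + q)"
proof -
  obtain r s where "0 \<le> r" "mconst r + p \<in> M" "mconst r - p \<in> M" "0 \<le> s" "mconst s + q \<in> M" "mconst s - q \<in> M"
    using M(2,3) by (auto simp: bounded_elt_def)
  then have "0 \<le> r + s" "(mconst r + p) + (mconst s + q) \<in> M" "(mconst r - p) + (mconst s - q) \<in> M"
    using quad_module_add[OF M(1)] by auto
  then show ?thesis unfolding bounded_elt_def by (intro exI[of _ "r + s"]) (simp add: mconst_simps algebra_simps)
qed

lemma bounded_elt_minus: "bounded_elt M p \<Longrightarrow> bounded_elt M (- p)"
  by (auto simp: bounded_elt_def)

lemma bounded_elt_sq:
  assumes M: "quad_module M" "bounded_elt M p" shows "\<exists>r\<ge>0. mconst r - p\<^sup>2 \<in> M"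
  using square_bound[OF M(1)] M(2) unfolding bounded_elt_def by (metis zero_le_power2)

text \<open>\<open>M\<close> need not be closed under products, but 4 p q = (p + q)^2 - (p - q)^2
  reduces a lower bound for the product to an upper bound for one square; the other side follows
  with -q.\<close>

lemma bounded_elt_mult:
  assumes M: "quad_module M" "bounded_elt M p" "bounded_elt M q" shows "bounded_elt M (p * q)"
proof -
  have *: "\<exists>r\<ge>0. mconst r + p * q \<in> M" if pq: "bounded_elt M p" "bounded_elt M q" for p q
  proof -
    have "bounded_elt M (p - q)"
      using bounded_elt_add[OF M(1) pq(1) bounded_elt_minus[OF pq(2)]] by simp
    then obtain r where r: "0 \<le> r" "mconst r - (p - q)\<^sup>2 \<in> M" using bounded_elt_sq[OF M(1)] by blast
    then have "mconst r - (p - q)\<^sup>2 + (p + q)\<^sup>2 \<in> M" by (intro quad_module_add[OF M(1)] quad_module_sq[OF M(1)])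
    moreover have "mconst r - (p - q)\<^sup>2 + (p + q)\<^sup>2 = mconst 4 * (mconst (r / 4) + p * q)"
    proof -
      have "mconst r = mconst 4 * mconst (r / 4)" by (simp flip: mconst_simps(4))
      then show ?thesis by (simp add: mconst_numeral power2_eq_square algebra_simps)
    qed
    ultimately have "mconst (r / 4) + p * q \<in> M" using mconst_cancel[OF M(1), of 4] by simp
    then show ?thesis using r(1) by (intro exI[of _ "r / 4"]) simp
  qed
  obtain r s where "0 \<le> r" "mconst r + p * q \<in> M" "0 \<le> s" "mconst s + - (p * q) \<in> M"
    using *[OF M(2,3)] *[OF M(2) bounded_elt_minus[OF M(3)]] unfolding mult_minus_right by blast
  then have "mconst (max r s) + p * q \<in> M" "mconst (max r s) + - (p * q) \<in> M"
    by (auto intro: bounded_elt_mono[OF M(1), of r] bounded_elt_mono[OF M(1), of s] simp del: add_uminus_conv_diff)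
  then show ?thesis unfolding bounded_elt_def using \<open>0 \<le> r\<close> by (intro exI[of _ "max r s"]) auto
qed

lemma bounded_elt_const: "quad_module M \<Longrightarrow> bounded_elt M (mconst c)"
  unfolding bounded_elt_def
  by (intro exI[of _ "\<bar>c\<bar>"]) (auto simp flip: mconst_simps intro: mconst_nonneg_mem)

lemma archimedean_iff_bounded:
  assumes M: "quad_module M" shows "archimedean M \<longleftrightarrow> (\<forall>p. bounded_elt M p)"
proof
  assume A: "archimedean M"
  show "\<forall>p. bounded_elt M p"
  proof
    fix p
    obtain k :: nat where "of_nat k + p \<in> M" "of_nat k - p \<in> M" using A unfolding archimedean_def by blast
    then show "bounded_elt M p" unfolding bounded_elt_def by (intro exI[of _ "real k"]) (simp add: mconst_simps)
  qed
next
  assume B: "\<forall>p. bounded_elt M p"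
  show "archimedean M"
    unfolding archimedean_def
  proof
    fix p
    obtain r where r: "0 \<le> r" "mconst r + p \<in> M" "mconst r + - p \<in> M" using B unfolding bounded_elt_def by auto
    obtain k :: nat where "r \<le> real k" using real_arch_simple by blast
    then have "r \<le> real (Suc k)" by simp
    then have "mconst (real (Suc k)) + p \<in> M" "mconst (real (Suc k)) + - p \<in> M"
      using bounded_elt_mono[OF M _ r(2)] bounded_elt_mono[OF M _ r(3)] by blast+
    then show "\<exists>k::nat. 0 < k \<and> of_nat k + p \<in> M \<and> of_nat k - p \<in> M"
      by (intro exI[of _ "Suc k"]) (simp add: mconst_simps(7) del: of_nat_Suc)
  qed
qed

text \<open>The certificate of a ball bounds each variable, and the bounded elements form a ring
  that contains the constants.\<close>

lemma archimedean_of_ball: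
  assumes M: "quad_module M" and N: "mconst N - (\<Sum>i\<in>UNIV. (mvar i)\<^sup>2) \<in> M"
  shows "archimedean M"
proof -
  have var: "bounded_elt M (mvar i)" for i
  proof -
    have "mconst N - (\<Sum>i\<in>UNIV. (mvar i)\<^sup>2) + (\<Sum>j\<in>UNIV - {i}. (mvar j)\<^sup>2) \<in> M"
      by (intro quad_module_add[OF M N] quad_module_sum[OF M] quad_module_sq[OF M])
    then have i: "mconst N - (mvar i)\<^sup>2 \<in> M" by (simp add: sum.remove[of UNIV i])
    have "mconst (max 0 N + 1) + x \<in> M" if "x\<^sup>2 = (mvar i)\<^sup>2" for x
    proof -
      \<comment> \<open>N - x^2 + (x + 1/2)^2 is N + 1/4 + x, and the last constant raises this to
        max 0 N + 1 + x.\<close>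
      have m: "(mconst N - (mvar i)\<^sup>2) + (x + mconst (1/2))\<^sup>2 + mconst (max 0 N - N + 3/4) \<in> M"
        by (intro quad_module_add[OF M] quad_module_sq[OF M] mconst_nonneg_mem[OF M] i) auto
      have sq: "(x + mconst (1/2))\<^sup>2 = x\<^sup>2 + x + mconst (1/4)"
      proof -
        have "(x + mconst (1/2))\<^sup>2 = x\<^sup>2 + (mconst (1/2) + mconst (1/2)) * x + mconst (1/2) * mconst (1/2)"
          by (simp add: power2_eq_square algebra_simps)
        also have "\<dots> = x\<^sup>2 + mconst 1 * x + mconst (1/4)" by (simp flip: mconst_simps(3,4))
        finally show ?thesis by (simp add: mconst_simps)
      qed
      have c: "mconst (max 0 N + 1) = mconst N + mconst (1/4) + mconst (max 0 N - N + 3/4)"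
        unfolding mconst_simps(3)[symmetric] by (rule arg_cong[of _ _ mconst]) simp
      show ?thesis using m unfolding sq c that by (simp add: algebra_simps)
    qed
    from this[of "mvar i"] this[of "- mvar i"] show ?thesis
      unfolding bounded_elt_def by (intro exI[of _ "max 0 N + 1"]) auto
  qed
  have "bounded_elt M p" for p
  proof (induct p rule: mpoly_induct)
    case (add p q) then show ?case by (rule bounded_elt_add[OF M])
  next
    case (mult p q) then show ?case by (rule bounded_elt_mult[OF M])
  qed (rule bounded_elt_const[OF M], rule var)
  then show ?thesis using archimedean_iff_bounded[OF M] by blast
qed

section \<open>The Positivstellensatz and compactness\<close>

text \<open>Otherwise T - h T would be a proper preordering, contained in a prime cone; a real point
  for \<open>- h\<close> and the generators then lies in the nonnegativity set and has h \<le>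
  0.\<close>

theorem positivstellensatz:
  fixes g :: "nat \<Rightarrow> 'n::finite real_mpoly"
  assumes T: "ring_preordering T" and g: "\<And>i. i \<in> {1..m} \<Longrightarrow> g i \<in> T"
    and h: "\<And>x. x \<in> nonneg_set m g \<Longrightarrow> 0 < mpoly_eval h x"
  shows "\<exists>p\<in>T. \<exists>q\<in>T. p * h = 1 + q"
proof -
  let ?T = "{s + (- h) * t |s t. s \<in> T \<and> t \<in> T}"
  note ad = preordering_adjoin[OF T, of "- h"]
  have "-1 \<in> ?T"
  proof (rule ccontr)
    assume "-1 \<notin> ?T"
    then obtain P where P: "prime_cone P" "?T \<subseteq> P" using prime_cone_exists[OF ad(1)] by blast
    have "finite (insert (- h) (g ` {1..m}))" by simp
    moreover have "insert (- h) (g ` {1..m}) \<subseteq> P" using P(2) ad(2,3) g by blast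
    ultimately obtain x where x: "\<forall>p\<in>insert (- h) (g ` {1..m}). 0 \<le> mpoly_eval p x"
      using prime_cone_realised[OF P(1)] unfolding realised_def by blast
    then have "x \<in> nonneg_set m g" by (simp add: nonneg_set_def)
    then show False using h[of x] x is_ring_hom_uminus[OF is_ring_hom_mpoly_eval, of h x] by simp
  qed
  then obtain s t where "-1 = s + (- h) * t" "s \<in> T" "t \<in> T" by blast
  moreover have "t * h = 1 + s" using arg_cong[OF calculation(1), of "\<lambda>x. 1 + x + t * h"] by (simp add: algebra_simps)
  ultimately show ?thesis by blast
qed

lemma mpoly_eval_mconst: "mpoly_eval (mconst c) x = c" and mpoly_eval_mvar: "mpoly_eval (mvar i) x = x $ i"
  by (simp_all add: mpoly_eval_conv_ev mpoly_ev_mconst mpoly_ev_mvar is_ring_hom_id)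

lemma mpoly_eval_simps:
  "mpoly_eval 0 x = 0" "mpoly_eval 1 x = 1" "mpoly_eval (p + q) x = mpoly_eval p x + mpoly_eval q x"
  "mpoly_eval (p * q) x = mpoly_eval p x * mpoly_eval q x" "mpoly_eval (- p) x = - mpoly_eval p x"
  "mpoly_eval (p - q) x = mpoly_eval p x - mpoly_eval q x" "mpoly_eval (p ^ k) x = mpoly_eval p x ^ k"
  "mpoly_eval (sum f A) x = (\<Sum>a\<in>A. mpoly_eval (f a) x)" "mpoly_eval (prod f A) x = (\<Prod>a\<in>A. mpoly_eval (f a) x)"
  "mpoly_eval (mconst c) x = c" "mpoly_eval (mvar i) x = x $ i"
  by (simp_all add: is_ring_hom_0[OF is_ring_hom_mpoly_eval] is_ring_hom_1[OF is_ring_hom_mpoly_eval]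
      is_ring_hom_add[OF is_ring_hom_mpoly_eval] is_ring_hom_mult[OF is_ring_hom_mpoly_eval]
      is_ring_hom_uminus[OF is_ring_hom_mpoly_eval] is_ring_hom_diff[OF is_ring_hom_mpoly_eval]
      is_ring_hom_power[OF is_ring_hom_mpoly_eval] is_ring_hom_sum[OF is_ring_hom_mpoly_eval]
      is_ring_hom_prod[OF is_ring_hom_mpoly_eval] mpoly_eval_mconst mpoly_eval_mvar)

text \<open>Woermann's argument: with \<open>h = N - |x|\<^sup>2\<close> and \<open>p h = 1 + q\<close> the product \<open>(1 + q) h = p h\<^sup>2\<close> lies
  in \<open>T\<close>, while \<open>q\<close> is bounded with respect to the preordering generated by \<open>h\<close> alone.\<close>

theorem archimedean_if_compact:
  fixes g :: "nat \<Rightarrow> 'n::finite real_mpoly"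
  assumes T: "ring_preordering T" and g: "\<And>i. i \<in> {1..m} \<Longrightarrow> g i \<in> T" and K: "compact (nonneg_set m g)"
  shows "archimedean T"
proof -
  note M = preordering_imp_quad_module[OF T]
  obtain B where B: "\<And>x. x \<in> nonneg_set m g \<Longrightarrow> norm x \<le> B"
    using compact_imp_bounded[OF K] unfolding bounded_iff by blast
  define N where "N = B\<^sup>2 + 1"
  define S :: "'n real_mpoly" where "S = (\<Sum>i\<in>UNIV. (mvar i)\<^sup>2)"
  define h where "h = mconst N - S"
  have "mpoly_eval h x = N - (norm x)\<^sup>2" for x
    by (simp add: h_def S_def mpoly_eval_simps norm_vec_def L2_set_def sum_nonneg)
  moreover have "(norm x)\<^sup>2 \<le> B\<^sup>2" if "x \<in> nonneg_set m g" for x using B[OF that] by (intro power_mono) auto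
  ultimately have "0 < mpoly_eval h x" if "x \<in> nonneg_set m g" for x
    using that by (simp add: N_def) (meson le_less_trans less_add_one)
  then obtain p q where pq: "p \<in> T" "q \<in> T" "p * h = 1 + q" using positivstellensatz[where T = T and m = m and g = g and h = h, OF T g] by blast
  note add = quad_module_add[OF M] and sos = sos_subset_quad_module[OF M]
  have ST: "S \<in> T" unfolding S_def by (intro quad_module_sum[OF M] quad_module_sq[OF M])
  have qh: "(1 + q) * h \<in> T"
  proof -
    have "h\<^sup>2 * p \<in> T" using quad_module_sq_mult[OF M pq(1)] .
    moreover have "h\<^sup>2 * p = (1 + q) * h" unfolding pq(3)[symmetric] by (simp add: power2_eq_square algebra_simps)
    ultimately show ?thesis by simp
  qed
  let ?T0 = "{s + h * t |s t. s \<in> sums_of_squares \<and> t \<in> sums_of_squares}"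
  note T0 = preordering_adjoin[OF preordering_sums_of_squares, of h]
  have "archimedean ?T0"
    using T0(3) archimedean_of_ball[OF preordering_imp_quad_module[OF T0(1)]] unfolding h_def S_def by blast
  then have "bounded_elt ?T0 q" using archimedean_iff_bounded[OF preordering_imp_quad_module[OF T0(1)]] by blast
  then obtain k where "0 \<le> k" "mconst k - q \<in> ?T0" unfolding bounded_elt_def by blast
  then obtain s t where k: "0 \<le> k" "mconst k - q = s + h * t" "s \<in> sums_of_squares" "t \<in> sums_of_squares" by blast
  have "(1 + q) * s \<in> T" using pq(2) k(3) quad_module_1[OF M] add quad_module_sos_mult[OF M] by (simp add: mult.commute)
  moreover have "t * ((1 + q) * h) \<in> T" using quad_module_sos_mult[OF M k(4) qh] .
  ultimately have "(1 + q) * s + t * ((1 + q) * h) + (mconst (k/2) - q)\<^sup>2 \<in> T"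
    by (intro add quad_module_sq[OF M])
  moreover have "(1 + q) * s + t * ((1 + q) * h) = (1 + q) * (mconst k - q)"
    unfolding k(2) by (simp add: algebra_simps)
  \<comment> \<open>The square cancels k q - q^2, which leaves an upper bound for \<open>q\<close>
    relative to \<open>T\<close> itself.\<close>
  moreover have "(1 + q) * (mconst k - q) + (mconst (k/2) - q)\<^sup>2 = mconst (k + k\<^sup>2/4) - q"
  proof -
    have "mconst k = mconst (k/2) + mconst (k/2)" "mconst (k + k\<^sup>2/4) = mconst k + mconst (k/2) * mconst (k/2)"
      by (simp_all add: power2_eq_square flip: mconst_simps)
    note e = this
    show ?thesis unfolding e(2) e(1) by (simp add: power2_eq_square algebra_simps)
  qed
  ultimately have c: "mconst (k + k\<^sup>2/4) - q \<in> T" by simp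
  define c' where "c' = k + k\<^sup>2/4"
  have N0: "0 \<le> N" by (simp add: N_def)
  \<comment> \<open>Every occurrence of \<open>q\<close> cancels in this sum, and the certificate of
    a larger ball remains.\<close>
  have "(1 + q) * h + q * S + mconst N * (mconst c' - q) \<in> T"
    using c pq(2) ST by (intro add qh preordering_mult[OF T] mconst_nonneg_mult[OF M N0]) (auto simp: c'_def)
  moreover have "(1 + q) * h + q * S + mconst N * (mconst c' - q) = mconst (N + N * c') - S"
    by (simp add: h_def algebra_simps mconst_simps)
  ultimately show ?thesis using archimedean_of_ball[OF M, of "N + N * c'"] by (simp add: S_def)
qed


section \<open>Positive polynomials and Archimedean quadratic modules\<close>

text \<open>Taken over all of \<open>M\<close>, so it is contained in \<open>nonneg_set m g\<close>
  as soon as the generators belong to \<open>M\<close>.\<close>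

definition real_points :: "'n::finite real_mpoly set \<Rightarrow> (real ^ 'n) set" where
  "real_points M = {x. \<forall>p\<in>M. 0 \<le> mpoly_eval p x}"

lemma maximal_quad_module_exists:
  fixes M :: "'a::comm_ring_1 set"
  assumes "quad_module M" "-1 \<notin> M"
  shows "\<exists>N. quad_module N \<and> M \<subseteq> N \<and> -1 \<notin> N \<and> (\<forall>N'. quad_module N' \<longrightarrow> N \<subseteq> N' \<longrightarrow> -1 \<notin> N' \<longrightarrow> N' = N)"
proof -
  let ?A = "{N. quad_module N \<and> M \<subseteq> N \<and> -1 \<notin> N}"
  have "\<exists>N\<in>?A. \<forall>N'\<in>?A. N \<subseteq> N' \<longrightarrow> N' = N"
  proof (rule subset_Zorn_nonempty)
    show "?A \<noteq> {}" using assms by blast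
    fix C assume ne: "C \<noteq> {}" and ch: "subset.chain ?A C"
    have mem: "quad_module N" "M \<subseteq> N" "-1 \<notin> N" if "N \<in> C" for N
      using ch that by (auto simp: subset.chain_def)
    have "quad_module (\<Union>C)"
      unfolding quad_module_def
    proof (intro conjI ballI allI)
      show "1 \<in> \<Union>C" using ne mem(1) quad_module_1 by blast
      fix x assume x: "x \<in> \<Union>C"
      show "q\<^sup>2 * x \<in> \<Union>C" for q using x mem(1) quad_module_sq_mult by blast
      fix y assume "y \<in> \<Union>C"
      then obtain N1 N2 where "N1 \<in> C" "N2 \<in> C" "x \<in> N1" "y \<in> N2" using x by blast
      moreover have "N1 \<subseteq> N2 \<or> N2 \<subseteq> N1" using ch calculation unfolding subset.chain_def by blast
      ultimately show "x + y \<in> \<Union>C" using mem(1) quad_module_add by blast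
    qed
    then show "\<Union>C \<in> ?A" using ne mem by blast
  qed
  then obtain N where "N \<in> ?A" and mx: "\<forall>N'\<in>?A. N \<subseteq> N' \<longrightarrow> N' = N" by (rule bexE)
  then have N: "quad_module N" "M \<subseteq> N" "-1 \<notin> N" by simp_all
  have "N' = N" if "quad_module N'" "N \<subseteq> N'" "-1 \<notin> N'" for N'
    using mx[rule_format, of N'] that N(2) by simp
  then show ?thesis using N by blast
qed

text \<open>If neither element belongs to \<open>N\<close>, both adjunctions yield -1. Combining the
  certificates puts -s, and with it both signs of s, into \<open>N\<close>; then s a is in
  \<open>N\<close> as well, and so is -1 = m + s a.\<close>

lemma maximal_quad_module_total:
  fixes N :: "'n::finite real_mpoly set"
  assumes N: "quad_module N" "-1 \<notin> N"
    and max: "\<And>N'. quad_module N' \<Longrightarrow> N \<subseteq> N' \<Longrightarrow> -1 \<notin> N' \<Longrightarrow> N' = N"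
  shows "a \<in> N \<or> - a \<in> N"
proof (rule ccontr)
  assume nt: "\<not> ?thesis"
  have ext: "\<exists>m\<in>N. \<exists>s\<in>sums_of_squares. -1 = m + s * f" if "f \<notin> N" for f
  proof (rule ccontr)
    assume *: "\<not> ?thesis"
    let ?N = "{m + s * f |m s. m \<in> N \<and> s \<in> sums_of_squares}"
    have "-1 \<notin> ?N" using * by blast
    then have "?N = N" using quad_module_adjoin(1,2)[OF N(1), of f] by (intro max)
    then show False using quad_module_adjoin(3)[OF N(1), of f] that by blast
  qed
  obtain m s where ms: "m \<in> N" "s \<in> sums_of_squares" "-1 = m + s * a" using ext[of a] nt by blast
  obtain m' s' where ms': "m' \<in> N" "s' \<in> sums_of_squares" "-1 = m' + s' * (- a)" using ext[of "- a"] nt by blast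
  have sum: "s' * m + s * m' = - (s + s')"
  proof -
    have "m = -1 - s * a" "m' = -1 - s' * (- a)" using ms(3) ms'(3) by (metis add_diff_cancel_right')+
    note e = this
    show ?thesis unfolding e(1) e(2) by (simp add: algebra_simps)
  qed
  have "s' * m + s * m' \<in> N"
    by (intro quad_module_add[OF N(1)] quad_module_sos_mult[OF N(1)] ms ms')
  then have "- (s + s') + s' \<in> N"
    unfolding sum by (rule quad_module_add[OF N(1) _ sos_subset_quad_module[OF N(1) ms'(2)]])
  then have s: "- s \<in> N" "s \<in> N" using sos_subset_quad_module[OF N(1) ms(2)] by simp_all
  \<comment> \<open>Elements with both signs in \<open>N\<close> absorb multiplication: (a + 1)^2 -
    (a - 1)^2 = 4 a.\<close>
  have "(a + 1)\<^sup>2 * s + (a - 1)\<^sup>2 * (- s) \<in> N"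
    by (intro quad_module_add[OF N(1)] quad_module_sq_mult[OF N(1)] s)
  moreover have "(a + 1)\<^sup>2 * s + (a - 1)\<^sup>2 * (- s) = mconst 4 * (s * a)"
    by (simp add: mconst_numeral power2_eq_square algebra_simps)
  ultimately have "s * a \<in> N" using mconst_cancel[OF N(1), of 4] by simp
  then have "-1 \<in> N" unfolding ms(3) by (rule quad_module_add[OF N(1) ms(1)])
  then show False using N(2) by simp
qed

text \<open>\<open>a\<close> differs from the real number \<open>c\<close> only infinitesimally in
  the sense of \<open>N\<close>. For a maximal proper module extending an Archimedean one, these
  values turn out to be evaluation at a point.\<close>

definition is_val :: "'n::finite real_mpoly set \<Rightarrow> 'n real_mpoly \<Rightarrow> real \<Rightarrow> bool" where
  "is_val N a c \<longleftrightarrow> (\<forall>\<epsilon>>0. mconst \<epsilon> + (a - mconst c) \<in> N \<and> mconst \<epsilon> - (a - mconst c) \<in> N)"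

text \<open>The value is the supremum of the lower bounds certified by \<open>N\<close>; that it is
  also an upper bound up to \<epsilon> uses totality.\<close>

lemma is_val_exists:
  assumes N: "quad_module N" "-1 \<notin> N" and tot: "\<And>a. a \<in> N \<or> - a \<in> N" and b: "bounded_elt N a"
  shows "\<exists>c. is_val N a c"
proof -
  define L where "L = {r. a - mconst r \<in> N}"
  have L: "r \<in> L \<longleftrightarrow> a - mconst r \<in> N" for r by (simp add: L_def)
  obtain k where k: "0 \<le> k" "mconst k + a \<in> N" "mconst k - a \<in> N" using b by (auto simp: bounded_elt_def)
  have ne: "- k \<in> L" using k(2) by (simp add: L_def mconst_simps add.commute)
  have ub: "r \<le> k" if "r \<in> L" for r
  proof (rule ccontr)
    assume r: "\<not> r \<le> k"
    have "(mconst k - a) + (a - mconst r) \<in> N" using that k(3) by (intro quad_module_add[OF N(1)]) (simp_all add: L_def)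
    then have "mconst (r - k) * (-1) \<in> N" by (simp add: mconst_simps)
    then show False using mconst_cancel[OF N(1), of "r - k" "-1"] r N(2) by simp
  qed
  then have bdd: "bdd_above L" by (auto simp: bdd_above_def)
  have "is_val N a (Sup L)"
    unfolding is_val_def
  proof (intro allI impI conjI)
    fix \<epsilon> :: real assume e: "0 < \<epsilon>"
    obtain r where r: "r \<in> L" "Sup L - \<epsilon> < r"
      using less_cSup_iff[of L "Sup L - \<epsilon>"] ne bdd e by force
    have "(a - mconst r) + mconst (r - (Sup L - \<epsilon>)) \<in> N"
      using r by (intro quad_module_add[OF N(1)] mconst_nonneg_mem[OF N(1)]) (auto simp: L_def)
    then show "mconst \<epsilon> + (a - mconst (Sup L)) \<in> N" by (simp add: mconst_simps algebra_simps)
    have "Sup L + \<epsilon> \<notin> L" using cSup_upper[OF _ bdd, of "Sup L + \<epsilon>"] e by auto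
    then have "- (a - mconst (Sup L + \<epsilon>)) \<in> N" using tot L by blast
    then show "mconst \<epsilon> - (a - mconst (Sup L)) \<in> N" by (simp add: mconst_simps algebra_simps)
  qed
  then show ?thesis ..
qed

section \<open>Values respect the ring operations\<close>

lemma is_val_const: "quad_module N \<Longrightarrow> is_val N (mconst c) c"
  by (simp add: is_val_def mconst_nonneg_mem)

lemma is_val_add:
  assumes N: "quad_module N" "is_val N a c" "is_val N b d" shows "is_val N (a + b) (c + d)"
  unfolding is_val_def
proof (intro allI impI)
  fix \<epsilon> :: real assume "0 < \<epsilon>"
  then have e: "0 < \<epsilon> / 2" by simp
  have v: "mconst (\<epsilon>/2) + (a - mconst c) \<in> N" "mconst (\<epsilon>/2) - (a - mconst c) \<in> N"
    "mconst (\<epsilon>/2) + (b - mconst d) \<in> N" "mconst (\<epsilon>/2) - (b - mconst d) \<in> N"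
    using N(2,3) e unfolding is_val_def by blast+
  have e2: "mconst \<epsilon> = mconst (\<epsilon>/2) + mconst (\<epsilon>/2)" by (simp flip: mconst_simps(3))
  show "mconst \<epsilon> + (a + b - mconst (c + d)) \<in> N \<and> mconst \<epsilon> - (a + b - mconst (c + d)) \<in> N"
    using quad_module_add[OF N(1) v(1,3)] quad_module_add[OF N(1) v(2,4)]
    unfolding e2 mconst_simps(3)[of c d] by (simp add: algebra_simps)
qed

lemma is_val_scale:
  assumes N: "quad_module N" "is_val N a c" shows "is_val N (mconst r * a) (r * c)"
proof -
  have pos: "is_val N (mconst r * a) (r * c)" if r: "0 < r" and v: "is_val N a c" for r a c
    unfolding is_val_def
  proof (intro allI impI)
    fix \<epsilon> :: real assume "0 < \<epsilon>"
    then have e: "0 < \<epsilon> / r" using r by simp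
    have "mconst (\<epsilon> / r) + (a - mconst c) \<in> N" "mconst (\<epsilon> / r) - (a - mconst c) \<in> N"
      using v e unfolding is_val_def by blast+
    then have m: "mconst r * (mconst (\<epsilon> / r) + (a - mconst c)) \<in> N" "mconst r * (mconst (\<epsilon> / r) - (a - mconst c)) \<in> N"
      using r by (blast intro: mconst_nonneg_mult[OF N(1)] less_imp_le)+
    have eq: "mconst \<epsilon> = mconst r * mconst (\<epsilon> / r)" using r by (simp flip: mconst_simps(4))
    show "mconst \<epsilon> + (mconst r * a - mconst (r * c)) \<in> N \<and> mconst \<epsilon> - (mconst r * a - mconst (r * c)) \<in> N"
      using m unfolding eq mconst_simps(4)[of r c] by (simp add: algebra_simps)
  qed
  have neg: "is_val N (- a) (- c)"
    unfolding is_val_def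
  proof (intro allI impI)
    fix \<epsilon> :: real assume "0 < \<epsilon>"
    then have "mconst \<epsilon> + (a - mconst c) \<in> N" "mconst \<epsilon> - (a - mconst c) \<in> N"
      using N(2) unfolding is_val_def by blast+
    then show "mconst \<epsilon> + (- a - mconst (- c)) \<in> N \<and> mconst \<epsilon> - (- a - mconst (- c)) \<in> N"
      by (simp add: mconst_simps(5) algebra_simps)
  qed
  consider "r = 0" | "0 < r" | "0 < - r" by linarith
  then show ?thesis
  proof cases
    case 1 then show ?thesis using is_val_const[OF N(1), of 0] by (simp add: mconst_simps)
  next
    case 2 then show ?thesis using pos N(2) by blast
  next
    case 3
    then show ?thesis using pos[OF 3 neg] by (simp add: mconst_simps)
  qed
qed

lemma is_val_0_sq:
  assumes N: "quad_module N" "is_val N a 0" shows "is_val N (a\<^sup>2) 0"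
  unfolding is_val_def
proof (intro allI impI conjI)
  fix \<epsilon> :: real assume e: "0 < \<epsilon>"
  show "mconst \<epsilon> + (a\<^sup>2 - mconst 0) \<in> N"
    using e by (auto simp: mconst_simps intro!: quad_module_add[OF N(1)] mconst_nonneg_mem[OF N(1)] quad_module_sq[OF N(1)])
  have "mconst (sqrt \<epsilon>) + a \<in> N" "mconst (sqrt \<epsilon>) - a \<in> N"
    using N(2) e unfolding is_val_def by (auto simp: mconst_simps)
  then have "mconst ((sqrt \<epsilon>)\<^sup>2) - a\<^sup>2 \<in> N" using e by (intro square_bound[OF N(1)]) auto
  then show "mconst \<epsilon> - (a\<^sup>2 - mconst 0) \<in> N" using e by (simp add: mconst_simps(1))
qed

text \<open>After subtraction of the values only elements of value 0 remain to be multiplied; their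
  squares have value 0, and products follow by polarisation.\<close>

lemma is_val_mult:
  assumes N: "quad_module N" "is_val N a c" "is_val N b d" shows "is_val N (a * b) (c * d)"
proof -
  define a' b' where "a' = a + mconst (- c)" and "b' = b + mconst (- d)"
  have v: "is_val N a' 0" "is_val N b' 0"
    using is_val_add[OF N(1,2) is_val_const[OF N(1), of "- c"]] is_val_add[OF N(1,3) is_val_const[OF N(1), of "- d"]]
    by (simp_all add: a'_def b'_def)
  have "is_val N ((a' + b')\<^sup>2) 0" "is_val N ((a' + mconst (-1) * b')\<^sup>2) 0"
    using is_val_add[OF N(1) v] is_val_add[OF N(1) v(1) is_val_scale[OF N(1) v(2), of "-1"]]
    by (auto intro!: is_val_0_sq[OF N(1)])
  then have "is_val N (mconst (1/4) * ((a' + b')\<^sup>2 + mconst (-1) * (a' + mconst (-1) * b')\<^sup>2)) (1/4 * (0 + (-1) * 0))"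
    by (intro is_val_scale[OF N(1)] is_val_add[OF N(1)])
  moreover have "mconst (1/4) * ((a' + b')\<^sup>2 + mconst (-1) * (a' + mconst (-1) * b')\<^sup>2) = a' * b'"
  proof -
    have "(a' + b')\<^sup>2 + mconst (-1) * (a' + mconst (-1) * b')\<^sup>2 = mconst 4 * (a' * b')"
      by (simp add: mconst_simps(2,5) mconst_numeral power2_eq_square algebra_simps)
    then have "mconst (1/4) * ((a' + b')\<^sup>2 + mconst (-1) * (a' + mconst (-1) * b')\<^sup>2) = (mconst (1/4) * mconst 4) * (a' * b')"
      by (simp only: mult.assoc)
    also have "mconst (1/4) * mconst 4 = (1 :: 'a real_mpoly)"
      unfolding mconst_simps(4)[symmetric] by (simp add: mconst_simps(2))
    finally show ?thesis by simp
  qed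
  ultimately have "is_val N (a' * b') 0" by simp
  then have "is_val N (a' * b' + mconst d * a + mconst c * b + mconst (- (c * d))) (0 + d * c + c * d + - (c * d))"
    by (intro is_val_add[OF N(1)] is_val_scale[OF N(1)] is_val_const[OF N(1)] N(2,3))
  moreover have "a' * b' + mconst d * a + mconst c * b + mconst (- (c * d)) = a * b"
    by (simp add: a'_def b'_def mconst_simps algebra_simps)
  ultimately show ?thesis by (simp add: mult.commute)
qed

text \<open>The values of the variables are the coordinates of a point. By induction the value of
  every polynomial is its evaluation there, and an element of \<open>N\<close> cannot have a
  negative value.\<close>

lemma archimedean_point_exists:
  fixes M :: "'n::finite real_mpoly set"
  assumes M: "quad_module M" "-1 \<notin> M" "archimedean M"
  shows "real_points M \<noteq> {}"
proof -
  obtain N where N: "quad_module N" "M \<subseteq> N" "-1 \<notin> N"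
    and max: "\<And>N'. quad_module N' \<Longrightarrow> N \<subseteq> N' \<Longrightarrow> -1 \<notin> N' \<Longrightarrow> N' = N"
    using maximal_quad_module_exists[OF M(1,2)] by metis
  have b: "bounded_elt N a" for a
    using M(3) N(2) archimedean_iff_bounded[OF M(1)] unfolding bounded_elt_def by blast
  have ex: "\<exists>c. is_val N a c" for a
    by (rule is_val_exists[OF N(1,3) maximal_quad_module_total[OF N(1,3) max] b])
  define x where "x = (\<chi> i. SOME c. is_val N (mvar i) c)"
  have v: "is_val N p (mpoly_eval p x)" for p
  proof (induct p rule: mpoly_induct)
    case (var i)
    show ?case using someI_ex[OF ex[of "mvar i"]] by (simp add: mpoly_eval_simps x_def)
  qed (simp_all add: mpoly_eval_simps is_val_const[OF N(1)] is_val_add[OF N(1)] is_val_mult[OF N(1)])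
  have "0 \<le> mpoly_eval p x" if "p \<in> N" for p
  proof (rule ccontr)
    assume c: "\<not> 0 \<le> mpoly_eval p x"
    define \<epsilon> where "\<epsilon> = - mpoly_eval p x / 2"
    have e: "0 < \<epsilon>" using c by (simp add: \<epsilon>_def)
    have "mconst \<epsilon> - (p - mconst (mpoly_eval p x)) \<in> N" using v[of p] e unfolding is_val_def by blast
    then have "mconst \<epsilon> - (p - mconst (mpoly_eval p x)) + p \<in> N" using that by (rule quad_module_add[OF N(1)])
    moreover have "mpoly_eval p x = - (\<epsilon> + \<epsilon>)" by (simp add: \<epsilon>_def)
    then have "mconst \<epsilon> - (p - mconst (mpoly_eval p x)) + p = mconst \<epsilon> * (-1)"
      by (simp only: mconst_simps(3,5)) (simp add: algebra_simps)
    ultimately have "mconst \<epsilon> * (-1) \<in> N" by simp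
    then show False using mconst_cancel[OF N(1) e] N(3) by blast
  qed
  then show ?thesis using N(2) by (auto simp: real_points_def)
qed

text \<open>Adjoining -f to \<open>M\<close> leaves no real point, which yields a sum of squares s
  with s f - 1 in \<open>M\<close>. Division by s is impossible; instead a bound r + f in
  \<open>M\<close> is lowered by a fixed amount until r is at most 0.\<close>

theorem archimedean_positivstellensatz:
  fixes f :: "'n::finite real_mpoly"
  assumes M: "quad_module M" "archimedean M" and f: "\<And>x. x \<in> real_points M \<Longrightarrow> 0 < mpoly_eval f x"
  shows "f \<in> M"
proof -
  let ?M = "{m + s * (- f) |m s. m \<in> M \<and> s \<in> sums_of_squares}"
  note ad = quad_module_adjoin[OF M(1), of "- f"]
  have arch: "archimedean ?M"
    unfolding archimedean_def
  proof
    fix p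
    obtain k :: nat where "k > 0" "of_nat k + p \<in> M" "of_nat k - p \<in> M"
      using M(2) unfolding archimedean_def by blast
    then show "\<exists>k::nat. k > 0 \<and> of_nat k + p \<in> ?M \<and> of_nat k - p \<in> ?M"
      using subsetD[OF ad(2)] by (intro exI[of _ k] conjI)
  qed
  have "-1 \<in> ?M"
  proof (rule ccontr)
    assume "-1 \<notin> ?M"
    then obtain x where x: "x \<in> real_points ?M" using archimedean_point_exists[OF ad(1) _ arch] by blast
    then have x: "0 \<le> mpoly_eval p x" if "p \<in> ?M" for p using that unfolding real_points_def by simp
    have "x \<in> real_points M" unfolding real_points_def using x subsetD[OF ad(2)] by simp
    moreover have "0 \<le> mpoly_eval (- f) x" by (rule x[OF ad(3)])
    ultimately show False using f by (fastforce simp: mpoly_eval_simps)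
  qed
  then obtain m s where ms: "-1 = m + s * (- f)" "m \<in> M" "s \<in> sums_of_squares" by blast
  have sf: "s * f - 1 \<in> M"
  proof -
    have "m = s * f - 1" using arg_cong[OF ms(1), of "\<lambda>x. x + s * f"] by (simp add: algebra_simps)
    then show ?thesis using ms(2) by simp
  qed
  have bd: "bounded_elt M p" for p using M(2) archimedean_iff_bounded[OF M(1)] by blast
  obtain k1 where k1: "0 \<le> k1" "mconst k1 + - s \<in> M" using bd[of s] by (auto simp: bounded_elt_def)
  obtain k2 where k2: "0 \<le> k2" "mconst k2 + - (s\<^sup>2 * f + 1) \<in> M"
    using bd[of "s\<^sup>2 * f + 1"] unfolding bounded_elt_def diff_conv_add_uminus[of "mconst _"] by blast
  obtain r0 where r0: "0 \<le> r0" "mconst r0 + f \<in> M" using bd[of f] by (auto simp: bounded_elt_def)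
  \<comment> \<open>Large enough that 2 k - s and 2 k - (s^2 f + 1) lie in \<open>M\<close>.\<close>
  define k where "k = max 1 (max k1 k2)"
  have k: "1 \<le> k" by (simp add: k_def)
  have ks: "mconst (2 * k) + - s \<in> M"
    by (rule bounded_elt_mono[OF M(1) _ k1(2)]) (use k1 k in \<open>simp add: k_def\<close>)
  have ks2: "mconst (2 * k) + - (s\<^sup>2 * f + 1) \<in> M"
    by (rule bounded_elt_mono[OF M(1) _ k2(2)]) (use k2 k in \<open>simp add: k_def\<close>)
  define d where "d = inverse (k\<^sup>2)"
  have d: "0 < d" using k by (simp add: d_def)
  have step: "mconst (r - d) + f \<in> M" if r: "0 \<le> r" "mconst r + f \<in> M" for r
  proof -
    \<comment> \<open>All four summands are in \<open>M\<close>. The terms with \<open>s\<close>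
      cancel and k^2 (r + f) - 1 remains, which lowers r by d = 1/k^2.\<close>
    have "(mconst k - s)\<^sup>2 * (mconst r + f) + mconst (2 * k) * (s * f - 1) + mconst r * (s * (mconst (2 * k) + - s))
        + (mconst (2 * k) + - (s\<^sup>2 * f + 1)) \<in> M"
    proof -
      have "mconst (2 * k) * (s * f - 1) \<in> M" using k by (intro mconst_nonneg_mult[OF M(1) _ sf]) simp
      moreover have "mconst r * (s * (mconst (2 * k) + - s)) \<in> M"
        by (rule mconst_nonneg_mult[OF M(1) r(1) quad_module_sos_mult[OF M(1) ms(3) ks]])
      ultimately show ?thesis
        using quad_module_add[OF M(1)] quad_module_sq_mult[OF M(1) r(2)] ks2 by blast
    qed
    moreover have "(mconst k - s)\<^sup>2 * (mconst r + f) + mconst (2 * k) * (s * f - 1) + mconst r * (s * (mconst (2 * k) + - s))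
        + (mconst (2 * k) + - (s\<^sup>2 * f + 1)) = mconst (k\<^sup>2) * (mconst r + f) - 1"
      by (simp add: mconst_simps(4,8) mconst_numeral power2_eq_square algebra_simps)
    moreover have "mconst (k\<^sup>2) * (mconst r + f) - 1 = mconst (k\<^sup>2) * (mconst (r - d) + f)"
    proof -
      have "mconst (k\<^sup>2) * mconst d = (1 :: 'n real_mpoly)"
        unfolding mconst_simps(4)[symmetric] using k by (simp add: d_def mconst_simps(2))
      then show ?thesis by (simp add: mconst_simps(6) algebra_simps)
    qed
    ultimately show ?thesis using mconst_cancel[OF M(1), of "k\<^sup>2"] k by simp
  qed
  have dec: "f \<in> M" if "r \<le> 0" "mconst r + f \<in> M" for r
    using bounded_elt_mono[OF M(1), of r 0 f] that by (simp add: mconst_simps)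
  have "f \<in> M \<or> mconst (r0 - real j * d) + f \<in> M" for j
  proof (induct j)
    case 0 then show ?case using r0 by simp
  next
    case (Suc j)
    have e: "r0 - real (Suc j) * d = (r0 - real j * d) - d" by (simp add: algebra_simps)
    show ?case
    proof (cases "0 \<le> r0 - real j * d")
      case True then show ?thesis using Suc step unfolding e by blast
    next
      case False then show ?thesis using Suc dec[of "r0 - real j * d"] by auto
    qed
  qed
  moreover obtain j where "r0 < real j * d" using reals_Archimedean3[OF d] by blast
  ultimately show ?thesis using dec[of "r0 - real j * d"] by (metis diff_le_0_iff_le less_imp_le)
qed


section \<open>Compactness arguments\<close>

text \<open>If no multiple n works, a limit of the counterexamples has a \<le> 0 and therefore s >
  0, but then n s grows without bound along the sequence.\<close>

lemma compact_add_multiple_pos: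
  fixes a s :: "'c::metric_space \<Rightarrow> real"
  assumes C: "compact C" and a: "continuous_on C a" and s: "continuous_on C s"
    and nn: "\<And>z. z \<in> C \<Longrightarrow> 0 \<le> s z" and pos: "\<And>z. z \<in> C \<Longrightarrow> s z = 0 \<Longrightarrow> 0 < a z"
  shows "\<exists>N\<ge>0. \<exists>\<mu>>0. \<forall>z\<in>C. \<mu> \<le> a z + N * s z"
proof (rule ccontr)
  assume nt: "\<not> ?thesis"
  have "\<exists>z\<in>C. a z + real n * s z < inverse (real (Suc n))" for n
  proof (rule ccontr)
    assume "\<not> ?thesis"
    then have "\<forall>z\<in>C. inverse (real (Suc n)) \<le> a z + real n * s z" by (simp add: not_less)
    moreover have "0 \<le> real n" "0 < inverse (real (Suc n))" by auto
    ultimately show False using nt by blast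
  qed
  then obtain z where z: "\<And>n. z n \<in> C" "\<And>n. a (z n) + real n * s (z n) < inverse (real (Suc n))" by metis
  obtain l r where l: "l \<in> C" "strict_mono r" "(z \<circ> r) \<longlonglongrightarrow> l"
    using C z(1) unfolding compact_def by metis
  have la: "(\<lambda>n. a (z (r n))) \<longlonglongrightarrow> a l" and ls: "(\<lambda>n. s (z (r n))) \<longlonglongrightarrow> s l"
    using continuous_on_tendsto_compose[OF a l(3,1)] continuous_on_tendsto_compose[OF s l(3,1)] z(1) by auto
  have li: "(\<lambda>n. inverse (real (Suc (r n)))) \<longlonglongrightarrow> 0"
    using LIMSEQ_subseq_LIMSEQ[OF LIMSEQ_inverse_real_of_nat l(2)] by (simp add: o_def)
  have "a l \<le> 0"
  proof (rule LIMSEQ_le[OF la li])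
    have "a (z (r n)) \<le> inverse (real (Suc (r n)))" for n
      using z(2)[of "r n"] nn[OF z(1), of "r n"] by (smt (verit) mult_nonneg_nonneg of_nat_0_le_iff)
    then show "\<exists>N. \<forall>n\<ge>N. a (z (r n)) \<le> inverse (real (Suc (r n)))" by blast
  qed
  then have sl: "0 < s l" using pos[OF l(1)] nn[OF l(1)] by force
  have "filterlim (\<lambda>n. real (r n)) at_top sequentially"
    using filterlim_compose[OF filterlim_real_sequentially filterlim_subseq[OF l(2)]] .
  then have "filterlim (\<lambda>n. real (r n) * s (z (r n))) at_top sequentially"
    by (rule filterlim_at_top_mult_tendsto_pos[OF ls sl, rotated])
  then have "filterlim (\<lambda>n. a (z (r n)) + real (r n) * s (z (r n))) at_top sequentially"
    by (rule filterlim_tendsto_add_at_top[OF la])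
  then have "eventually (\<lambda>n. 1 \<le> a (z (r n)) + real (r n) * s (z (r n))) sequentially"
    by (simp add: filterlim_at_top)
  then obtain n where n: "1 \<le> a (z (r n)) + real (r n) * s (z (r n))"
    using eventually_happens by force
  have "inverse (real (Suc (r n))) \<le> 1" by (simp add: field_simps)
  then show False using n z(2)[of "r n"] by linarith
qed

text \<open>Local comparisons become one constant on all of \<open>C\<close>: a limit of
  counterexamples for the constants 1/(n + 1) has f \<le> 0, and the local bound there refutes
  them.\<close>

lemma compact_local_domination:
  fixes f g :: "'c::metric_space \<Rightarrow> real"
  assumes C: "compact C" and f: "continuous_on C f" and g: "continuous_on C g"
    and nn: "\<And>z. z \<in> C \<Longrightarrow> 0 \<le> g z"
    and loc: "\<And>z. z \<in> C \<Longrightarrow> 0 < f z \<or> (\<exists>\<kappa>>0. \<exists>r>0. \<forall>y\<in>C. dist y z < r \<longrightarrow> \<kappa> * g y \<le> f y)"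
  shows "\<exists>\<kappa>>0. \<forall>z\<in>C. \<kappa> * g z \<le> f z"
proof (rule ccontr)
  assume nt: "\<not> ?thesis"
  have "\<exists>z\<in>C. f z < inverse (real (Suc n)) * g z" for n
  proof (rule ccontr)
    assume "\<not> ?thesis"
    then have "\<forall>z\<in>C. inverse (real (Suc n)) * g z \<le> f z" by (simp add: not_less)
    moreover have "0 < inverse (real (Suc n))" by auto
    ultimately show False using nt by blast
  qed
  then obtain z where z: "\<And>n. z n \<in> C" "\<And>n. f (z n) < inverse (real (Suc n)) * g (z n)" by metis
  obtain l r where l: "l \<in> C" "strict_mono r" "(z \<circ> r) \<longlonglongrightarrow> l"
    using C z(1) unfolding compact_def by metis
  have lf: "(\<lambda>n. f (z (r n))) \<longlonglongrightarrow> f l" and lg: "(\<lambda>n. g (z (r n))) \<longlonglongrightarrow> g l"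
    using continuous_on_tendsto_compose[OF f l(3,1)] continuous_on_tendsto_compose[OF g l(3,1)] z(1) by auto
  have li: "(\<lambda>n. inverse (real (Suc (r n)))) \<longlonglongrightarrow> 0"
    using LIMSEQ_subseq_LIMSEQ[OF LIMSEQ_inverse_real_of_nat l(2)] by (simp add: o_def)
  have "f l \<le> 0 * g l"
    by (rule LIMSEQ_le[OF lf tendsto_mult[OF li lg]]) (use z(2) less_imp_le in blast)
  then obtain d e where d: "0 < d" "0 < e" "\<And>y. y \<in> C \<Longrightarrow> dist y l < e \<Longrightarrow> d * g y \<le> f y"
    using loc[OF l(1)] by auto
  have "eventually (\<lambda>n. dist ((z \<circ> r) n) l < e) sequentially" using l(3) d(2) by (rule tendstoD)
  moreover have "eventually (\<lambda>n. inverse (real (Suc (r n))) < d) sequentially" using li d(1) by (rule order_tendstoD)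
  ultimately have "eventually (\<lambda>n. dist ((z \<circ> r) n) l < e \<and> inverse (real (Suc (r n))) < d) sequentially"
    by (rule eventually_conj)
  then obtain n where n: "dist (z (r n)) l < e" "inverse (real (Suc (r n))) < d"
    using eventually_happens by (metis (no_types, lifting) comp_apply trivial_limit_sequentially)
  have "inverse (real (Suc (r n))) * g (z (r n)) \<le> d * g (z (r n))"
    using n(2) nn[OF z(1)] by (intro mult_right_mono) auto
  then show False using z(2)[of "r n"] d(3)[OF z(1) n(1)] by linarith
qed

section \<open>Polynomial functions on compact sets\<close>

lemma continuous_on_mpoly_eval [continuous_intros]:
  assumes "continuous_on S h" shows "continuous_on S (\<lambda>z. mpoly_eval p (h z))"
  by (induct p rule: mpoly_induct)
     (simp_all add: mpoly_eval_simps, (intro continuous_intros assms | assumption)+)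

lemma mpoly_approx:
  fixes f :: "real ^ 'n \<Rightarrow> real"
  assumes K: "compact K" and f: "continuous_on K f" and e: "0 < e"
  shows "\<exists>p. \<forall>x\<in>K. \<bar>f x - mpoly_eval p x\<bar> < e"
proof -
  have ex: "\<exists>p. \<forall>x. mpoly_eval p x = g x" if "real_polynomial_function g" for g :: "real ^ 'n \<Rightarrow> real"
    using that
  proof induct
    case (linear g)
    then have lin: "Real_Vector_Spaces.linear g" by (rule bounded_linear.linear)
    have gx: "g x = (\<Sum>i\<in>UNIV. x $ i * g (axis i 1))" for x
    proof -
      have "g (\<Sum>i\<in>UNIV. x $ i *\<^sub>R axis i 1) = (\<Sum>i\<in>UNIV. x $ i * g (axis i 1))"
        unfolding linear_sum[OF lin] linear_scale[OF lin] real_scaleR_def ..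
      then show ?thesis unfolding basis_expansion[of x, unfolded scalar_mult_eq_scaleR] .
    qed
    have "mpoly_eval (\<Sum>i\<in>UNIV. mvar i * mconst (g (axis i 1))) x = g x" for x
      unfolding mpoly_eval_simps by (rule gx[symmetric])
    then show ?case by blast
  next
    case (const c) then show ?case by (intro exI[of _ "mconst c"]) (simp add: mpoly_eval_simps)
  next
    case (add g h)
    then obtain p q where "\<forall>x. mpoly_eval p x = g x" "\<forall>x. mpoly_eval q x = h x" by blast
    then show ?case by (intro exI[of _ "p + q"]) (simp add: mpoly_eval_simps)
  next
    case (mult g h)
    then obtain p q where "\<forall>x. mpoly_eval p x = g x" "\<forall>x. mpoly_eval q x = h x" by blast
    then show ?case by (intro exI[of _ "p * q"]) (simp add: mpoly_eval_simps)
  qed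
  obtain g where g: "real_polynomial_function g" "\<And>x. x \<in> K \<Longrightarrow> \<bar>f x - g x\<bar> < e"
    using Stone_Weierstrass_real_polynomial_function[OF K f e] by metis
  then show ?thesis using ex[OF g(1)] by metis
qed

lemma real_points_bound:
  assumes M: "quad_module M" "archimedean M"
  shows "\<exists>B\<ge>0. \<forall>x\<in>real_points M. \<bar>mpoly_eval p x\<bar> \<le> B"
proof -
  obtain r where r: "0 \<le> r" "mconst r + p \<in> M" "mconst r - p \<in> M"
    using M archimedean_iff_bounded[OF M(1)] unfolding bounded_elt_def by blast
  have "\<bar>mpoly_eval p x\<bar> \<le> r" if "x \<in> real_points M" for x
  proof -
    have "0 \<le> mpoly_eval (mconst r + p) x" "0 \<le> mpoly_eval (mconst r - p) x"
      using that r(2,3) unfolding real_points_def by blast+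
    then show ?thesis by (simp add: mpoly_eval_simps)
  qed
  then show ?thesis using r(1) by blast
qed

lemma norm_sq_vec: "(norm (x :: real ^ 'n))\<^sup>2 = (\<Sum>i\<in>UNIV. (x $ i)\<^sup>2)"
  unfolding power2_norm_eq_inner inner_vec_def by (simp add: power2_eq_square)

lemma compact_real_points:
  assumes M: "quad_module M" "archimedean M"
  shows "compact (real_points M)"
proof -
  obtain B where B: "\<forall>x\<in>real_points M. \<bar>mpoly_eval (\<Sum>i\<in>UNIV. (mvar i)\<^sup>2) x\<bar> \<le> B"
    using real_points_bound[OF M] by blast
  have "norm x \<le> sqrt B" if "x \<in> real_points M" for x
  proof -
    have "(norm x)\<^sup>2 \<le> B" using B that by (force simp: mpoly_eval_simps norm_sq_vec)
    then show ?thesis by (rule real_le_rsqrt)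
  qed
  then have "bounded (real_points M)" unfolding bounded_iff by blast
  moreover have "closed (real_points M)"
  proof -
    have "real_points M = (\<Inter>p\<in>M. {x. 0 \<le> mpoly_eval p x})" by (auto simp: real_points_def)
    then show ?thesis by (auto intro!: closed_Collect_le continuous_intros)
  qed
  ultimately show ?thesis by (simp add: compact_eq_bounded_closed)
qed

section \<open>Uniformly positive definite quadratic forms\<close>

lemma sum_sum_insert:
  fixes t :: "'i \<Rightarrow> 'i \<Rightarrow> 'a::comm_monoid_add"
  assumes "finite I" "j \<notin> I"
  shows "(\<Sum>k\<in>insert j I. \<Sum>l\<in>insert j I. t k l) = t j j + (\<Sum>l\<in>I. t j l) + (\<Sum>k\<in>I. t k j) + (\<Sum>k\<in>I. \<Sum>l\<in>I. t k l)"
  using assms by (simp add: sum.distrib add_ac)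

text \<open>Used in two ways: to complete a square, and with \<open>s\<close> and \<open>d\<close>
  of opposite sign to add a multiple of the form with matrix |y|^2 I - y y^T.\<close>

lemma form_minus_square:
  fixes a :: "'i \<Rightarrow> 'i \<Rightarrow> 'a::comm_ring_1"
  assumes "finite I"
  shows "(\<Sum>k\<in>I. \<Sum>l\<in>I. (a k l - s * \<beta> k * \<beta> l - (if k = l then d else 0)) * h k * h l) =
    (\<Sum>k\<in>I. \<Sum>l\<in>I. a k l * h k * h l) - s * (\<Sum>l\<in>I. \<beta> l * h l)\<^sup>2 - d * (\<Sum>l\<in>I. (h l)\<^sup>2)"
proof -
  have "(\<Sum>k\<in>I. \<Sum>l\<in>I. s * \<beta> k * \<beta> l * h k * h l) = s * (\<Sum>l\<in>I. \<beta> l * h l)\<^sup>2"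
    by (simp only: power2_eq_square sum_product, simp only: sum_distrib_left, simp only: ac_simps)
  moreover have "(\<Sum>k\<in>I. \<Sum>l\<in>I. (if k = l then d else 0) * h k * h l) = d * (\<Sum>l\<in>I. (h l)\<^sup>2)"
    using assms by (simp add: if_distrib[of "\<lambda>x. x * _"] sum_distrib_left power2_eq_square mult.assoc cong: if_cong)
  ultimately show ?thesis by (simp add: left_diff_distrib sum_subtractf)
qed

lemma sum_mult_bound:
  fixes c w :: "'i \<Rightarrow> real"
  assumes "\<And>l. l \<in> I \<Longrightarrow> \<bar>c l\<bar> \<le> B"
  shows "\<bar>\<Sum>l\<in>I. c l * w l\<bar> \<le> B * (\<Sum>l\<in>I. \<bar>w l\<bar>)"
proof -
  have "\<bar>\<Sum>l\<in>I. c l * w l\<bar> \<le> (\<Sum>l\<in>I. \<bar>c l * w l\<bar>)" by (rule sum_abs)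
  also have "\<dots> \<le> (\<Sum>l\<in>I. B * \<bar>w l\<bar>)"
    using assms by (intro sum_mono) (simp add: abs_mult mult_right_mono)
  finally show ?thesis by (simp add: sum_distrib_left)
qed

text \<open>Completing the square at an index \<open>j\<close>: the coefficients \<open>b\<^sub>l / a\<^sub>j\<^sub>j\<close> are replaced by polynomial
  approximations, and the small mixed terms \<open>2 r\<^sub>l h\<^sub>j h\<^sub>l\<close> that remain are absorbed through
  \<open>(\<delta> + r\<^sub>l) (h\<^sub>j + h\<^sub>l)\<^sup>2 + (\<delta> - r\<^sub>l) (h\<^sub>j - h\<^sub>l)\<^sup>2\<close>.\<close>

theorem uniformly_pd_form_mem:
  fixes a :: "'i \<Rightarrow> 'i \<Rightarrow> 'n::finite real_mpoly"
  assumes M: "quad_module M" "archimedean M" and "finite I" and "\<And>k l. a k l = a l k" and "0 < \<mu>"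
    and "\<And>x w. x \<in> real_points M \<Longrightarrow> \<mu> * (\<Sum>k\<in>I. (w k)\<^sup>2) \<le> (\<Sum>k\<in>I. \<Sum>l\<in>I. mpoly_eval (a k l) x * w k * w l)"
  shows "(\<Sum>k\<in>I. \<Sum>l\<in>I. a k l * h k * h l) \<in> M"
  using assms(3-6)
proof (induct I arbitrary: a \<mu> rule: finite_induct)
  case empty
  then show ?case by (simp add: quad_module_0[OF M(1)])
next
  case (insert j I)
  note fin = insert(1) and jI = insert(2) and IH = insert(3) and sym = insert(4) and \<mu> = insert(5) and pd = insert(6)
  let ?K = "real_points M"
  have ajj: "\<mu> \<le> mpoly_eval (a j j) x" if "x \<in> ?K" for x
  proof -
    define w :: "'i \<Rightarrow> real" where "w k = (if k = j then 1 else 0)" for k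
    have w: "w j = 1" "\<And>k. k \<in> I \<Longrightarrow> w k = 0" using jI by (auto simp: w_def)
    have "(\<Sum>k\<in>insert j I. (w k)\<^sup>2) = 1" using fin jI w by simp
    moreover have "(\<Sum>k\<in>insert j I. \<Sum>l\<in>insert j I. mpoly_eval (a k l) x * w k * w l) = mpoly_eval (a j j) x"
      unfolding sum_sum_insert[OF fin jI] using w by simp
    ultimately show ?thesis using pd[OF that, of w] by simp
  qed
  have "\<forall>l. \<exists>B\<ge>0. \<forall>x\<in>?K. \<bar>mpoly_eval (a j l) x\<bar> \<le> B" using real_points_bound[OF M] by blast
  then obtain Bl where Bl: "\<And>l. 0 \<le> Bl l" "\<And>l x. x \<in> ?K \<Longrightarrow> \<bar>mpoly_eval (a j l) x\<bar> \<le> Bl l" by metis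
  define b where "b = sum Bl I"
  have b0: "0 \<le> b" using Bl(1) by (simp add: b_def sum_nonneg)
  have b: "\<bar>mpoly_eval (a j l) x\<bar> \<le> b" if "x \<in> ?K" "l \<in> I" for x l
    using Bl(2)[OF that(1), of l] member_le_sum[of l I Bl] that(2) fin Bl(1) unfolding b_def by force
  define c where "c = real (card I)"
  \<comment> \<open>1/s is at most 2/\<mu> on the compact set and its approximation is off by at
    most 1, so \<open>L\<close> bounds every \<beta>.\<close>
  define L where "L = (2 / \<mu> + 1) * b"
  have cL: "0 \<le> c" "0 \<le> L" using \<mu> b0 by (auto simp: c_def L_def)
  \<comment> \<open>The summands pay, in this order, for the subtracted \<delta> on the diagonal,
    for \<epsilon> \<le> \<mu>/2, for the loss \<epsilon> u^2 and for the mixed term 2 u R; together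
    they cost half of \<mu>.\<close>
  define D where "D = 1 + c + c * c * L\<^sup>2 + 2 * L * c"
  have D: "1 \<le> D" using cL by (simp add: D_def)
  define \<delta> where "\<delta> = \<mu> / (2 * D)"
  have \<delta>: "0 < \<delta>" "\<delta> * D = \<mu> / 2" using \<mu> D by (auto simp: \<delta>_def)
  \<comment> \<open>Reserved from the pivot: absorbing the mixed terms costs one \<delta> times the
    square of \<open>h j\<close> for each index in \<open>I\<close>.\<close>
  define \<epsilon> where "\<epsilon> = \<delta> * c"
  have "\<delta> * c \<le> \<delta> * D" using \<delta>(1) cL by (intro mult_left_mono) (auto simp: D_def)
  then have \<epsilon>: "0 \<le> \<epsilon>" "\<epsilon> \<le> \<mu> / 2" using \<delta> cL by (auto simp: \<epsilon>_def)
  define s where "s = a j j - mconst \<epsilon>"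
  have s: "\<mu> / 2 \<le> mpoly_eval s x" if "x \<in> ?K" for x
    using ajj[OF that] \<epsilon>(2) by (simp add: s_def mpoly_eval_simps)
  have sM: "s \<in> M"
    by (rule archimedean_positivstellensatz[OF M]) (use s \<mu> in force)
  obtain S where S: "0 \<le> S" "\<And>x. x \<in> ?K \<Longrightarrow> \<bar>mpoly_eval s x\<bar> \<le> S" using real_points_bound[OF M] by blast
  \<comment> \<open>The error r l is at most S \<eta> b in absolute value, which has to stay below
    \<delta>; the bound 1 enters \<open>L\<close>.\<close>
  define \<eta> where "\<eta> = min 1 (\<delta> / (S * b + 1))"
  have Sb: "0 \<le> S * b" using S b0 by simp
  have \<eta>: "0 < \<eta>" "\<eta> \<le> 1" using \<delta> Sb by (auto simp: \<eta>_def)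
  have \<eta>2: "\<eta> * (S * b) < \<delta>"
  proof -
    have "\<eta> * (S * b) \<le> \<delta> / (S * b + 1) * (S * b)" using Sb by (intro mult_right_mono) (auto simp: \<eta>_def)
    also have "\<dots> < \<delta>" using \<delta> Sb by (simp add: field_simps)
    finally show ?thesis .
  qed
  have "continuous_on ?K (\<lambda>x. 1 / mpoly_eval s x)"
    using s \<mu> by (intro continuous_intros) force
  then obtain g where g: "\<And>x. x \<in> ?K \<Longrightarrow> \<bar>1 / mpoly_eval s x - mpoly_eval g x\<bar> < \<eta>"
    using mpoly_approx[OF compact_real_points[OF M] _ \<eta>(1)] by blast
  define \<beta> where "\<beta> l = g * a j l" for l
  define r where "r l = a j l - s * \<beta> l" for l
  have \<beta>b: "\<bar>mpoly_eval (\<beta> l) x\<bar> \<le> L" if "x \<in> ?K" "l \<in> I" for x l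
  proof -
    have "\<bar>1 / mpoly_eval s x\<bar> \<le> 2 / \<mu>"
      using s[OF that(1)] \<mu> by (simp add: field_simps)
    then have "\<bar>mpoly_eval g x\<bar> \<le> 2 / \<mu> + 1" using g[OF that(1)] \<eta>(2) by linarith
    then show ?thesis using b[OF that] \<mu> unfolding \<beta>_def L_def mpoly_eval_simps abs_mult
      by (intro mult_mono) auto
  qed
  have rb: "\<bar>mpoly_eval (r l) x\<bar> < \<delta>" if "x \<in> ?K" "l \<in> I" for x l
  proof -
    have s0: "mpoly_eval s x \<noteq> 0" using s[OF that(1)] \<mu> by auto
    have "mpoly_eval (r l) x = mpoly_eval s x * (1 / mpoly_eval s x - mpoly_eval g x) * mpoly_eval (a j l) x"
      using s0 by (simp add: r_def \<beta>_def mpoly_eval_simps field_simps)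
    then have "\<bar>mpoly_eval (r l) x\<bar> = \<bar>mpoly_eval s x\<bar> * \<bar>1 / mpoly_eval s x - mpoly_eval g x\<bar> * \<bar>mpoly_eval (a j l) x\<bar>"
      by (simp add: abs_mult)
    also have "\<dots> \<le> S * \<eta> * b"
      using S(2)[OF that(1)] g[OF that(1)] b[OF that] S(1) \<eta>(1) by (intro mult_mono) auto
    also have "\<dots> < \<delta>" using \<eta>2 by (simp add: ac_simps)
    finally show ?thesis .
  qed
  \<comment> \<open>The approximate Schur complement, less the \<delta> spent on the squares of the
    \<open>h l\<close> when the mixed terms are absorbed.\<close>
  define a' where "a' k l = a k l - s * \<beta> k * \<beta> l - (if k = l then mconst \<delta> else 0)" for k l
  have a'M: "(\<Sum>k\<in>I. \<Sum>l\<in>I. a' k l * h k * h l) \<in> M"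
  proof (rule IH)
    show "a' k l = a' l k" for k l using sym[of k l] by (simp add: a'_def mult.assoc mult.commute[of "\<beta> k"])
    show "0 < \<mu> / 2" using \<mu> by simp
    fix x and w :: "'i \<Rightarrow> real" assume x: "x \<in> ?K"
    define sv al where "sv = mpoly_eval s x" and "al = mpoly_eval (a j j) x"
    define bl be rv where "bl l = mpoly_eval (a j l) x" and "be l = mpoly_eval (\<beta> l) x" and "rv l = mpoly_eval (r l) x" for l
    define u R W A V where "u = (\<Sum>l\<in>I. be l * w l)" and "R = (\<Sum>l\<in>I. rv l * w l)" and "W = (\<Sum>l\<in>I. (w l)\<^sup>2)"
      and "A = (\<Sum>k\<in>I. \<Sum>l\<in>I. mpoly_eval (a k l) x * w k * w l)" and "V = (\<Sum>l\<in>I. \<bar>w l\<bar>)"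
    have sv: "al = sv + \<epsilon>" by (simp add: sv_def al_def s_def mpoly_eval_simps)
    have "bl l = sv * be l + rv l" for l by (simp add: bl_def sv_def be_def rv_def r_def mpoly_eval_simps)
    then have blw: "(\<Sum>l\<in>I. bl l * w l) = sv * u + R"
      by (simp add: u_def R_def distrib_right sum.distrib sum_distrib_left mult.assoc)
    have t: "(\<Sum>k\<in>I. \<Sum>l\<in>I. mpoly_eval (a' k l) x * w k * w l) = A - sv * u\<^sup>2 - \<delta> * W"
    proof -
      have "mpoly_eval (a' k l) x = mpoly_eval (a k l) x - sv * be k * be l - (if k = l then \<delta> else 0)" for k l
        by (simp add: a'_def sv_def be_def mpoly_eval_simps)
      then show ?thesis unfolding A_def u_def W_def using form_minus_square[OF fin] by simp
    qed
    \<comment> \<open>Choosing - u as the entry at \<open>j\<close> makes the completed square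
      vanish up to errors, so the bound on the full form becomes one on the Schur
      complement.\<close>
    define w' where "w' = w(j := - u)"
    have w': "w' j = - u" "\<And>k. k \<in> I \<Longrightarrow> w' k = w k" using jI by (auto simp: w'_def)
    have "\<mu> * (u\<^sup>2 + W) \<le> al * u\<^sup>2 - 2 * u * (sv * u + R) + A"
    proof -
      have "(\<Sum>k\<in>insert j I. (w' k)\<^sup>2) = u\<^sup>2 + W" using fin jI w' by (simp add: W_def)
      moreover have "(\<Sum>k\<in>insert j I. \<Sum>l\<in>insert j I. mpoly_eval (a k l) x * w' k * w' l)
          = al * u\<^sup>2 - 2 * u * (\<Sum>l\<in>I. bl l * w l) + A"
      proof -
        have 1: "(\<Sum>l\<in>I. mpoly_eval (a j l) x * w' j * w' l) = - (u * (\<Sum>l\<in>I. bl l * w l))"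
          by (simp add: w' bl_def sum_distrib_left sum_negf ac_simps)
        have 2: "(\<Sum>k\<in>I. mpoly_eval (a k j) x * w' k * w' j) = - (u * (\<Sum>l\<in>I. bl l * w l))"
          by (simp add: w' bl_def sum_distrib_left sum_negf ac_simps sym[of _ j])
        have 3: "(\<Sum>k\<in>I. \<Sum>l\<in>I. mpoly_eval (a k l) x * w' k * w' l) = A"
          by (simp add: w' A_def)
        show ?thesis
          unfolding sum_sum_insert[OF fin jI] 1 2 3 by (simp add: w' al_def power2_eq_square)
      qed
      ultimately show ?thesis using pd[OF x, of w'] by (simp add: blw)
    qed
    then have low: "\<mu> * W - \<epsilon> * u\<^sup>2 + 2 * (u * R) \<le> A - sv * u\<^sup>2"
    proof -
      assume h: "\<mu> * (u\<^sup>2 + W) \<le> al * u\<^sup>2 - 2 * u * (sv * u + R) + A"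
      have "0 \<le> \<mu> * u\<^sup>2" using \<mu> by simp
      moreover have "al * u\<^sup>2 - 2 * u * (sv * u + R) + A = A - sv * u\<^sup>2 + \<epsilon> * u\<^sup>2 - 2 * (u * R)"
        by (simp add: sv power2_eq_square algebra_simps)
      ultimately show ?thesis using h by (simp add: distrib_left)
    qed
    have V0: "0 \<le> V" by (simp add: V_def sum_nonneg)
    have VW: "V\<^sup>2 \<le> c * W"
      using Cauchy_Schwarz_ineq_sum[of "\<lambda>_. 1" "\<lambda>l. \<bar>w l\<bar>" I] by (simp add: V_def W_def c_def)
    have W0: "0 \<le> W" by (simp add: W_def sum_nonneg)
    have uV: "\<bar>u\<bar> \<le> L * V" unfolding u_def V_def using \<beta>b[OF x] by (intro sum_mult_bound) (simp add: be_def)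
    have RV: "\<bar>R\<bar> \<le> \<delta> * V" unfolding R_def V_def using rb[OF x] by (intro sum_mult_bound) (simp add: rv_def less_imp_le)
    have "u\<^sup>2 \<le> (L * V)\<^sup>2" using uV by (metis abs_ge_zero power2_abs power_mono)
    also have "\<dots> \<le> L\<^sup>2 * (c * W)" using VW by (simp add: power_mult_distrib mult_left_mono)
    finally have u2: "\<epsilon> * u\<^sup>2 \<le> \<delta> * (c * c * L\<^sup>2) * W"
      using mult_left_mono[OF _ \<epsilon>(1)] by (fastforce simp: \<epsilon>_def ac_simps)
    have "\<bar>u * R\<bar> \<le> (L * V) * (\<delta> * V)" unfolding abs_mult using uV RV cL V0 by (intro mult_mono) auto
    also have "\<dots> = (L * \<delta>) * V\<^sup>2" by (simp add: power2_eq_square)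
    also have "\<dots> \<le> (L * \<delta>) * (c * W)" using VW cL \<delta> by (intro mult_left_mono) auto
    finally have uR: "- (2 * (u * R)) \<le> \<delta> * (2 * L * c) * W" by (simp add: ac_simps)
    have DW: "\<delta> * (1 + c * c * L\<^sup>2 + 2 * L * c) * W \<le> (\<mu> / 2) * W"
    proof (rule mult_right_mono[OF _ W0])
      have "\<delta> * (1 + c * c * L\<^sup>2 + 2 * L * c) \<le> \<delta> * D" using \<delta> cL by (intro mult_left_mono) (auto simp: D_def)
      then show "\<delta> * (1 + c * c * L\<^sup>2 + 2 * L * c) \<le> \<mu> / 2" using \<delta> by simp
    qed
    have "\<mu> * W - (\<mu> / 2) * W \<le> A - sv * u\<^sup>2 - \<delta> * W"
      using low u2 uR DW by (simp add: algebra_simps)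
    then show "\<mu> / 2 * (\<Sum>k\<in>I. (w k)\<^sup>2) \<le> (\<Sum>k\<in>I. \<Sum>l\<in>I. mpoly_eval (a' k l) x * w k * w l)"
      unfolding t W_def[symmetric] by (simp add: mult.commute)
  qed
  have rM: "mconst \<delta> + r l \<in> M" "mconst \<delta> - r l \<in> M" if "l \<in> I" for l
  proof -
    have "- \<delta> < mpoly_eval (r l) x \<and> mpoly_eval (r l) x < \<delta>" if "x \<in> ?K" for x
      using rb[OF that \<open>l \<in> I\<close>] by linarith
    then show "mconst \<delta> + r l \<in> M" "mconst \<delta> - r l \<in> M"
      by (intro archimedean_positivstellensatz[OF M], fastforce simp: mpoly_eval_simps)+
  qed
  define Z where "Z l = (h j + h l)\<^sup>2 * (mconst \<delta> + r l) + (h j - h l)\<^sup>2 * (mconst \<delta> - r l)" for l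
  have XM: "(\<Sum>l\<in>I. mconst (1/2) * Z l) \<in> M"
  proof (rule quad_module_sum[OF M(1)])
    fix l assume "l \<in> I"
    then have "Z l \<in> M"
      unfolding Z_def using quad_module_add[OF M(1)] quad_module_sq_mult[OF M(1)] rM by blast
    then show "mconst (1/2) * Z l \<in> M" by (intro mconst_nonneg_mult[OF M(1)]) simp
  qed
  define U where "U = (\<Sum>l\<in>I. \<beta> l * h l)"
  have Z: "mconst (1/2) * Z l = mconst \<delta> * (h j)\<^sup>2 + mconst \<delta> * (h l)\<^sup>2 + 2 * h j * (r l * h l)" for l
  proof -
    have "Z l = mconst 2 * (mconst \<delta> * (h j)\<^sup>2 + mconst \<delta> * (h l)\<^sup>2 + 2 * h j * (r l * h l))"
      by (simp add: Z_def mconst_numeral power2_eq_square algebra_simps)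
    then have "mconst (1/2) * Z l = (mconst (1/2) * mconst 2) * (mconst \<delta> * (h j)\<^sup>2 + mconst \<delta> * (h l)\<^sup>2 + 2 * h j * (r l * h l))"
      by (simp only: mult.assoc)
    also have "mconst (1/2) * mconst 2 = (1 :: 'n real_mpoly)" unfolding mconst_simps(4)[symmetric] by (simp add: mconst_simps(2))
    finally show ?thesis by simp
  qed
  have "(\<Sum>l\<in>I. r l * h l) = (\<Sum>l\<in>I. a j l * h l) - s * U"
    by (simp add: r_def U_def left_diff_distrib sum_subtractf sum_distrib_left mult.assoc)
  then have rh: "(\<Sum>l\<in>I. 2 * h j * (r l * h l)) = 2 * h j * ((\<Sum>l\<in>I. a j l * h l) - s * U)"
    by (simp only: sum_distrib_left[symmetric])
  have SX: "(\<Sum>l\<in>I. mconst (1/2) * Z l) =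
      mconst \<epsilon> * (h j)\<^sup>2 + mconst \<delta> * (\<Sum>l\<in>I. (h l)\<^sup>2) + 2 * h j * ((\<Sum>l\<in>I. a j l * h l) - s * U)"
    unfolding Z sum.distrib rh unfolding sum_distrib_left[symmetric]
    by (simp add: \<epsilon>_def c_def mconst_simps(4,7) ac_simps)
  have a'h: "(\<Sum>k\<in>I. \<Sum>l\<in>I. a' k l * h k * h l) =
      (\<Sum>k\<in>I. \<Sum>l\<in>I. a k l * h k * h l) - s * U\<^sup>2 - mconst \<delta> * (\<Sum>l\<in>I. (h l)\<^sup>2)"
    unfolding a'_def U_def by (rule form_minus_square[OF fin])
  have jl: "(\<Sum>l\<in>I. a j l * h j * h l) = h j * (\<Sum>l\<in>I. a j l * h l)"
    by (simp add: sum_distrib_left ac_simps)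
  have kj: "(\<Sum>k\<in>I. a k j * h k * h j) = h j * (\<Sum>l\<in>I. a j l * h l)"
    by (simp add: sum_distrib_left ac_simps sym[of _ j])
  have "(\<Sum>k\<in>insert j I. \<Sum>l\<in>insert j I. a k l * h k * h l) =
      (h j + U)\<^sup>2 * s + (\<Sum>l\<in>I. mconst (1/2) * Z l) + (\<Sum>k\<in>I. \<Sum>l\<in>I. a' k l * h k * h l)"
    unfolding sum_sum_insert[OF fin jI] SX a'h jl kj
    by (simp add: s_def power2_eq_square algebra_simps)
  then show ?case
    using quad_module_add[OF M(1) quad_module_add[OF M(1) quad_module_sq_mult[OF M(1) sM] XM] a'M] by simp
qed


section \<open>Nondegenerate zeros\<close>

definition centred_var :: "real ^ 'n::finite \<Rightarrow> 'n \<Rightarrow> 'n real_mpoly" where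
  "centred_var p k = mvar k - mconst (p $ k)"

lemma mpoly_eval_centred_var: "mpoly_eval (centred_var p k) x = (x - p) $ k"
  by (simp add: centred_var_def mpoly_eval_simps)

text \<open>An exact global form of a zero of order two with positive definite Hessian: the
  coefficients are polynomials, and positivity is asked of their values at \<open>p\<close>
  only.\<close>

definition nondeg_zero :: "'n::finite real_mpoly \<Rightarrow> real ^ 'n \<Rightarrow> bool" where
  "nondeg_zero f p \<longleftrightarrow> (\<exists>B. (\<forall>k l. B k l = B l k) \<and>
     f = (\<Sum>k\<in>UNIV. \<Sum>l\<in>UNIV. B k l * centred_var p k * centred_var p l) \<and>
     (\<forall>w. w \<noteq> 0 \<longrightarrow> 0 < (\<Sum>k\<in>UNIV. \<Sum>l\<in>UNIV. mpoly_eval (B k l) p * w $ k * w $ l)))"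

abbreviation form :: "('n::finite \<Rightarrow> 'n \<Rightarrow> 'n real_mpoly) \<Rightarrow> real ^ 'n \<Rightarrow> real ^ 'n \<Rightarrow> real" where
  "form B x w \<equiv> \<Sum>k\<in>UNIV. \<Sum>l\<in>UNIV. mpoly_eval (B k l) x * w $ k * w $ l"

lemma mpoly_eval_form:
  "mpoly_eval (\<Sum>k\<in>UNIV. \<Sum>l\<in>UNIV. B k l * centred_var p k * centred_var p l) x = form B x (x - p)"
  by (simp add: mpoly_eval_simps mpoly_eval_centred_var)

lemma form_scale: "form B x (c *\<^sub>R w) = c\<^sup>2 * form B x w"
  unfolding sum_distrib_left by (simp add: power2_eq_square ac_simps)

lemma continuous_on_form: "continuous_on C (\<lambda>z :: (real ^ 'n::finite) \<times> (real ^ 'n). form B (fst z) (snd z))"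
  by (intro continuous_intros)

text \<open>Compactness of the sphere of directions spreads positive definiteness from
  \<open>p\<close> to nearby points: close to \<open>p\<close> the term N |x - p|^2 uses up at most
  half of \<mu>, and homogeneity reduces to unit vectors.\<close>

lemma nondeg_zero_lower_bound:
  assumes "nondeg_zero f p"
  shows "\<exists>\<nu>>0. \<exists>r>0. \<forall>x. dist x p < r \<longrightarrow> \<nu> * (norm (x - p))\<^sup>2 \<le> mpoly_eval f x"
proof -
  obtain B where B: "f = (\<Sum>k\<in>UNIV. \<Sum>l\<in>UNIV. B k l * centred_var p k * centred_var p l)"
    "\<And>w. w \<noteq> 0 \<Longrightarrow> 0 < form B p w"
    using assms unfolding nondeg_zero_def by blast
  let ?C = "cball p 1 \<times> sphere (0 :: real ^ 'a) 1"
  have "\<exists>N\<ge>0. \<exists>\<mu>>0. \<forall>z\<in>?C. \<mu> \<le> form B (fst z) (snd z) + N * (norm (fst z - p))\<^sup>2"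
  proof (rule compact_add_multiple_pos)
    show "compact ?C" by (intro compact_Times compact_cball compact_sphere)
    show "continuous_on ?C (\<lambda>z. form B (fst z) (snd z))" by (rule continuous_on_form)
    show "continuous_on ?C (\<lambda>z. (norm (fst z - p))\<^sup>2)" by (intro continuous_intros)
    show "0 < form B (fst z) (snd z)" if "z \<in> ?C" "(norm (fst z - p))\<^sup>2 = 0" for z
    proof -
      have "snd z \<noteq> 0" using that(1) by auto
      moreover have "fst z = p" using that(2) by simp
      ultimately show ?thesis using B(2)[of "snd z"] by simp
    qed
  qed simp
  then obtain N \<mu> where N: "0 \<le> N" "0 < \<mu>"
    and low: "\<And>x w. dist p x \<le> 1 \<Longrightarrow> norm w = 1 \<Longrightarrow> \<mu> \<le> form B x w + N * (norm (x - p))\<^sup>2"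
    by force
  define r where "r = min 1 (\<mu> / (2 * (N + 1)))"
  have r: "0 < r" using N by (simp add: r_def)
  have "\<mu> / 2 * (norm (x - p))\<^sup>2 \<le> mpoly_eval f x" if x: "dist x p < r" for x
  proof (cases "x = p")
    case True then show ?thesis by (simp add: B(1) mpoly_eval_form)
  next
    case False
    define n where "n = norm (x - p)"
    have n: "0 < n" "n < 1" "n < \<mu> / (2 * (N + 1))" using False x by (auto simp: n_def r_def dist_norm)
    define w where "w = inverse n *\<^sub>R (x - p)"
    have w: "norm w = 1" "x - p = n *\<^sub>R w" using n by (simp_all add: w_def flip: n_def)
    have "\<mu> \<le> form B x w + N * n\<^sup>2" using low[of x w] w(1) n(2) by (simp add: n_def dist_norm norm_minus_commute)
    moreover have "N * n\<^sup>2 \<le> \<mu> / 2"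
    proof -
      have "N * n\<^sup>2 \<le> N * n" using N n by (intro mult_left_mono) (auto simp: power2_eq_square mult_le_one)
      also have "\<dots> \<le> (N + 1) * n" using n by (intro mult_right_mono) auto
      also have "\<dots> \<le> \<mu> / 2" using n(3) N by (simp add: field_simps)
      finally show ?thesis .
    qed
    ultimately have "\<mu> / 2 \<le> form B x w" by simp
    moreover have "mpoly_eval f x = n\<^sup>2 * form B x w" unfolding B(1) mpoly_eval_form w(2) form_scale ..
    ultimately show ?thesis using mult_left_mono[of "\<mu> / 2" "form B x w" "n\<^sup>2"] unfolding n_def[symmetric]
      by (simp add: mult.commute)
  qed
  then show ?thesis using N r by (intro exI[of _ "\<mu> / 2"] conjI exI[of _ r]) auto
qed

text \<open>The quadratic form with matrix \<open>|y|\<^sup>2 I - y y\<^sup>T\<close> vanishes at \<open>y = x - p\<close>, so a multiple of it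
  can be added to make the matrix of \<open>f\<close> positive definite on the whole compact set.\<close>

theorem single_zero_mem:
  assumes M: "quad_module M" "archimedean M" and f: "nondeg_zero f p"
    and pos: "\<And>x. x \<in> real_points M \<Longrightarrow> x \<noteq> p \<Longrightarrow> 0 < mpoly_eval f x"
  shows "f \<in> M"
proof -
  obtain B where sym: "\<And>k l. B k l = B l k"
    and B: "f = (\<Sum>k\<in>UNIV. \<Sum>l\<in>UNIV. B k l * centred_var p k * centred_var p l)" "\<And>w. w \<noteq> 0 \<Longrightarrow> 0 < form B p w"
    using f unfolding nondeg_zero_def by blast
  let ?C = "real_points M \<times> sphere (0 :: real ^ 'a) 1"
  \<comment> \<open>The Cauchy-Schwarz defect of y = x - p and w. For a unit vector w it vanishes
    only if y = 0 or w is a multiple of y, and in the second case the form of \<open>f\<close> at w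
    is a positive multiple of f(x).\<close>
  define s where "s x w = (norm (x - p))\<^sup>2 * (norm w)\<^sup>2 - ((x - p) \<bullet> w)\<^sup>2" for x w :: "real ^ 'a"
  have s0: "0 \<le> s x w" for x w
    using Cauchy_Schwarz_ineq[of "x - p" w] by (simp add: s_def power2_norm_eq_inner)
  have "\<exists>N\<ge>0. \<exists>\<mu>>0. \<forall>z\<in>?C. \<mu> \<le> form B (fst z) (snd z) + N * s (fst z) (snd z)"
  proof (rule compact_add_multiple_pos)
    show "compact ?C" by (intro compact_Times compact_real_points[OF M] compact_sphere)
    show "continuous_on ?C (\<lambda>z. form B (fst z) (snd z))" by (rule continuous_on_form)
    show "continuous_on ?C (\<lambda>z. s (fst z) (snd z))" unfolding s_def by (intro continuous_intros)
    show "0 < form B (fst z) (snd z)" if z: "z \<in> ?C" "s (fst z) (snd z) = 0" for z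
    proof -
      obtain x w where xw: "z = (x, w)" "x \<in> real_points M" "norm w = 1" using z(1) by auto
      show ?thesis
      proof (cases "x = p")
        case True
        have "w \<noteq> 0" using xw(3) by auto
        then show ?thesis using B(2)[of w] xw(1) True by simp
      next
        case False
        define y where "y = x - p"
        have y: "y \<noteq> 0" using False by (simp add: y_def)
        define c where "c = (y \<bullet> w) / (norm y)\<^sup>2"
        have yw: "(y \<bullet> w)\<^sup>2 = (norm y)\<^sup>2" using z(2) xw by (simp add: s_def y_def)
        have "(norm (w - c *\<^sub>R y))\<^sup>2 = 1 - 2 * c * (y \<bullet> w) + c\<^sup>2 * (norm y)\<^sup>2"
          using xw(3) unfolding power2_norm_eq_inner
          by (simp add: inner_diff_left inner_diff_right inner_commute power2_eq_square norm_eq_1 algebra_simps)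
        also have "\<dots> = 0"
          using y yw by (simp add: c_def power_divide power2_eq_square field_simps)
        finally have w: "w = c *\<^sub>R y" by simp
        then have "c \<noteq> 0" using xw(3) by auto
        have "mpoly_eval f x = form B x y" unfolding B(1) mpoly_eval_form y_def ..
        then have "form B x w = c\<^sup>2 * mpoly_eval f x" unfolding w form_scale by simp
        then show ?thesis using pos[OF xw(2) False] \<open>c \<noteq> 0\<close> xw(1) by simp
      qed
    qed
  qed (rule s0)
  then obtain N \<mu> where N: "0 \<le> N" "0 < \<mu>"
    and low: "\<And>x w. x \<in> real_points M \<Longrightarrow> norm w = 1 \<Longrightarrow> \<mu> \<le> form B x w + N * s x w"
    by force
  define S where "S = (\<Sum>i\<in>UNIV. (centred_var p i)\<^sup>2)"
  \<comment> \<open>In \<open>form_minus_square\<close> this is s = N and d = - N S, so the two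
    corrections cancel at x - p and the represented polynomial is still \<open>f\<close>.\<close>
  define a where "a k l = B k l - mconst N * centred_var p k * centred_var p l - (if k = l then mconst (- N) * S else 0)" for k l
  have Sx: "mpoly_eval S x = (norm (x - p))\<^sup>2" for x
    by (simp add: S_def mpoly_eval_simps mpoly_eval_centred_var norm_sq_vec)
  have fa: "form a x w = form B x w + N * s x w" for x w
  proof -
    have e: "mpoly_eval (a k l) x = mpoly_eval (B k l) x - N * (x - p) $ k * (x - p) $ l
        - (if k = l then - N * (norm (x - p))\<^sup>2 else 0)" for k l
      by (simp add: a_def mpoly_eval_simps mpoly_eval_centred_var Sx)
    have i: "(x - p) \<bullet> w = (\<Sum>l\<in>UNIV. (x - p) $ l * w $ l)" by (simp add: inner_vec_def)
    show ?thesis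
      unfolding e form_minus_square[OF finite] s_def norm_sq_vec[of w] i by (simp add: algebra_simps)
  qed
  have "(\<Sum>k\<in>UNIV. \<Sum>l\<in>UNIV. a k l * centred_var p k * centred_var p l) \<in> M"
  proof (rule uniformly_pd_form_mem[OF M finite _ N(2)])
    show "a k l = a l k" for k l using sym[of k l] by (simp add: a_def mult.assoc mult.commute[of "centred_var p k"])
    fix x and w :: "'a \<Rightarrow> real" assume x: "x \<in> real_points M"
    define v where "v = (\<chi> i. w i)"
    have "\<mu> * (norm v)\<^sup>2 \<le> form a x v"
    proof (cases "v = 0")
      case False
      define u where "u = inverse (norm v) *\<^sub>R v"
      have u: "norm u = 1" "v = norm v *\<^sub>R u" using False by (simp_all add: u_def)
      have "\<mu> \<le> form a x u" unfolding fa by (rule low[OF x u(1)])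
      then have "(norm v)\<^sup>2 * \<mu> \<le> (norm v)\<^sup>2 * form a x u" by (intro mult_left_mono) auto
      also have "\<dots> = form a x v" using form_scale[of a x "norm v" u] u(2) by simp
      finally show ?thesis by (simp add: mult.commute)
    qed simp
    then show "\<mu> * (\<Sum>k\<in>UNIV. (w k)\<^sup>2) \<le> (\<Sum>k\<in>UNIV. \<Sum>l\<in>UNIV. mpoly_eval (a k l) x * w k * w l)"
      by (simp add: norm_sq_vec v_def)
  qed
  moreover have "(\<Sum>k\<in>UNIV. \<Sum>l\<in>UNIV. a k l * centred_var p k * centred_var p l) = f"
  proof -
    have "(\<Sum>l\<in>UNIV. centred_var p l * centred_var p l) = S" by (simp add: S_def power2_eq_square)
    then show ?thesis
      unfolding a_def form_minus_square[OF finite] B(1) S_def[symmetric]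
      by (simp add: mconst_simps power2_eq_square algebra_simps)
  qed
  ultimately show ?thesis by simp
qed

text \<open>The growth \<open>exp (t \<Sum> 1/s)\<close> of the product is beaten by the factor \<open>(1 - t/A)\<^sup>k \<le> exp (- k t/A)\<close>.\<close>

lemma peaked_polynomial:
  fixes P :: "real set"
  assumes P: "finite P" "\<And>s. s \<in> P \<Longrightarrow> 0 < s" and A: "0 < A"
  shows "\<exists>k. \<forall>t. 0 < t \<longrightarrow> t \<le> A \<longrightarrow> \<bar>(1 - t / A) ^ k * (\<Prod>s\<in>P. 1 - t / s)\<bar> < 1"
proof -
  define b where "b = (\<Sum>s\<in>P. 1 / s)"
  obtain k :: nat where k: "A * b < real k" using reals_Archimedean2 by blast
  have "\<bar>(1 - t / A) ^ k * (\<Prod>s\<in>P. 1 - t / s)\<bar> < 1" if t: "0 < t" "t \<le> A" for t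
  proof -
    have "\<bar>\<Prod>s\<in>P. 1 - t / s\<bar> \<le> (\<Prod>s\<in>P. exp (t / s))"
      unfolding abs_prod
    proof (rule prod_mono)
      fix s assume "s \<in> P"
      then have "0 < t / s" using P(2) t(1) by simp
      moreover have "1 + t / s \<le> exp (t / s)" by (rule exp_ge_add_one_self)
      ultimately have "\<bar>1 - t / s\<bar> \<le> exp (t / s)" unfolding abs_le_iff by linarith
      then show "0 \<le> \<bar>1 - t / s\<bar> \<and> \<bar>1 - t / s\<bar> \<le> exp (t / s)" by simp
    qed
    also have "\<dots> = exp (t * b)" by (simp add: exp_sum P(1) b_def sum_distrib_left)
    finally have 1: "\<bar>\<Prod>s\<in>P. 1 - t / s\<bar> \<le> exp (t * b)" .
    have "0 \<le> 1 - t / A" "1 - t / A \<le> exp (- (t / A))"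
      using t A exp_ge_add_one_self[of "- (t / A)"] by (auto simp: field_simps)
    then have "\<bar>1 - t / A\<bar> ^ k \<le> exp (- (t / A)) ^ k" by (intro power_mono) auto
    then have 2: "\<bar>1 - t / A\<bar> ^ k \<le> exp (- (t * real k / A))" by (simp flip: exp_of_nat_mult add: mult.commute)
    have "\<bar>(1 - t / A) ^ k * (\<Prod>s\<in>P. 1 - t / s)\<bar> \<le> exp (- (t * real k / A)) * exp (t * b)"
      unfolding abs_mult power_abs using 1 2 by (intro mult_mono) auto
    also have "\<dots> = exp (t * (b - real k / A))" by (simp add: right_diff_distrib flip: exp_add)
    also have "\<dots> < 1" using k A t by (simp add: mult_pos_neg field_simps)
    finally show ?thesis .
  qed
  then show ?thesis by blast
qed


section \<open>Several zeros\<close>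

lemma mult_expand: "a * b = A * C + ((a - A) * b + A * (b - C))" for a :: "'a::comm_ring_1"
  by (simp add: algebra_simps)

text \<open>Hadamard's lemma for polynomials, by induction on their construction; products are
  combined through \<open>mult_expand\<close>.\<close>

lemma expand_at_point:
  fixes p :: "'n::finite real_mpoly"
  shows "\<exists>E. p = mconst (mpoly_eval p q) + (\<Sum>k\<in>UNIV. E k * centred_var q k)"
proof (induct p rule: mpoly_induct)
  case (const c)
  show ?case by (rule exI[of _ "\<lambda>_. 0"]) (simp add: mpoly_eval_simps)
next
  case (var i)
  have "(\<Sum>k\<in>UNIV. (if k = i then 1 else 0) * centred_var q k) = centred_var q i"
    by (simp add: if_distrib[of "\<lambda>x. x * _"] cong: if_cong)
  then show ?case
    by (intro exI[of _ "\<lambda>k. if k = i then 1 else 0"]) (simp add: mpoly_eval_simps centred_var_def)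
next
  case (add a b)
  then obtain E F where E: "a = mconst (mpoly_eval a q) + (\<Sum>k\<in>UNIV. E k * centred_var q k)"
    and F: "b = mconst (mpoly_eval b q) + (\<Sum>k\<in>UNIV. F k * centred_var q k)" by blast
  have "a + b = mconst (mpoly_eval (a + b) q) + (\<Sum>k\<in>UNIV. (E k + F k) * centred_var q k)"
    by (subst E, subst F) (simp add: mpoly_eval_simps mconst_simps sum.distrib distrib_right)
  then show ?case by (intro exI[of _ "\<lambda>k. E k + F k"])
next
  case (mult a b)
  then obtain E F where E: "a = mconst (mpoly_eval a q) + (\<Sum>k\<in>UNIV. E k * centred_var q k)"
    and F: "b = mconst (mpoly_eval b q) + (\<Sum>k\<in>UNIV. F k * centred_var q k)" by blast
  define A C :: "'n real_mpoly" where "A = mconst (mpoly_eval a q)" and "C = mconst (mpoly_eval b q)"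
  have "(\<Sum>k\<in>UNIV. (E k * b + A * F k) * centred_var q k)
      = (\<Sum>k\<in>UNIV. E k * centred_var q k) * b + A * (\<Sum>k\<in>UNIV. F k * centred_var q k)"
    by (simp add: sum.distrib distrib_right sum_distrib_left sum_distrib_right mult.assoc mult.left_commute mult.commute[of _ b])
  also have "(\<Sum>k\<in>UNIV. E k * centred_var q k) = a - A"
    unfolding A_def by (rule add_implies_diff, subst add.commute) (rule E[symmetric])
  also have "(\<Sum>k\<in>UNIV. F k * centred_var q k) = b - C"
    unfolding C_def by (rule add_implies_diff, subst add.commute) (rule F[symmetric])
  finally have S: "(\<Sum>k\<in>UNIV. (E k * b + A * F k) * centred_var q k) = (a - A) * b + A * (b - C)" .
  have ab: "mconst (mpoly_eval (a * b) q) = A * C" unfolding mpoly_eval_simps mconst_simps A_def C_def ..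
  have "a * b = mconst (mpoly_eval (a * b) q) + (\<Sum>k\<in>UNIV. (E k * b + A * F k) * centred_var q k)"
    unfolding S ab by (rule mult_expand)
  then show ?case by (intro exI[of _ "\<lambda>k. E k * b + A * F k"])
qed

lemma expand_at_zero:
  assumes "mpoly_eval p q = 0"
  obtains E where "p = (\<Sum>k\<in>UNIV. E k * centred_var q k)"
  using expand_at_point[of p q] assms by (auto simp: mconst_simps)

lemma nondeg_zero_eval:
  assumes "nondeg_zero f p" shows "mpoly_eval f p = 0"
proof -
  obtain B where "f = (\<Sum>k\<in>UNIV. \<Sum>l\<in>UNIV. B k l * centred_var p k * centred_var p l)"
    using assms unfolding nondeg_zero_def by blast
  then show ?thesis using mpoly_eval_form[of B p p] by simp
qed

text \<open>With e written as a combination of the \<open>centred_var q k\<close>, e^2 h is a form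
  with matrix entries E k E l h, which vanish at q together with h; at q the matrix of f is merely
  scaled by w.\<close>

lemma nondeg_zero_perturb:
  assumes "nondeg_zero f q" and w: "0 < mpoly_eval w q" and e: "mpoly_eval e q = 0" and h: "mpoly_eval h q = 0"
  shows "nondeg_zero (f * w + e\<^sup>2 * h) q"
proof -
  obtain B where sym: "\<And>k l. B k l = B l k"
    and B: "f = (\<Sum>k\<in>UNIV. \<Sum>l\<in>UNIV. B k l * centred_var q k * centred_var q l)" "\<And>w. w \<noteq> 0 \<Longrightarrow> 0 < form B q w"
    using assms(1) unfolding nondeg_zero_def by blast
  obtain E where E: "e = (\<Sum>k\<in>UNIV. E k * centred_var q k)" using expand_at_zero[OF e] .
  let ?B = "\<lambda>k l. B k l * w + E k * E l * h"
  have "f * w = (\<Sum>k\<in>UNIV. \<Sum>l\<in>UNIV. B k l * w * centred_var q k * centred_var q l)"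
    unfolding B(1) by (simp add: sum_distrib_left sum_distrib_right ac_simps)
  moreover have "e\<^sup>2 * h = (\<Sum>k\<in>UNIV. \<Sum>l\<in>UNIV. E k * E l * h * centred_var q k * centred_var q l)"
    unfolding E power2_eq_square sum_product by (simp add: sum_distrib_left sum_distrib_right ac_simps)
  ultimately have "f * w + e\<^sup>2 * h = (\<Sum>k\<in>UNIV. \<Sum>l\<in>UNIV. ?B k l * centred_var q k * centred_var q l)"
    by (simp add: sum.distrib distrib_right)
  moreover have "form ?B q v = mpoly_eval w q * form B q v" for v
    by (simp add: mpoly_eval_simps h sum_distrib_left ac_simps)
  then have "0 < form ?B q v" if "v \<noteq> 0" for v using w B(2)[OF that] by simp
  moreover have "?B k l = ?B l k" for k l using sym[of k l] by (simp add: mult.commute)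
  ultimately show ?thesis unfolding nondeg_zero_def by (intro exI[of _ ?B]) auto
qed

section \<open>Bounds and peaked polynomials on a compact set\<close>

lemma compact_mpoly_bound:
  assumes "compact (K :: (real ^ 'n::finite) set)"
  obtains A where "0 < A" "\<And>x. x \<in> K \<Longrightarrow> \<bar>mpoly_eval p x\<bar> \<le> A"
proof -
  have "continuous_on K (mpoly_eval p)" using continuous_on_mpoly_eval[OF continuous_on_id, of K p] by simp
  then have "bounded (mpoly_eval p ` K)" using assms compact_continuous_image compact_imp_bounded by blast
  then show ?thesis using that unfolding bounded_pos by auto
qed

lemma mpoly_lipschitz_at_zero:
  assumes K: "compact K" and e: "mpoly_eval e q = 0"
  shows "\<exists>L>0. \<forall>x\<in>K. (mpoly_eval e x)\<^sup>2 \<le> L * (norm (x - q))\<^sup>2"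
proof -
  obtain E where E: "e = (\<Sum>k\<in>UNIV. E k * centred_var q k)" using expand_at_zero[OF e] .
  obtain L where L: "0 < L" "\<And>x. x \<in> K \<Longrightarrow> \<bar>mpoly_eval (\<Sum>k\<in>UNIV. (E k)\<^sup>2) x\<bar> \<le> L"
    using compact_mpoly_bound[OF K] by blast
  have "(mpoly_eval e x)\<^sup>2 \<le> L * (norm (x - q))\<^sup>2" if x: "x \<in> K" for x
  proof -
    define v where "v = (\<chi> k. mpoly_eval (E k) x)"
    have "mpoly_eval e x = v \<bullet> (x - q)"
      unfolding E by (simp add: v_def inner_vec_def mpoly_eval_simps mpoly_eval_centred_var)
    then have "(mpoly_eval e x)\<^sup>2 \<le> (norm v)\<^sup>2 * (norm (x - q))\<^sup>2"
      using Cauchy_Schwarz_ineq[of v "x - q"] by (simp add: power2_norm_eq_inner)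
    also have "(norm v)\<^sup>2 \<le> L" using L(2)[OF x] by (simp add: norm_sq_vec v_def mpoly_eval_simps)
    finally show ?thesis by (simp add: mult_right_mono)
  qed
  then show ?thesis using L(1) by blast
qed

text \<open>Factors congruent to 1 modulo s have a product congruent to 1; this is how 1 - e^4
  becomes divisible by s.\<close>

lemma prod_one_minus_multiple:
  fixes s :: "'a::comm_ring_1"
  assumes "\<And>i. i \<in> I \<Longrightarrow> \<exists>v. h i = 1 - s * v"
  shows "\<exists>v. prod h I = 1 - s * v"
  using assms
proof (induct I rule: infinite_finite_induct)
  case (insert i I)
  then obtain v w where "h i = 1 - s * v" "prod h I = 1 - s * w" by blast
  then have "prod h (insert i I) = 1 - s * (v + w - s * v * w)" unfolding prod.insert[OF insert(1,2)] by (simp only:) (simp add: algebra_simps)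
  then show ?case by blast
qed (auto intro: exI[of _ 0])

text \<open>\<open>e\<close> is a polynomial in s with constant term 1: the factors 1 - s/\<sigma>
  for the values \<sigma> of s on \<open>Z\<close> create the zeros, and a high power of 1 - s/A
  keeps |e| below 1 on the rest of \<open>K\<close>.\<close>

lemma peaked_at_point:
  fixes p :: "real ^ 'n::finite"
  assumes K: "compact K" and Z: "finite Z" "p \<notin> Z"
    and s: "\<And>x. x \<noteq> p \<Longrightarrow> 0 < mpoly_eval s x"
  obtains e w where "1 - e ^ 4 = s * w" "\<And>q. q \<in> Z \<Longrightarrow> mpoly_eval e q = 0"
    "\<And>x. x \<in> K \<Longrightarrow> x \<noteq> p \<Longrightarrow> \<bar>mpoly_eval e x\<bar> < 1 \<and> 0 < mpoly_eval w x"
proof -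
  obtain A where A: "0 < A" "\<And>x. x \<in> K \<Longrightarrow> \<bar>mpoly_eval s x\<bar> \<le> A" using compact_mpoly_bound[OF K] by blast
  define P where "P = mpoly_eval s ` Z"
  have sZ: "0 < mpoly_eval s q" if "q \<in> Z" for q using that Z(2) by (intro s) auto
  have P: "finite P" "\<And>t. t \<in> P \<Longrightarrow> 0 < t" using Z(1) sZ by (auto simp: P_def)
  obtain k where k: "\<And>t. 0 < t \<Longrightarrow> t \<le> A \<Longrightarrow> \<bar>(1 - t / A) ^ k * (\<Prod>\<sigma>\<in>P. 1 - t / \<sigma>)\<bar> < 1"
    using peaked_polynomial[OF P A(1)] by blast
  define e where "e = (\<Prod>i<k. 1 - s * mconst (1 / A)) * (\<Prod>\<sigma>\<in>P. 1 - s * mconst (1 / \<sigma>))"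
  have ex: "mpoly_eval e x = (1 - mpoly_eval s x / A) ^ k * (\<Prod>\<sigma>\<in>P. 1 - mpoly_eval s x / \<sigma>)" for x
    by (simp add: e_def mpoly_eval_simps)
  have "\<exists>v. (\<Prod>i<k. 1 - s * mconst (1 / A)) = 1 - s * v" "\<exists>v. (\<Prod>\<sigma>\<in>P. 1 - s * mconst (1 / \<sigma>)) = 1 - s * v"
    by (rule prod_one_minus_multiple; blast)+
  then obtain u v where uv: "(\<Prod>i<k. 1 - s * mconst (1 / A)) = 1 - s * u"
    "(\<Prod>\<sigma>\<in>P. 1 - s * mconst (1 / \<sigma>)) = 1 - s * v" by blast
  have "e = 1 - s * (u + v - s * u * v)" unfolding e_def uv by (simp add: algebra_simps)
  then have "1 - e = s * (u + v - s * u * v)" by simp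
  moreover have "1 - e ^ 4 = (1 - e) * (1 + e + e\<^sup>2 + e ^ 3)" by (simp add: algebra_simps power_numeral_reduce)
  ultimately have "1 - e ^ 4 = s * ((u + v - s * u * v) * (1 + e + e\<^sup>2 + e ^ 3))" by (simp add: mult.assoc)
  then obtain w where w: "1 - e ^ 4 = s * w" by blast
  have "mpoly_eval e q = 0" if "q \<in> Z" for q
  proof -
    have "(\<Prod>\<sigma>\<in>P. 1 - mpoly_eval s q / \<sigma>) = 0"
      by (rule prod_zero[OF P(1)]) (use that sZ[OF that] in \<open>auto simp: P_def intro!: bexI[of _ q]\<close>)
    then show ?thesis by (simp add: ex)
  qed
  moreover have "\<bar>mpoly_eval e x\<bar> < 1 \<and> 0 < mpoly_eval w x" if x: "x \<in> K" "x \<noteq> p" for x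
  proof -
    have "mpoly_eval s x \<le> A" using A(2)[OF x(1)] by simp
    then have 1: "\<bar>mpoly_eval e x\<bar> < 1" unfolding ex by (rule k[OF s[OF x(2)]])
    then have "\<bar>mpoly_eval e x\<bar> ^ 4 < 1" using power_strict_mono[of "\<bar>mpoly_eval e x\<bar>" 1 4] by simp
    moreover have "1 - mpoly_eval e x ^ 4 = mpoly_eval s x * mpoly_eval w x"
      using arg_cong[OF w, of "\<lambda>g. mpoly_eval g x"] by (simp add: mpoly_eval_simps)
    ultimately have "0 < mpoly_eval s x * mpoly_eval w x" by (simp add: power_abs)
    then show ?thesis using 1 s[OF x(2)] by (simp add: zero_less_mult_iff)
  qed
  ultimately show ?thesis using that[OF w] by blast
qed


text \<open>To remove the zero \<open>p\<close>, take \<open>s = |x - p|\<^sup>8\<close>, \<open>t = C s - 1\<close> and \<open>1 - e\<^sup>4 = s w\<close>, where \<open>e\<close> vanishes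
  at the other zeros and \<open>t\<close> is positive there. Then \<open>f = e\<^sup>4 F + s c\<close> for \<open>F = f + \<delta> s t\<close> and
  \<open>c = f w - \<delta> e\<^sup>4 t\<close>. For small \<open>\<delta>\<close> the only zero of \<open>F\<close> is \<open>p\<close>, while \<open>c\<close> vanishes at the other
  zeros only, and the added terms have order at least four, so both remain nondegenerate.\<close>

theorem finitely_many_nondeg_zeros_mem:
  fixes f :: "'n::finite real_mpoly"
  assumes M: "quad_module M" "archimedean M" and "finite Z"
    and "\<And>x. x \<in> real_points M \<Longrightarrow> 0 \<le> mpoly_eval f x"
    and "\<And>x. x \<in> real_points M \<Longrightarrow> mpoly_eval f x = 0 \<Longrightarrow> x \<in> Z"
    and "\<And>p. p \<in> Z \<Longrightarrow> nondeg_zero f p"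
  shows "f \<in> M"
  using assms(3-6)
proof (induct Z arbitrary: f rule: finite_induct)
  case empty
  then show ?case by (intro archimedean_positivstellensatz[OF M]) (metis empty_iff order_le_less)
next
  case (insert p Z)
  note fin = insert(1) and pZ = insert(2) and IH = insert(3) and nn = insert(4) and zeros = insert(5) and nd = insert(6)
  let ?K = "real_points M"
  have K: "compact ?K" by (rule compact_real_points[OF M])
  define S where "S = (\<Sum>i\<in>UNIV. (centred_var p i)\<^sup>2)"
  have Sx: "mpoly_eval S x = (norm (x - p))\<^sup>2" for x
    by (simp add: S_def mpoly_eval_simps mpoly_eval_centred_var norm_sq_vec)
  \<comment> \<open>A square, hence an admissible multiplier; its two factors
    \<open>S\<^sup>2\<close> also bring the correction into the shape of
    \<open>nondeg_zero_perturb\<close>, with \<open>S\<close> as \<open>e\<close> and the rest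
    vanishing at \<open>p\<close>.\<close>
  define s where "s = (S\<^sup>2)\<^sup>2"
  have s_pos: "0 < mpoly_eval s x" if "x \<noteq> p" for x using that by (simp add: s_def mpoly_eval_simps Sx)
  have s_p: "mpoly_eval s p = 0" by (simp add: s_def mpoly_eval_simps Sx)
  obtain e w where ew: "1 - e ^ 4 = s * w" and eZ: "\<And>q. q \<in> Z \<Longrightarrow> mpoly_eval e q = 0"
    and e1w: "\<And>x. x \<in> ?K \<Longrightarrow> x \<noteq> p \<Longrightarrow> \<bar>mpoly_eval e x\<bar> < 1 \<and> 0 < mpoly_eval w x"
    using peaked_at_point[OF K fin pZ s_pos] by blast
  have e_eq: "mpoly_eval e x ^ 4 = 1 - mpoly_eval s x * mpoly_eval w x" for x
    using arg_cong[OF ew, of "\<lambda>h. mpoly_eval h x"] by (simp add: mpoly_eval_simps)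
  \<comment> \<open>With this constant, t = C s - 1 is -1 at \<open>p\<close> and positive on
    \<open>Z\<close>.\<close>
  obtain C where C: "0 < C" "\<And>q. q \<in> Z \<Longrightarrow> 1 < C * mpoly_eval s q"
  proof -
    have sZ: "0 < mpoly_eval s q" if "q \<in> Z" for q using that pZ by (intro s_pos) auto
    define C where "C = 1 + (\<Sum>q\<in>Z. 1 / mpoly_eval s q)"
    have "1 / mpoly_eval s q < C" if "q \<in> Z" for q
      using member_le_sum[of q Z "\<lambda>q. 1 / mpoly_eval s q"] that fin sZ unfolding C_def
      by (force intro: less_imp_le)
    then have "1 < C * mpoly_eval s q" if "q \<in> Z" for q using that sZ[OF that] by (simp add: divide_less_eq)
    moreover have "0 < C" unfolding C_def
      by (intro add_pos_nonneg sum_nonneg) (auto intro: less_imp_le[OF sZ])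
    ultimately show ?thesis using that by blast
  qed
  define t where "t = mconst C * s - 1"
  have tx: "mpoly_eval t x = C * mpoly_eval s x - 1" for x by (simp add: t_def mpoly_eval_simps)
  have tZ: "0 < mpoly_eval t q" if "q \<in> Z" for q using C(2)[OF that] by (simp add: tx)
  have cont: "continuous_on A (mpoly_eval h)" for A h using continuous_on_mpoly_eval[OF continuous_on_id, of A h] by simp
  have zero_in: "x = p \<or> x \<in> Z" if "x \<in> ?K" "mpoly_eval f x = 0" for x using zeros[OF that] by simp

  let ?N = "{x \<in> ?K. mpoly_eval t x \<le> 0}" and ?D = "{x \<in> ?K. 0 \<le> mpoly_eval t x}"
  have cN: "compact ?N" and cD: "compact ?D"
    using compact_Int_closed[OF K closed_Collect_le[OF cont continuous_on_const[of UNIV 0]], of t]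
      compact_Int_closed[OF K closed_Collect_le[OF continuous_on_const[of UNIV 0] cont], of t]
    by (simp_all add: Int_def)
  \<comment> \<open>Where t \<le> 0 the only zero of \<open>f\<close> can be \<open>p\<close>, and
    near it \<open>f\<close> is at least a multiple of |x - p|^2, which dominates s = |x -
    p|^8.\<close>
  have "\<exists>\<kappa>>0. \<forall>x\<in>?N. \<kappa> * mpoly_eval s x \<le> mpoly_eval f x"
  proof (rule compact_local_domination[OF cN cont cont])
    fix z assume z: "z \<in> ?N"
    show "0 \<le> mpoly_eval s z" using s_pos[of z] s_p by fastforce
    show "0 < mpoly_eval f z \<or> (\<exists>\<kappa>>0. \<exists>r>0. \<forall>y\<in>?N. dist y z < r \<longrightarrow> \<kappa> * mpoly_eval s y \<le> mpoly_eval f y)"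
    proof (cases "z = p")
      case True
      obtain \<nu> r where \<nu>: "0 < \<nu>" "0 < r" "\<And>x. dist x p < r \<Longrightarrow> \<nu> * (norm (x - p))\<^sup>2 \<le> mpoly_eval f x"
        using nondeg_zero_lower_bound[OF nd[OF insertI1]] by blast
      have "\<nu> * mpoly_eval s y \<le> mpoly_eval f y" if y: "dist y z < min r 1" for y
      proof -
        have "norm (y - p) < 1" using y True by (simp add: dist_norm)
        then have "norm (y - p) ^ 8 \<le> (norm (y - p))\<^sup>2" by (intro power_decreasing) auto
        then have "\<nu> * mpoly_eval s y \<le> \<nu> * (norm (y - p))\<^sup>2"
          using \<nu>(1) by (simp add: s_def mpoly_eval_simps Sx flip: power_mult)
        also have "\<dots> \<le> mpoly_eval f y" using y True by (intro \<nu>(3)) auto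
        finally show ?thesis .
      qed
      then show ?thesis using \<nu>(1,2) by (intro disjI2 exI[of _ \<nu>] conjI exI[of _ "min r 1"]) auto
    next
      case False
      then have "mpoly_eval f z \<noteq> 0" using zero_in[of z] z tZ[of z] by force
      then show ?thesis using nn[of z] z by simp
    qed
  qed
  then obtain \<kappa>1 where \<kappa>1: "0 < \<kappa>1" "\<And>x. x \<in> ?K \<Longrightarrow> mpoly_eval t x \<le> 0 \<Longrightarrow> \<kappa>1 * mpoly_eval s x \<le> mpoly_eval f x"
    by blast
  have D_ne: "x \<noteq> p" if "0 \<le> mpoly_eval t x" for x using that s_p by (auto simp: tx)
  \<comment> \<open>Where t \<ge> 0 the zeros of \<open>f\<close> are in \<open>Z\<close>; there
    \<open>e\<close> vanishes, so its square is at most of the quadratic order that bounds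
    \<open>f\<close> from below.\<close>
  have "\<exists>\<kappa>>0. \<forall>x\<in>?D. \<kappa> * (mpoly_eval e x)\<^sup>2 \<le> mpoly_eval f x"
  proof (rule compact_local_domination[OF cD cont])
    show "continuous_on ?D (\<lambda>x. (mpoly_eval e x)\<^sup>2)" by (intro continuous_on_power cont)
    fix z assume z: "z \<in> ?D"
    show "0 < mpoly_eval f z \<or> (\<exists>\<kappa>>0. \<exists>r>0. \<forall>y\<in>?D. dist y z < r \<longrightarrow> \<kappa> * (mpoly_eval e y)\<^sup>2 \<le> mpoly_eval f y)"
    proof (cases "z \<in> Z")
      case True
      obtain \<nu> r where \<nu>: "0 < \<nu>" "0 < r" "\<And>x. dist x z < r \<Longrightarrow> \<nu> * (norm (x - z))\<^sup>2 \<le> mpoly_eval f x"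
        using nondeg_zero_lower_bound[OF nd[OF insertI2[OF True]]] by blast
      obtain L where L: "0 < L" "\<And>x. x \<in> ?K \<Longrightarrow> (mpoly_eval e x)\<^sup>2 \<le> L * (norm (x - z))\<^sup>2"
        using mpoly_lipschitz_at_zero[OF K eZ[OF True]] by blast
      have "\<nu> / L * (mpoly_eval e y)\<^sup>2 \<le> mpoly_eval f y" if y: "y \<in> ?D" "dist y z < r" for y
      proof -
        have "\<nu> / L * (mpoly_eval e y)\<^sup>2 \<le> \<nu> / L * (L * (norm (y - z))\<^sup>2)"
          using y(1) \<nu>(1) L(1) by (intro mult_left_mono L(2)) auto
        also have "\<dots> \<le> mpoly_eval f y" using \<nu>(3)[OF y(2)] L(1) by simp
        finally show ?thesis .
      qed
      then show ?thesis using \<nu>(1,2) L(1) by (intro disjI2 exI[of _ "\<nu> / L"] conjI exI[of _ r]) auto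
    next
      case False
      then have "mpoly_eval f z \<noteq> 0" using zero_in[of z] z D_ne[of z] by blast
      then show ?thesis using nn[of z] z by simp
    qed
  qed simp
  then obtain \<kappa>2 where \<kappa>2: "0 < \<kappa>2" "\<And>x. x \<in> ?K \<Longrightarrow> 0 \<le> mpoly_eval t x \<Longrightarrow> \<kappa>2 * (mpoly_eval e x)\<^sup>2 \<le> mpoly_eval f x"
    by blast
  have "\<exists>\<kappa>>0. \<forall>x\<in>?D. \<kappa> * 1 \<le> mpoly_eval w x"
    by (rule compact_local_domination[OF cD cont continuous_on_const]) (use e1w D_ne in auto)
  then obtain w0 where w0: "0 < w0" "\<And>x. x \<in> ?K \<Longrightarrow> 0 \<le> mpoly_eval t x \<Longrightarrow> w0 \<le> mpoly_eval w x" by auto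
  obtain T where T: "0 < T" "\<And>x. x \<in> ?K \<Longrightarrow> \<bar>mpoly_eval t x\<bar> \<le> T" using compact_mpoly_bound[OF K] by blast
  \<comment> \<open>The first bound makes \<open>F\<close> positive where t < 0, the second makes
    \<open>c\<close> nonnegative where t \<ge> 0.\<close>
  define \<delta> where "\<delta> = min (\<kappa>1 / 2) (\<kappa>2 * w0 / (2 * T))"
  have \<delta>: "0 < \<delta>" "\<delta> < \<kappa>1" "\<delta> * T < \<kappa>2 * w0"
  proof -
    show "0 < \<delta>" "\<delta> < \<kappa>1" using \<kappa>1(1) \<kappa>2(1) w0(1) T(1) by (auto simp: \<delta>_def)
    have "\<delta> * T \<le> \<kappa>2 * w0 / (2 * T) * T" using T(1) by (intro mult_right_mono) (auto simp: \<delta>_def)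
    also have "\<dots> < \<kappa>2 * w0" using \<kappa>2(1) w0(1) T(1) by simp
    finally show "\<delta> * T < \<kappa>2 * w0" .
  qed

  define F where "F = f * 1 + S\<^sup>2 * (S\<^sup>2 * mconst \<delta> * t)"
  define c where "c = f * w + e\<^sup>2 * (- (e\<^sup>2 * mconst \<delta> * t))"
  have Fx: "mpoly_eval F x = mpoly_eval f x + \<delta> * mpoly_eval s x * mpoly_eval t x" for x
    by (simp add: F_def s_def mpoly_eval_simps power2_eq_square)
  have cx: "mpoly_eval c x = mpoly_eval f x * mpoly_eval w x - \<delta> * mpoly_eval e x ^ 4 * mpoly_eval t x" for x
    by (simp add: c_def mpoly_eval_simps power2_eq_square power4_eq_xxxx)

  have "F \<in> M"
  proof (rule single_zero_mem[OF M])
    show "nondeg_zero F p" unfolding F_def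
      by (rule nondeg_zero_perturb[OF nd[OF insertI1]]) (simp_all add: mpoly_eval_simps Sx)
    fix x assume x: "x \<in> ?K" "x \<noteq> p"
    show "0 < mpoly_eval F x"
    proof (cases "0 \<le> mpoly_eval t x")
      case True
      have "0 \<le> \<delta> * mpoly_eval s x * mpoly_eval t x" using True \<delta>(1) s_pos[OF x(2)] by simp
      moreover have "0 < \<delta> * mpoly_eval s x * mpoly_eval t x" if "mpoly_eval f x = 0"
        using zero_in[OF x(1) that] x(2) tZ \<delta>(1) s_pos[OF x(2)] by simp
      ultimately show ?thesis using nn[OF x(1)] unfolding Fx by (cases "mpoly_eval f x = 0") auto
    next
      case False
      have "- 1 \<le> mpoly_eval t x" using C(1) s_pos[OF x(2)] by (simp add: tx)
      then have "\<delta> * mpoly_eval s x * (- 1) \<le> \<delta> * mpoly_eval s x * mpoly_eval t x"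
        using \<delta>(1) s_pos[OF x(2)] by (intro mult_left_mono) auto
      moreover have "\<delta> * mpoly_eval s x < \<kappa>1 * mpoly_eval s x" using \<delta>(2) s_pos[OF x(2)] by simp
      ultimately show ?thesis using \<kappa>1(2)[OF x(1)] False unfolding Fx by linarith
    qed
  qed
  moreover have "c \<in> M"
  proof (rule IH)
    have c_pos: "0 \<le> mpoly_eval c x \<and> (mpoly_eval c x = 0 \<longrightarrow> x \<in> Z)" if x: "x \<in> ?K" for x
    proof (cases "0 \<le> mpoly_eval t x")
      case True
      note xp = D_ne[OF True]
      have wx: "0 < mpoly_eval w x" using e1w[OF x xp] by simp
      show ?thesis
      proof (cases "mpoly_eval e x = 0")
        case True
        then show ?thesis using nn[OF x] wx zero_in[OF x] xp by (auto simp: cx)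
      next
        case False
        have "mpoly_eval e x ^ 4 \<le> (mpoly_eval e x)\<^sup>2"
          using power_decreasing[of 2 4 "\<bar>mpoly_eval e x\<bar>"] e1w[OF x xp] by (simp add: power_abs)
        moreover have less: "\<delta> * mpoly_eval t x < \<kappa>2 * w0"
          using mult_left_mono[of "mpoly_eval t x" T \<delta>] \<delta> abs_le_D1[OF T(2)[OF x]] by linarith
        ultimately have "\<delta> * mpoly_eval t x * mpoly_eval e x ^ 4 < \<kappa>2 * w0 * (mpoly_eval e x)\<^sup>2"
          using False \<delta>(1) True \<kappa>2(1) w0(1) by (intro mult_less_le_imp_less[OF less]) auto
        also have "\<dots> = \<kappa>2 * (mpoly_eval e x)\<^sup>2 * w0" by simp
        also have "\<dots> \<le> mpoly_eval f x * mpoly_eval w x"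
          using \<kappa>2(2)[OF x True] w0(2)[OF x True] w0(1) nn[OF x] by (intro mult_mono) auto
        finally show ?thesis by (simp add: cx mult_ac)
      qed
    next
      case False
      have "0 < mpoly_eval c x"
      proof (cases "x = p")
        case True
        then show ?thesis using nondeg_zero_eval[OF nd[OF insertI1]] \<delta>(1) e_eq[of p] by (simp add: cx tx s_p)
      next
        case xp: False
        have "mpoly_eval f x \<noteq> 0" using zero_in[OF x] xp tZ[of x] False by fastforce
        then have "0 < mpoly_eval f x * mpoly_eval w x" using nn[OF x] e1w[OF x xp] by simp
        moreover have "\<delta> * mpoly_eval e x ^ 4 * mpoly_eval t x \<le> 0"
          using False \<delta>(1) by (intro mult_nonneg_nonpos) auto
        ultimately show ?thesis by (simp add: cx)
      qed
      then show ?thesis by simp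
    qed
    show "0 \<le> mpoly_eval c x" if "x \<in> ?K" for x using c_pos[OF that] by simp
    show "x \<in> Z" if "x \<in> ?K" "mpoly_eval c x = 0" for x using c_pos[OF that(1)] that(2) by simp
    fix q assume q: "q \<in> Z"
    then have "q \<noteq> p" using pZ by auto
    have "mpoly_eval s q * mpoly_eval w q = 1" using e_eq[of q] eZ[OF q] by simp
    then have "0 < mpoly_eval w q" using zero_less_mult_pos[OF _ s_pos[OF \<open>q \<noteq> p\<close>]] by simp
    then show "nondeg_zero c q" unfolding c_def
      by (rule nondeg_zero_perturb[OF nd[OF insertI2[OF q]] _ eZ[OF q]]) (simp add: mpoly_eval_simps eZ[OF q])
  qed
  \<comment> \<open>Both multipliers are squares, and the two corrections by \<delta> cancel in the
    sum.\<close>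
  ultimately have "(e\<^sup>2)\<^sup>2 * F + (S\<^sup>2)\<^sup>2 * c \<in> M"
    by (intro quad_module_add[OF M(1)] quad_module_sq_mult[OF M(1)])
  moreover have "(e\<^sup>2)\<^sup>2 * F + (S\<^sup>2)\<^sup>2 * c = f * (e ^ 4 + s * w)"
    unfolding F_def c_def s_def by (simp add: algebra_simps power2_eq_square power4_eq_xxxx)
  moreover have "e ^ 4 + s * w = 1" unfolding ew[symmetric] by simp
  ultimately show ?case by simp
qed


section \<open>Morse polynomials\<close>

text \<open>The coefficients of the derivative are again polynomials, so the statement can be
  iterated for the Hessian.\<close>

lemma mpoly_has_derivative:
  fixes f :: "'n::finite real_mpoly"
  shows "\<exists>D. \<forall>x. (mpoly_eval f has_derivative (\<lambda>h. \<Sum>k\<in>UNIV. mpoly_eval (D k) x * h $ k)) (at x)"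
proof (induct f rule: mpoly_induct)
  case (const c)
  have "mpoly_eval (mconst c) = (\<lambda>_. c)" by (simp add: fun_eq_iff mpoly_eval_simps)
  then show ?case by (intro exI[of _ "\<lambda>_. 0"]) (simp add: mpoly_eval_simps)
next
  case (var i)
  have "mpoly_eval (mvar i) = (\<lambda>x. x $ i)" by (simp add: fun_eq_iff mpoly_eval_simps)
  moreover have "(\<Sum>k\<in>UNIV. mpoly_eval (if k = i then 1 else 0) x * h $ k) = h $ i" for x h :: "real ^ 'n"
    by (simp add: if_distrib[of "\<lambda>p. mpoly_eval p x * _"] mpoly_eval_simps cong: if_cong)
  ultimately show ?case
    by (intro exI[of _ "\<lambda>k. if k = i then 1 else 0"])
       (simp add: bounded_linear.has_derivative[OF bounded_linear_vec_nth has_derivative_ident])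
next
  case (add a b)
  then obtain D E where
    D: "\<And>x. (mpoly_eval a has_derivative (\<lambda>h. \<Sum>k\<in>UNIV. mpoly_eval (D k) x * h $ k)) (at x)" and
    E: "\<And>x. (mpoly_eval b has_derivative (\<lambda>h. \<Sum>k\<in>UNIV. mpoly_eval (E k) x * h $ k)) (at x)" by blast
  have e: "mpoly_eval (a + b) = (\<lambda>x. mpoly_eval a x + mpoly_eval b x)" by (simp add: fun_eq_iff mpoly_eval_simps)
  have "(mpoly_eval (a + b) has_derivative (\<lambda>h. \<Sum>k\<in>UNIV. mpoly_eval (D k + E k) x * h $ k)) (at x)" for x
    unfolding e by (rule has_derivative_eq_rhs[OF has_derivative_add[OF D E]])
      (simp add: mpoly_eval_simps distrib_right sum.distrib)
  then show ?case by (intro exI[of _ "\<lambda>k. D k + E k"] allI)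
next
  case (mult a b)
  then obtain D E where
    D: "\<And>x. (mpoly_eval a has_derivative (\<lambda>h. \<Sum>k\<in>UNIV. mpoly_eval (D k) x * h $ k)) (at x)" and
    E: "\<And>x. (mpoly_eval b has_derivative (\<lambda>h. \<Sum>k\<in>UNIV. mpoly_eval (E k) x * h $ k)) (at x)" by blast
  have e: "mpoly_eval (a * b) = (\<lambda>x. mpoly_eval a x * mpoly_eval b x)" by (simp add: fun_eq_iff mpoly_eval_simps)
  have "(mpoly_eval (a * b) has_derivative (\<lambda>h. \<Sum>k\<in>UNIV. mpoly_eval (a * E k + D k * b) x * h $ k)) (at x)" for x
    unfolding e by (rule has_derivative_eq_rhs[OF has_derivative_mult[OF D E]])
      (simp add: fun_eq_iff mpoly_eval_simps distrib_left distrib_right sum.distrib sum_distrib_left sum_distrib_right mult_ac)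
  then show ?case by (intro exI[of _ "\<lambda>k. a * E k + D k * b"] allI)
qed

lemma mpoly_family_has_derivative:
  "\<exists>D. \<forall>j x. (mpoly_eval (E j) has_derivative (\<lambda>h. \<Sum>k\<in>UNIV. mpoly_eval (D j k) x * h $ k)) (at x)"
  by (rule choice, rule allI, rule mpoly_has_derivative)

lemma sum_axis: "(\<Sum>k\<in>UNIV. c k * axis j (1::real) $ k) = c (j :: 'n::finite)"
  by (simp add: axis_def if_distrib[of "\<lambda>x. _ * x"] cong: if_cong)

lemma partial_deriv_eq:
  assumes "(f has_derivative (\<lambda>h. \<Sum>k\<in>UNIV. c k * h $ k)) (at x)"
  shows "partial_deriv j f x = c j"
  unfolding partial_deriv_def frechet_derivative_at[OF assms, symmetric] by (rule sum_axis)

lemma has_derivative_expansion: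
  fixes E :: "'n::finite \<Rightarrow> 'n real_mpoly"
  assumes D: "\<And>j. (mpoly_eval (E j) has_derivative (\<lambda>h. \<Sum>k\<in>UNIV. mpoly_eval (D j k) x * h $ k)) (at x)"
  shows "(mpoly_eval (\<Sum>j\<in>UNIV. E j * centred_var p j) has_derivative
    (\<lambda>h. \<Sum>k\<in>UNIV. mpoly_eval ((\<Sum>j\<in>UNIV. D j k * centred_var p j) + E k) x * h $ k)) (at x)"
proof -
  have e: "mpoly_eval (\<Sum>j\<in>UNIV. E j * centred_var p j) = (\<lambda>x. \<Sum>j\<in>UNIV. mpoly_eval (E j) x * (x - p) $ j)"
    by (simp add: fun_eq_iff mpoly_eval_simps mpoly_eval_centred_var)
  have "((\<lambda>x. (x - p) $ j) has_derivative (\<lambda>h. h $ j)) (at x)" for j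
    by (rule bounded_linear.has_derivative[OF bounded_linear_vec_nth])
       (auto intro!: derivative_eq_intros)
  then have "((\<lambda>x. \<Sum>j\<in>UNIV. mpoly_eval (E j) x * (x - p) $ j) has_derivative
      (\<lambda>h. \<Sum>j\<in>UNIV. mpoly_eval (E j) x * h $ j + (\<Sum>k\<in>UNIV. mpoly_eval (D j k) x * h $ k) * (x - p) $ j)) (at x)"
    by (intro has_derivative_sum has_derivative_mult D)
  then show ?thesis unfolding e
  proof (rule has_derivative_eq_rhs, intro ext)
    fix h :: "real ^ 'n"
    have "(\<Sum>j\<in>UNIV. (\<Sum>k\<in>UNIV. mpoly_eval (D j k) x * h $ k) * (x - p) $ j)
        = (\<Sum>k\<in>UNIV. \<Sum>j\<in>UNIV. mpoly_eval (D j k) x * (x - p) $ j * h $ k)"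
      unfolding sum_distrib_right by (subst sum.swap) (simp add: mult_ac)
    then show "(\<Sum>j\<in>UNIV. mpoly_eval (E j) x * h $ j + (\<Sum>k\<in>UNIV. mpoly_eval (D j k) x * h $ k) * (x - p) $ j)
        = (\<Sum>k\<in>UNIV. mpoly_eval ((\<Sum>j\<in>UNIV. D j k * centred_var p j) + E k) x * h $ k)"
      by (simp add: mpoly_eval_simps mpoly_eval_centred_var sum.distrib distrib_right sum_distrib_right)
  qed
qed

text \<open>The first-order expansion is applied twice: at a critical point the coefficients
  \<open>E k\<close> vanish and can be expanded again. The Hessian entry is then B k l + B l k at p,
  and symmetrising B gives the factor 2.\<close>

lemma critical_zero_expansion:
  fixes f :: "'n::finite real_mpoly"
  assumes f0: "mpoly_eval f p = 0" and crit: "(mpoly_eval f has_derivative (\<lambda>_. 0)) (at p)"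
  obtains B where "\<And>k l. B k l = B l k"
    "f = (\<Sum>k\<in>UNIV. \<Sum>l\<in>UNIV. B k l * centred_var p k * centred_var p l)"
    "\<And>k l. hessian (mpoly_eval f) p $ k $ l = 2 * mpoly_eval (B k l) p"
proof -
  obtain E where E: "f = (\<Sum>k\<in>UNIV. E k * centred_var p k)" using expand_at_zero[OF f0] .
  obtain D where D: "\<And>j x. (mpoly_eval (E j) has_derivative (\<lambda>h. \<Sum>k\<in>UNIV. mpoly_eval (D j k) x * h $ k)) (at x)"
    using mpoly_family_has_derivative by blast
  define G where "G k = (\<Sum>j\<in>UNIV. D j k * centred_var p j) + E k" for k
  have fG: "(mpoly_eval f has_derivative (\<lambda>h. \<Sum>k\<in>UNIV. mpoly_eval (G k) x * h $ k)) (at x)" for x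
    unfolding E G_def by (rule has_derivative_expansion[OF D])
  have Gp: "mpoly_eval (G k) p = mpoly_eval (E k) p" for k
    by (simp add: G_def mpoly_eval_simps mpoly_eval_centred_var)
  have E0: "mpoly_eval (E k) p = 0" for k
    using fun_cong[OF has_derivative_unique[OF crit fG], of "axis k 1"] by (simp add: sum_axis Gp)
  have "\<exists>B. E k = (\<Sum>l\<in>UNIV. B l * centred_var p l)" for k
    by (rule expand_at_zero[OF E0[of k]]) blast
  then have "\<exists>B. \<forall>k. E k = (\<Sum>l\<in>UNIV. B k l * centred_var p l)" by (intro choice allI)
  then obtain B where B: "\<And>k. E k = (\<Sum>l\<in>UNIV. B k l * centred_var p l)" by blast
  \<comment> \<open>At \<open>p\<close> the centred variables vanish, so the partial derivative of
    \<open>E j\<close> reduces to \<open>B j k\<close>.\<close>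
  have DB: "mpoly_eval (D j k) p = mpoly_eval (B j k) p" for j k
  proof -
    obtain D' where D': "\<And>l x. (mpoly_eval (B j l) has_derivative (\<lambda>h. \<Sum>k\<in>UNIV. mpoly_eval (D' l k) x * h $ k)) (at x)"
      using mpoly_family_has_derivative by blast
    have "(mpoly_eval (E j) has_derivative
        (\<lambda>h. \<Sum>k\<in>UNIV. mpoly_eval ((\<Sum>l\<in>UNIV. D' l k * centred_var p l) + B j k) p * h $ k)) (at p)"
      unfolding B by (rule has_derivative_expansion[OF D'])
    from partial_deriv_eq[OF this, of k] partial_deriv_eq[OF D[of j p], of k] show ?thesis
      by (simp add: mpoly_eval_simps mpoly_eval_centred_var)
  qed
  have H: "hessian (mpoly_eval f) p $ k $ l = mpoly_eval (B k l) p + mpoly_eval (B l k) p" for k l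
  proof -
    have 1: "partial_deriv l (mpoly_eval f) = mpoly_eval (G l)"
      using partial_deriv_eq[OF fG] by (simp add: fun_eq_iff)
    obtain D' where D': "\<And>j x. (mpoly_eval (D j l) has_derivative (\<lambda>h. \<Sum>k\<in>UNIV. mpoly_eval (D' j k) x * h $ k)) (at x)"
      using mpoly_family_has_derivative[of "\<lambda>j. D j l"] by blast
    have e: "mpoly_eval (G l) = (\<lambda>x. mpoly_eval (\<Sum>j\<in>UNIV. D j l * centred_var p j) x + mpoly_eval (E l) x)"
      by (simp add: fun_eq_iff G_def mpoly_eval_simps)
    have "(mpoly_eval (G l) has_derivative (\<lambda>h. \<Sum>k\<in>UNIV.
        (mpoly_eval ((\<Sum>j\<in>UNIV. D' j k * centred_var p j) + D k l) p + mpoly_eval (D l k) p) * h $ k)) (at p)"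
      unfolding e by (rule has_derivative_eq_rhs[OF has_derivative_add[OF has_derivative_expansion[OF D'] D]])
        (simp add: sum.distrib distrib_right)
    from partial_deriv_eq[OF this, of k] show ?thesis
      by (simp add: hessian_def 1 mpoly_eval_simps mpoly_eval_centred_var DB)
  qed
  define B' where "B' k l = mconst (1/2) * (B k l + B l k)" for k l
  have f: "f = (\<Sum>k\<in>UNIV. \<Sum>l\<in>UNIV. B k l * centred_var p k * centred_var p l)"
    unfolding E B by (simp add: sum_distrib_left sum_distrib_right ac_simps)
  have f': "f = (\<Sum>k\<in>UNIV. \<Sum>l\<in>UNIV. B l k * centred_var p k * centred_var p l)"
    unfolding f by (subst sum.swap) (simp add: ac_simps)
  have "mconst (1/2) + mconst (1/2) = (1 :: 'n real_mpoly)"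
    unfolding mconst_simps(3)[symmetric] by (simp add: mconst_simps)
  then have "f = mconst (1/2) * f + mconst (1/2) * f" unfolding distrib_right[symmetric] by simp
  also have "\<dots> = mconst (1/2) * (\<Sum>k\<in>UNIV. \<Sum>l\<in>UNIV. B k l * centred_var p k * centred_var p l)
      + mconst (1/2) * (\<Sum>k\<in>UNIV. \<Sum>l\<in>UNIV. B l k * centred_var p k * centred_var p l)"
    unfolding f[symmetric] f'[symmetric] ..
  also have "\<dots> = (\<Sum>k\<in>UNIV. \<Sum>l\<in>UNIV. B' k l * centred_var p k * centred_var p l)"
    unfolding B'_def by (simp add: sum_distrib_left sum.distrib distrib_left distrib_right mult.assoc)
  finally have "f = (\<Sum>k\<in>UNIV. \<Sum>l\<in>UNIV. B' k l * centred_var p k * centred_var p l)" .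
  moreover have "B' k l = B' l k" for k l by (simp add: B'_def add.commute)
  moreover have "hessian (mpoly_eval f) p $ k $ l = 2 * mpoly_eval (B' k l) p" for k l
    by (simp add: H B'_def mpoly_eval_simps)
  ultimately show ?thesis using that by blast
qed

text \<open>For w with w^T H w = 0 and u = H w, nonnegativity at w - t u reads 2 t |u|^2 \<le> t^2
  b; a small t > 0 forces u = 0, against invertibility.\<close>

lemma psd_invertible_imp_pd:
  fixes H :: "real ^ 'n ^ 'n"
  assumes sym: "transpose H = H" and inv: "invertible H" and psd: "\<And>v. 0 \<le> v \<bullet> (H *v v)" and w: "w \<noteq> 0"
  shows "0 < w \<bullet> (H *v w)"
proof (rule ccontr)
  assume "\<not> 0 < w \<bullet> (H *v w)"
  then have w0: "w \<bullet> (H *v w) = 0" using psd[of w] by simp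
  define u where "u = H *v w"
  define b where "b = u \<bullet> (H *v u)"
  have s: "x \<bullet> (H *v y) = y \<bullet> (H *v x)" for x y
    using dot_lmul_matrix[of x H y] sym by (metis inner_commute transpose_matrix_vector)
  have q: "2 * t * (u \<bullet> u) \<le> t\<^sup>2 * b" for t
  proof -
    have "(w - t *\<^sub>R u) \<bullet> (H *v (w - t *\<^sub>R u)) = w \<bullet> (H *v w) - t * (w \<bullet> (H *v u)) - t * (u \<bullet> (H *v w)) + t\<^sup>2 * b"
      by (simp add: matrix_vector_mult_diff_distrib matrix_vector_mult_scaleR inner_diff_left inner_diff_right
          b_def power2_eq_square algebra_simps)
    also have "\<dots> = t\<^sup>2 * b - 2 * t * (u \<bullet> u)" unfolding s[of w u] w0 by (simp flip: u_def)
    finally show ?thesis using psd[of "w - t *\<^sub>R u"] by simp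
  qed
  have "u \<bullet> u = 0"
  proof (rule ccontr)
    assume "u \<bullet> u \<noteq> 0"
    then have u: "0 < u \<bullet> u" by simp
    have b: "0 \<le> b" using psd by (simp add: b_def)
    \<comment> \<open>Adding 1 keeps the denominator positive for b = 0 and still gives t b \<le>
      |u|^2.\<close>
    define t where "t = u \<bullet> u / (b + 1)"
    have t: "0 < t" "t * b \<le> u \<bullet> u" using u b by (auto simp: t_def field_simps)
    have "t * (2 * (u \<bullet> u)) \<le> t * (t * b)" using q[of t] by (simp add: power2_eq_square mult_ac)
    then show False using t u by simp
  qed
  then have "H *v w = 0" by (simp add: u_def)
  then show False using inv w matrix_left_invertible_ker[of H] unfolding invertible_def by blast
qed

text \<open>A zero with \<open>f\<close> nonnegative around it is a critical point, and the form at
  \<open>p\<close> is the limit of f(p + t v) / t^2 as t decreases to 0, hence nonnegative;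
  invertibility of the Hessian makes it definite.\<close>

lemma nondeg_zero_if_morse:
  fixes f :: "'n::finite real_mpoly"
  assumes morse: "morse (mpoly_eval f)" and U: "open U" "p \<in> U"
    and nn: "\<And>x. x \<in> U \<Longrightarrow> 0 \<le> mpoly_eval f x" and f0: "mpoly_eval f p = 0"
  shows "nondeg_zero f p"
proof -
  obtain D where D: "(mpoly_eval f has_derivative (\<lambda>h. \<Sum>k\<in>UNIV. mpoly_eval (D k) p * h $ k)) (at p)"
    using mpoly_has_derivative by blast
  have crit: "(mpoly_eval f has_derivative (\<lambda>_. 0)) (at p)"
    using D differential_zero_maxmin[OF U(2,1) D] nn f0 by simp
  define H where "H = hessian (mpoly_eval f) p"
  have inv: "invertible H" using morse crit unfolding morse_def H_def by blast
  obtain B where sym: "\<And>k l. B k l = B l k"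
    and f: "f = (\<Sum>k\<in>UNIV. \<Sum>l\<in>UNIV. B k l * centred_var p k * centred_var p l)"
    and H: "\<And>k l. H $ k $ l = 2 * mpoly_eval (B k l) p"
    using critical_zero_expansion[OF f0 crit] unfolding H_def by blast
  have HB: "v \<bullet> (H *v v) = 2 * form B p v" for v
    by (simp add: inner_vec_def matrix_vector_mult_def H sum_distrib_left mult_ac)
  have psd: "0 \<le> form B p v" for v
  proof (rule tendsto_lowerbound)
    let ?F = "at_right (0::real)"
    have c: "((\<lambda>t. p + t *\<^sub>R v) \<longlongrightarrow> p) ?F"
      by (rule tendsto_eq_intros refl | simp)+
    have ev: "((\<lambda>t. mpoly_eval h (p + t *\<^sub>R v)) \<longlongrightarrow> mpoly_eval h p) ?F" for h
    proof (rule isCont_tendsto_compose[OF _ c])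
      show "isCont (mpoly_eval h) p"
        using continuous_on_mpoly_eval[OF continuous_on_id, of UNIV h] by (simp add: continuous_on_eq_continuous_at)
    qed
    show "((\<lambda>t. form B (p + t *\<^sub>R v) v) \<longlongrightarrow> form B p v) ?F"
      by (intro tendsto_sum tendsto_mult ev tendsto_const)
    have "eventually (\<lambda>t. p + t *\<^sub>R v \<in> U) ?F" using topological_tendstoD[OF c U] .
    moreover have "eventually (\<lambda>t. 0 < t) ?F" by (rule eventually_at_right_less)
    ultimately show "eventually (\<lambda>t. 0 \<le> form B (p + t *\<^sub>R v) v) ?F"
    proof eventually_elim
      case (elim t)
      have "mpoly_eval f (p + t *\<^sub>R v) = t\<^sup>2 * form B (p + t *\<^sub>R v) v"
        unfolding f mpoly_eval_form add_diff_cancel_left' form_scale ..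
      then show ?case using nn[OF elim(1)] elim(2) by (simp add: zero_le_mult_iff)
    qed
  qed simp
  have "transpose H = H" unfolding transpose_def by (subst vec_eq_iff, subst vec_eq_iff) (simp add: H sym)
  then have "0 < form B p v" if "v \<noteq> 0" for v
    using psd_invertible_imp_pd[OF _ inv _ that] psd by (simp add: HB)
  then show ?thesis unfolding nondeg_zero_def using sym f by blast
qed

theorem theorem2p2:
  fixes m :: nat
    and g :: "nat \<Rightarrow> 'n::finite real_mpoly"
    and f :: "'n real_mpoly"
  assumes "morse (mpoly_eval f)"
    and "\<forall>x\<in>nonneg_set m g. mpoly_eval f x \<ge> 0"
    and "finite {x \<in> nonneg_set m g. mpoly_eval f x = 0}"
    and "{x \<in> nonneg_set m g. mpoly_eval f x = 0} \<subseteq> interior (nonneg_set m g)"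
  shows "(compact (nonneg_set m g) \<longrightarrow> f \<in> generated_preordering m g) \<and>
         (archimedean (generated_quadratic_module m g) \<longrightarrow> f \<in> generated_quadratic_module m g)"
proof -
  have mem: "f \<in> M" if M: "quad_module M" "archimedean M" and g: "\<And>i. i \<in> {1..m} \<Longrightarrow> g i \<in> M" for M
  proof (rule finitely_many_nondeg_zeros_mem[OF M assms(3)])
    have sub: "x \<in> nonneg_set m g" if "x \<in> real_points M" for x
      using that g unfolding real_points_def nonneg_set_def by blast
    show "0 \<le> mpoly_eval f x" if "x \<in> real_points M" for x using assms(2) sub[OF that] by blast
    show "x \<in> {x \<in> nonneg_set m g. mpoly_eval f x = 0}" if "x \<in> real_points M" "mpoly_eval f x = 0" for x
      using sub[OF that(1)] that(2) by blast
    fix p assume p: "p \<in> {x \<in> nonneg_set m g. mpoly_eval f x = 0}"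
    show "nondeg_zero f p"
      by (rule nondeg_zero_if_morse[OF assms(1) open_interior[of "nonneg_set m g"]])
        (use p assms(2,4) interior_subset[of "nonneg_set m g"] in auto)
  qed
  have "f \<in> generated_preordering m g" if "compact (nonneg_set m g)"
    using mem[OF preordering_imp_quad_module[OF preordering_generated]
      archimedean_if_compact[OF preordering_generated generator_in_preordering that] generator_in_preordering] .
  moreover have "f \<in> generated_quadratic_module m g" if "archimedean (generated_quadratic_module m g)"
    using mem[OF quad_module_generated that generator_in_quadratic_module] .
  ultimately show ?thesis by blast
qed

end
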